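(* Let $G$ be a totally disconnected, locally compact group, let $x\in G$, let $U\leq G$ be a compact open subgroup tidy for $x$, and suppose that $s(x^{-1})=q$ is greater than $1$. Put $V = U_-$ and $H=U_{--}$, and let $\rho : H\rtimes\langle x\rangle\to \mathrm{Isom}(T_{q+1})_\omega$ be the scale group representation determined by $V$ and $x$. Then the scale group representation $\rho$ of $H\rtimes\langle x\rangle$ is unique up to conjugacy (that is, every scale group representation of $H\rtimes\langle x\rangle$ on $T_{q+1}$ is conjugate to $\rho$) if and only if the action of $V$ by left translation on the coset space $V/xVx^{-1}$ is primitive.
   Context: For a compact open subgroup $U$ of $G$ and $x\in G$, put $U_{\pm}=\bigcap_{n\ge0}x^{\pm n}Ux^{\mp n}$ read so that $U_+=\bigcap_{n\ge0}x^{n}Ux^{-n}$ and $U_-=\bigcap_{n\ge0}x^{-n}Ux^{n}$, and $U_{--}=\bigcup_{n\in\mathbb{Z}}x^nU_-x^{-n}$. $U$ is tidy for $x$ if $U=U_+U_-$ and $U_{--}$ is closed. The scale of $y\in G$ is $s(y)=\min_W[yWy^{-1}:yWy^{-1}\cap W]$ over compact open subgroups $W\leq G$. One has $xVx^{-1}\leq V$ and $[V:xVx^{-1}]=s(x^{-1})=q$. $T_{q+1}$ is the tree in which every vertex has $q+1$ neighbours, $\omega$ is a fixed end of it, $\mathrm{Isom}(T_{q+1})$ has the topology of pointwise convergence on vertices, and $\mathrm{Isom}(T_{q+1})_\omega$ is the stabiliser of $\omega$. A scale group is a closed subgroup of $\mathrm{Isom}(T_{q+1})$ that fixes $\omega$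 and is transitive on vertices. Here $H\rtimes\langle x\rangle$ has the topology in which $H$ (with its subspace topology from $G$) is open. A scale group representation of $H\rtimes\langle x\rangle$ on $T_{q+1}$ is a continuous homomorphism $H\rtimes\langle x\rangle\to\mathrm{Isom}(T_{q+1})_\omega$ whose image is a scale group. The representation $\rho$ is the following one. The graph with vertex set $\bigsqcup_{n\in\mathbb{Z}}H/x^{n}Vx^{-n}$ and edges $\{g\,x^nVx^{-n},\,g\,x^{n+1}Vx^{-n-1}\}$ ($g\in H$, $n\in\mathbb{Z}$) is isomorphic to $T_{q+1}$; it is identified with $T_{q+1}$ so that the common end of all the rays $(g\,x^{-n}Vx^{n})_{n\ge 0}$, $g\in H$, is $\omega$. The group $H$ acts on it by left translation and $x$ acts by $x.(g\,x^{n}Vx^{-n})=(xgx^{-1})\,x^{n+1}Vx^{-n-1}$; $\rho$ is the resulting homomorphism (its image is a scale group, and $V$ is the stabiliser of a vertex). Two scale group representations $\rho_1,\rho_2$ of $H\rtimes\langle x\rangle$ on $T_{q+1}$ are conjugate if there is $\sigma\in\mathrm{Isom}(T_{q+1})_\omega$ with $\rho_2(g)=\sigma\rho_1(g)\sigma^{-1}$ for all $g$. *)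

theory Defs
  imports
    "HOL-Analysis.Analysis"
    "HOL-Algebra.Group_Action"
    "HOL-Algebra.Left_Coset"
    "HOL-Algebra.Generated_Groups"
begin

section \<open>Totally disconnected, locally compact groups\<close>

locale topological_group = group G for G (structure) +
  fixes X :: "'a topology"
  assumes topspace_eq: "topspace X = carrier G"
    and continuous_mult: "continuous_map (prod_topology X X) X (\<lambda>(a, b). a \<otimes> b)"
    and continuous_inv: "continuous_map X X (\<lambda>a. inv a)"

locale tdlc_group = topological_group +
  assumes Hausdorff: "Hausdorff_space X"
    and locally_compact: "locally_compact_space X"
    and totally_disconnected: "\<And>S. connectedin X S \<Longrightarrow> \<exists>a. S \<subseteq> {a}"

definition compact_open_subgroup :: "('a, 'm) monoid_scheme \<Rightarrow> 'a topology \<Rightarrow> 'a set \<Rightarrow> bool"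
  where "compact_open_subgroup G X U \<longleftrightarrow> subgroup U G \<and> compactin X U \<and> openin X U"

definition conj_set :: "('a, 'm) monoid_scheme \<Rightarrow> 'a \<Rightarrow> 'a set \<Rightarrow> 'a set"
  where "conj_set G a S = (\<lambda>s. a \<otimes>\<^bsub>G\<^esub> s \<otimes>\<^bsub>G\<^esub> inv\<^bsub>G\<^esub> a) ` S"

definition plus_part :: "('a, 'm) monoid_scheme \<Rightarrow> 'a \<Rightarrow> 'a set \<Rightarrow> 'a set"
  where "plus_part G x U = (\<Inter>n::nat. conj_set G (x [^]\<^bsub>G\<^esub> int n) U)"

definition minus_part :: "('a, 'm) monoid_scheme \<Rightarrow> 'a \<Rightarrow> 'a set \<Rightarrow> 'a set"
  where "minus_part G x U = (\<Inter>n::nat. conj_set G (x [^]\<^bsub>G\<^esub> (- int n)) U)"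

definition minus_minus_part :: "('a, 'm) monoid_scheme \<Rightarrow> 'a \<Rightarrow> 'a set \<Rightarrow> 'a set"
  where "minus_minus_part G x U = (\<Union>n::int. conj_set G (x [^]\<^bsub>G\<^esub> n) (minus_part G x U))"

definition tidy :: "('a, 'm) monoid_scheme \<Rightarrow> 'a topology \<Rightarrow> 'a \<Rightarrow> 'a set \<Rightarrow> bool"
  where "tidy G X x U \<longleftrightarrow>
    U = plus_part G x U <#>\<^bsub>G\<^esub> minus_part G x U \<and> closedin X (minus_minus_part G x U)"

text \<open>The index \<open>[K : L]\<close> for \<open>L \<le> K\<close>. It is 0 for an infinite index, which does not
  happen below: an open subgroup of a compact group has finite index.\<close>

definition subgroup_index :: "('a, 'm) monoid_scheme \<Rightarrow> 'a set \<Rightarrow> 'a set \<Rightarrow> nat"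
  where "subgroup_index G K L = card (lcosets\<^bsub>G\<lparr>carrier := K\<rparr>\<^esub> L)"

definition group_scale :: "('a, 'm) monoid_scheme \<Rightarrow> 'a topology \<Rightarrow> 'a \<Rightarrow> nat"
  where "group_scale G X y = (LEAST k. \<exists>W. compact_open_subgroup G X W \<and>
    k = subgroup_index G (conj_set G y W) (conj_set G y W \<inter> W))"

section \<open>Regular trees, ends and isometries\<close>

record 'v ugraph =
  verts :: "'v set"
  edges :: "'v set set"

definition simple_graph :: "'v ugraph \<Rightarrow> bool"
  where "simple_graph T \<longleftrightarrow> (\<forall>e \<in> edges T. \<exists>u \<in> verts T. \<exists>v \<in> verts T. u \<noteq> v \<and> e = {u, v})"

definition walk :: "'v ugraph \<Rightarrow> 'v list \<Rightarrow> bool"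
  where "walk T p \<longleftrightarrow> p \<noteq> [] \<and> set p \<subseteq> verts T \<and> successively (\<lambda>u v. {u, v} \<in> edges T) p"

definition tree :: "'v ugraph \<Rightarrow> bool"
  where "tree T \<longleftrightarrow> simple_graph T \<and> verts T \<noteq> {} \<and>
    (\<forall>u \<in> verts T. \<forall>v \<in> verts T. \<exists>p. walk T p \<and> hd p = u \<and> last p = v) \<and>
    \<not> (\<exists>p. walk T p \<and> distinct p \<and> length p \<ge> 3 \<and> {last p, hd p} \<in> edges T)"

definition regular_tree :: "nat \<Rightarrow> 'v ugraph \<Rightarrow> bool"
  where "regular_tree d T \<longleftrightarrow> tree T \<and>
    (\<forall>v \<in> verts T. finite {u \<in> verts T. {u, v} \<in> edges T} \<and> card {u \<in> verts T. {u, v} \<in> edges T} = d)"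

definition rays :: "'v ugraph \<Rightarrow> (nat \<Rightarrow> 'v) set"
  where "rays T = {r. range r \<subseteq> verts T \<and> inj r \<and> (\<forall>n. {r n, r (Suc n)} \<in> edges T)}"

definition cofinal :: "'v ugraph \<Rightarrow> ((nat \<Rightarrow> 'v) \<times> (nat \<Rightarrow> 'v)) set"
  where "cofinal T = {(r, s). r \<in> rays T \<and> s \<in> rays T \<and> (\<exists>m n. \<forall>k. r (m + k) = s (n + k))}"

definition ends :: "'v ugraph \<Rightarrow> (nat \<Rightarrow> 'v) set set"
  where "ends T = rays T // cofinal T"

definition graph_dist :: "'v ugraph \<Rightarrow> 'v \<Rightarrow> 'v \<Rightarrow> nat"
  where "graph_dist T u v = (LEAST n. \<exists>p. walk T p \<and> hd p = u \<and> last p = v \<and> length p = Suc n)"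

definition Isom :: "'v ugraph \<Rightarrow> ('v \<Rightarrow> 'v) set"
  where "Isom T = {\<sigma> \<in> Bij (verts T).
    \<forall>u \<in> verts T. \<forall>v \<in> verts T. graph_dist T (\<sigma> u) (\<sigma> v) = graph_dist T u v}"

definition Isom_end :: "'v ugraph \<Rightarrow> (nat \<Rightarrow> 'v) set \<Rightarrow> ('v \<Rightarrow> 'v) set"
  where "Isom_end T \<omega> = {\<sigma> \<in> Isom T. (\<lambda>r. \<sigma> \<circ> r) ` \<omega> = \<omega>}"

definition IsomGroup :: "'v ugraph \<Rightarrow> ('v \<Rightarrow> 'v) monoid"
  where "IsomGroup T = (BijGroup (verts T))\<lparr>carrier := Isom T\<rparr>"

definition IsomEndGroup :: "'v ugraph \<Rightarrow> (nat \<Rightarrow> 'v) set \<Rightarrow> ('v \<Rightarrow> 'v) monoid"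
  where "IsomEndGroup T \<omega> = (BijGroup (verts T))\<lparr>carrier := Isom_end T \<omega>\<rparr>"

text \<open>Pointwise convergence on the (discrete) vertex set. Members of \<^term>\<open>Isom T\<close> are
  extensional, so they are points of this product space.\<close>

definition isom_topology :: "'v ugraph \<Rightarrow> ('v \<Rightarrow> 'v) topology"
  where "isom_topology T =
    subtopology (product_topology (\<lambda>_. discrete_topology (verts T)) (verts T)) (Isom T)"

definition scale_group :: "'v ugraph \<Rightarrow> (nat \<Rightarrow> 'v) set \<Rightarrow> ('v \<Rightarrow> 'v) set \<Rightarrow> bool"
  where "scale_group T \<omega> P \<longleftrightarrow> subgroup P (IsomGroup T) \<and> closedin (isom_topology T) P \<and>
    P \<subseteq> Isom_end T \<omega> \<and> (\<forall>u \<in> verts T. \<forall>v \<in> verts T. \<exists>\<sigma> \<in> P. \<sigma> u = v)"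

section \<open>Scale group representations of the semidirect product\<close>

text \<open>\<open>H \<rtimes> \<langle>x\<rangle>\<close>, as an external semidirect product in which the cyclic subgroup generated by
  \<open>x\<close> acts on \<open>H\<close> by conjugation in \<open>G\<close>.\<close>

definition semidirect :: "('a, 'm) monoid_scheme \<Rightarrow> 'a set \<Rightarrow> 'a \<Rightarrow> ('a \<times> 'a) monoid"
  where "semidirect G H x =
    \<lparr>carrier = H \<times> generate G {x},
     mult = \<lambda>(h, a) (k, b). (h \<otimes>\<^bsub>G\<^esub> (a \<otimes>\<^bsub>G\<^esub> k \<otimes>\<^bsub>G\<^esub> inv\<^bsub>G\<^esub> a), a \<otimes>\<^bsub>G\<^esub> b),
     one = (\<one>\<^bsub>G\<^esub>, \<one>\<^bsub>G\<^esub>)\<rparr>"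

definition semidirect_topology ::
    "('a, 'm) monoid_scheme \<Rightarrow> 'a topology \<Rightarrow> 'a set \<Rightarrow> 'a \<Rightarrow> ('a \<times> 'a) topology"
  where "semidirect_topology G X H x =
    prod_topology (subtopology X H) (discrete_topology (generate G {x}))"

definition scale_group_rep ::
    "('a, 'm) monoid_scheme \<Rightarrow> 'a topology \<Rightarrow> 'a set \<Rightarrow> 'a \<Rightarrow> 'v ugraph \<Rightarrow> (nat \<Rightarrow> 'v) set \<Rightarrow>
      ('a \<times> 'a \<Rightarrow> 'v \<Rightarrow> 'v) \<Rightarrow> bool"
  where "scale_group_rep G X H x T \<omega> \<rho> \<longleftrightarrow>
    \<rho> \<in> hom (semidirect G H x) (IsomEndGroup T \<omega>) \<and>
    continuous_map (semidirect_topology G X H x)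
      (subtopology (isom_topology T) (Isom_end T \<omega>)) \<rho> \<and>
    scale_group T \<omega> (\<rho> ` carrier (semidirect G H x))"

definition conjugate_reps ::
    "('a, 'm) monoid_scheme \<Rightarrow> 'a set \<Rightarrow> 'a \<Rightarrow> 'v ugraph \<Rightarrow> (nat \<Rightarrow> 'v) set \<Rightarrow>
      ('a \<times> 'a \<Rightarrow> 'v \<Rightarrow> 'v) \<Rightarrow> ('a \<times> 'a \<Rightarrow> 'v \<Rightarrow> 'v) \<Rightarrow> bool"
  where "conjugate_reps G H x T \<omega> \<rho>\<^sub>1 \<rho>\<^sub>2 \<longleftrightarrow>
    (\<exists>\<sigma> \<in> Isom_end T \<omega>. \<forall>g \<in> carrier (semidirect G H x).
      \<rho>\<^sub>2 g = \<sigma> \<otimes>\<^bsub>IsomGroup T\<^esub> \<rho>\<^sub>1 g \<otimes>\<^bsub>IsomGroup T\<^esub> inv\<^bsub>IsomGroup T\<^esub> \<sigma>)"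

section \<open>The representation determined by \<open>V\<close> and \<open>x\<close>\<close>

text \<open>The vertices are tagged with their level \<open>n\<close>, which makes the union over \<open>n\<close> disjoint.\<close>

definition coset_graph ::
    "('a, 'm) monoid_scheme \<Rightarrow> 'a set \<Rightarrow> 'a \<Rightarrow> 'a set \<Rightarrow> (int \<times> 'a set) ugraph"
  where "coset_graph G H x V =
    \<lparr>verts = {(n, g <#\<^bsub>G\<^esub> conj_set G (x [^]\<^bsub>G\<^esub> n) V) | n g. g \<in> H},
     edges = {{(n, g <#\<^bsub>G\<^esub> conj_set G (x [^]\<^bsub>G\<^esub> n) V),
               (n + 1, g <#\<^bsub>G\<^esub> conj_set G (x [^]\<^bsub>G\<^esub> (n + 1)) V)} | n g. g \<in> H}\<rparr>"

definition coset_ray ::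
    "('a, 'm) monoid_scheme \<Rightarrow> 'a \<Rightarrow> 'a set \<Rightarrow> 'a \<Rightarrow> nat \<Rightarrow> int \<times> 'a set"
  where "coset_ray G x V g n = (- int n, g <#\<^bsub>G\<^esub> conj_set G (x [^]\<^bsub>G\<^esub> (- int n)) V)"

definition tree_identification ::
    "('a, 'm) monoid_scheme \<Rightarrow> 'a set \<Rightarrow> 'a \<Rightarrow> 'a set \<Rightarrow> 'v ugraph \<Rightarrow> (nat \<Rightarrow> 'v) set \<Rightarrow>
      (int \<times> 'a set \<Rightarrow> 'v) \<Rightarrow> bool"
  where "tree_identification G H x V T \<omega> \<phi> \<longleftrightarrow>
    bij_betw \<phi> (verts (coset_graph G H x V)) (verts T) \<and>
    (\<forall>u \<in> verts (coset_graph G H x V). \<forall>v \<in> verts (coset_graph G H x V).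
      {\<phi> u, \<phi> v} \<in> edges T \<longleftrightarrow> {u, v} \<in> edges (coset_graph G H x V)) \<and>
    (\<forall>g \<in> H. \<phi> \<circ> coset_ray G x V g \<in> \<omega>)"

text \<open>The action on the coset graph of \<open>(h, a)\<close> with \<open>a = x\<^sup>k\<close>: since
  \<open>x(g x\<^sup>n V x\<^sup>-\<^sup>n)x\<^sup>-\<^sup>1 = (xgx\<^sup>-\<^sup>1) x\<^sup>n\<^sup>+\<^sup>1 V x\<^sup>-\<^sup>n\<^sup>-\<^sup>1\<close>, the element \<open>x\<close> conjugates cosets and raises the level by one,
  so \<open>a\<close> conjugates cosets and raises the level by \<open>k\<close>. The exponent \<open>k\<close> is unique when \<open>x\<close>
  has infinite order, as it does when its inverse has scale greater than 1.\<close>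

definition coset_action ::
    "('a, 'm) monoid_scheme \<Rightarrow> 'a \<Rightarrow> 'a \<times> 'a \<Rightarrow> int \<times> 'a set \<Rightarrow> int \<times> 'a set"
  where "coset_action G x = (\<lambda>(h, a) (n, C).
    (n + (THE k::int. x [^]\<^bsub>G\<^esub> k = a), h <#\<^bsub>G\<^esub> conj_set G a C))"

definition coset_rep ::
    "('a, 'm) monoid_scheme \<Rightarrow> 'a set \<Rightarrow> 'a \<Rightarrow> 'a set \<Rightarrow> 'v ugraph \<Rightarrow> (int \<times> 'a set \<Rightarrow> 'v) \<Rightarrow>
      'a \<times> 'a \<Rightarrow> 'v \<Rightarrow> 'v"
  where "coset_rep G H x V T \<phi> = (\<lambda>p. \<lambda>v \<in> verts T.
    \<phi> (coset_action G x p (inv_into (verts (coset_graph G H x V)) \<phi> v)))"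

section \<open>Primitive actions\<close>

definition primitive_action :: "('a, 'm) monoid_scheme \<Rightarrow> 'b set \<Rightarrow> ('a \<Rightarrow> 'b \<Rightarrow> 'b) \<Rightarrow> bool"
  where "primitive_action K E \<alpha> \<longleftrightarrow> transitive_action K E \<alpha> \<and>
    (\<forall>R. equiv E R \<and> (\<forall>g \<in> carrier K. \<forall>(a, b) \<in> R. (\<alpha> g a, \<alpha> g b) \<in> R) \<longrightarrow>
      R = Id_on E \<or> R = E \<times> E)"

definition left_translation ::
    "('a, 'm) monoid_scheme \<Rightarrow> 'a set set \<Rightarrow> 'a \<Rightarrow> 'a set \<Rightarrow> 'a set"
  where "left_translation G E g = (\<lambda>C \<in> E. g <#\<^bsub>G\<^esub> C)"

end

theory Submission
imports Defs
begin

text \<open>Write \<open>W \<le> V\<close> for \<open>xVx\<^sup>-\<^sup>1\<close>. The action of \<open>V\<close> on \<open>V/W\<close> is primitive iff there is no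
  subgroup strictly between \<open>W\<close> and \<open>V\<close>.

  If \<open>W < L < V\<close>, then \<open>xLx\<^sup>-\<^sup>1\<close> is contained in \<open>L\<close> and again has index \<open>q\<close>, so \<open>L\<close> gives a
  representation on the same tree. Were it conjugate to \<open>\<rho>\<close>, the vertex stabilised by \<open>V\<close> would be
  sent to a vertex on the axis of \<open>x\<close>; the axis being unique, \<open>V\<close> would be a conjugate of \<open>L\<close> by a
  power of \<open>x\<close>, which the inclusions rule out.

  Conversely, let \<open>\<rho>'\<close> be any scale group representation. The orbits of the compact group \<open>V\<close> are
  finite, so \<open>H\<close> preserves the levels of the tree and \<open>x\<close> shifts them by one, necessarily away
  from \<open>\<omega>\<close> because \<open>H\<close> is the union of the groups \<open>x\<^sup>-\<^sup>nVx\<^sup>n\<close> and is transitive on levels. Choose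
  the last vertex \<open>v\<close> on the axis of \<open>x\<close> that is fixed by \<open>V\<close>. The stabiliser in \<open>V\<close> of \<open>xv\<close>
  contains \<open>W\<close> and is not \<open>V\<close>; if \<open>W\<close> is maximal, it is \<open>W\<close>, and then \<open>V\<close> is the full stabiliser
  of \<open>v\<close> in \<open>H\<close>. Hence \<open>gx\<^sup>nVx\<^sup>-\<^sup>n \<mapsto> gx\<^sup>nv\<close> conjugates \<open>\<rho>\<close> to \<open>\<rho>'\<close>.

  The index of \<open>W\<close> in \<open>V\<close> is read off from the valency of the tree, and \<open>V\<close> is open in the closed
  subgroup \<open>H\<close> by Baire category.\<close>

subsection \<open>Trees with a parent function\<close>

text \<open>A tree with a distinguished end, encoded without edges: \<open>par v\<close> is the
  neighbour of \<open>v\<close> towards the end, and \<open>lev\<close> is a Busemann function,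
  growing by 1 with each step away from it. \<open>confluent\<close> makes all ancestor lines lead
  to the same end.\<close>

locale level_tree =
  fixes A :: "'v set" and par :: "'v \<Rightarrow> 'v" and lev :: "'v \<Rightarrow> int"
  assumes par_in: "v \<in> A \<Longrightarrow> par v \<in> A"
    and lev_par: "v \<in> A \<Longrightarrow> lev (par v) = lev v - 1"
    and confluent: "\<lbrakk>u \<in> A; v \<in> A; lev u = lev v\<rbrakk> \<Longrightarrow> \<exists>i. (par ^^ i) u = (par ^^ i) v"
begin

lemma funpow_par_in: "v \<in> A \<Longrightarrow> (par ^^ k) v \<in> A"
  by (induction k) (auto intro: par_in)

lemma lev_funpow_par: "v \<in> A \<Longrightarrow> lev ((par ^^ k) v) = lev v - int k"
  by (induction k) (auto simp: lev_par funpow_par_in)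

lemma inj_funpow_par: "v \<in> A \<Longrightarrow> inj (\<lambda>k. (par ^^ k) v)"
  by (rule injI) (metis lev_funpow_par diff_left_imp_eq of_nat_eq_iff)

lemma common_ancestor:
  assumes "u \<in> A" "v \<in> A"
  obtains i j where "(par ^^ i) u = (par ^^ j) v" "lev u - int i = lev v - int j"
proof -
  define m where "m = min (lev u) (lev v)"
  define i j where "i = nat (lev u - m)" and "j = nat (lev v - m)"
  have ij: "lev u - int i = m" "lev v - int j = m"
    by (auto simp: i_def j_def m_def)
  then obtain k where "(par ^^ k) ((par ^^ i) u) = (par ^^ k) ((par ^^ j) v)"
    using assms by (metis confluent funpow_par_in lev_funpow_par)
  then have "(par ^^ (k + i)) u = (par ^^ (k + j)) v"
    by (simp add: funpow_add)
  then show thesis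
    using that[of "k + i" "k + j"] ij by simp
qed

lemma funpow_par_eq_mono: "(par ^^ i) u = (par ^^ i) v \<Longrightarrow> i \<le> j \<Longrightarrow> (par ^^ j) u = (par ^^ j) v"
  by (metis (no_types, lifting) funpow_add le_add_diff_inverse2 o_apply)

lemma funpow_par_commute:
  assumes "\<And>v. v \<in> A \<Longrightarrow> f v \<in> A" "\<And>v. v \<in> A \<Longrightarrow> f (par v) = par (f v)" "v \<in> A"
  shows "f ((par ^^ k) v) = (par ^^ k) (f v)"
  using assms by (induction k) (auto simp: funpow_par_in)

text \<open>Any two vertices share an ancestor, and a map commuting with \<open>par\<close> carries
  this coincidence along. So the Busemann function changes by the same amount everywhere.\<close>

lemma level_shift_const:
  assumes "\<And>v. v \<in> A \<Longrightarrow> f v \<in> A" "\<And>v. v \<in> A \<Longrightarrow> f (par v) = par (f v)"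
    and "u \<in> A" "v \<in> A"
  shows "lev (f u) - lev u = lev (f v) - lev v"
proof -
  obtain i j where ij: "(par ^^ i) u = (par ^^ j) v" "lev u - int i = lev v - int j"
    using common_ancestor assms(3,4) by blast
  then have "(par ^^ i) (f u) = (par ^^ j) (f v)"
    using funpow_par_commute[of f, OF assms(1,2)] assms(3,4) by metis
  then have "lev (f u) - int i = lev (f v) - int j"
    using assms by (metis lev_funpow_par)
  with ij show ?thesis by simp
qed

text \<open>A vertex is coded by its level and the labels of its ancestors. Labels distinguish siblings,
  and the bi-infinite axis \<open>a\<close> has labels 0, so that all but finitely many labels vanish.\<close>

lemma coding:
  fixes a :: "int \<Rightarrow> 'v"
  assumes axis_in: "\<And>n. a n \<in> A" and axis_par: "\<And>n. par (a (n + 1)) = a n"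
    and children: "\<And>v. v \<in> A \<Longrightarrow> finite {u \<in> A. par u = v} \<and> card {u \<in> A. par u = v} = q"
  obtains code where
    "bij_betw code A (UNIV \<times> {f. (\<forall>k. f k < q) \<and> (\<exists>N. \<forall>k\<ge>N. f k = 0)})"
    "\<And>v. v \<in> A \<Longrightarrow> code (par v) = (fst (code v) - (1::int), snd (code v) \<circ> Suc)"
proof -
  have lev_axis: "lev (a n) = lev (a 0) + n" for n
  proof (induction n rule: int_induct[where k = 0])
    case (step1 i)
    then show ?case using lev_par[OF axis_in, of "i + 1"] by (simp add: axis_par)
  next
    case (step2 i)
    then show ?case using lev_par[OF axis_in, of i] axis_par[of "i - 1"] by simp
  qed simp
  \<comment> \<open>The children of each vertex are numbered so that a child on the axis, if there
    is one, gets the number 0.\<close>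
  have "\<exists>e. bij_betw e {u \<in> A. par u = v} {..<q} \<and>
      (\<forall>u\<in>{u \<in> A. par u = v}. u \<in> range a \<longrightarrow> e u = 0)" if v: "v \<in> A" for v
  proof -
    let ?C = "{u \<in> A. par u = v}"
    obtain e where e: "bij_betw e ?C {..<q}"
      using children[OF v] by (metis atLeast0LessThan ex_bij_betw_finite_nat)
    show ?thesis
    proof (cases "\<exists>u\<in>?C. u \<in> range a")
      case False
      then show ?thesis using e by blast
    next
      case True
      then obtain u where u: "u \<in> ?C" "u \<in> range a" by blast
      have uniq: "w = u" if "w \<in> ?C" "w \<in> range a" for w
      proof -
        from that u obtain m n where mn: "w = a m" "u = a n" by blast
        have "lev w = lev v + 1" "lev u = lev v + 1"
          using that(1) u(1) by (metis (mono_tags, lifting) diff_add_cancel lev_par mem_Collect_eq)+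
        with mn show ?thesis by (metis lev_axis add_left_cancel)
      qed
      \<comment> \<open>Levels separate the axis vertices, so \<open>u\<close> is the only axis
        child; swapping its label with 0 keeps the numbering bijective.\<close>
      let ?t = "Transposition.transpose (e u) 0 :: nat \<Rightarrow> nat"
      have "e u < q" using bij_betw_apply[OF e u(1)] by simp
      then have "bij_betw ?t {..<q} {..<q}"
        by (intro bij_betwI[where g = ?t]) (auto simp: Transposition.transpose_def)
      then have "bij_betw (?t \<circ> e) ?C {..<q}"
        using e by (rule bij_betw_trans[rotated])
      moreover have "\<forall>w\<in>?C. w \<in> range a \<longrightarrow> (?t \<circ> e) w = 0"
        using uniq by auto
      ultimately show ?thesis by blast
    qed
  qed
  then have "\<exists>e. \<forall>v\<in>A. bij_betw (e v) {u \<in> A. par u = v} {..<q} \<and>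
      (\<forall>u\<in>{u \<in> A. par u = v}. u \<in> range a \<longrightarrow> e v u = 0)"
    by (intro bchoice) blast
  then obtain e where ee: "\<forall>v\<in>A. bij_betw (e v) {u \<in> A. par u = v} {..<q} \<and>
      (\<forall>u\<in>{u \<in> A. par u = v}. u \<in> range a \<longrightarrow> e v u = 0)"
    by (rule exE)
  have e: "bij_betw (e v) {u \<in> A. par u = v} {..<q}" if "v \<in> A" for v
    using ee that by blast
  have e0: "e v u = 0" if "v \<in> A" "u \<in> A" "par u = v" "u \<in> range a" for u v
    using bspec[OF ee that(1)] that by simp
  define l where "l u = e (par u) u" for u
  have l_less: "l u < q" if "u \<in> A" for u
    using e[OF par_in[OF that]] that by (auto simp: l_def bij_betw_def)
  have l_inj: "u = w" if "u \<in> A" "w \<in> A" "par u = par w" "l u = l w" for u w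
    using e[OF par_in[OF that(1)]] that by (auto simp: l_def bij_betw_def inj_on_def)
  have l_surj: "\<exists>u\<in>A. par u = v \<and> l u = i" if "v \<in> A" "i < q" for v i
  proof -
    from e[OF that(1)] that(2) have "i \<in> e v ` {u \<in> A. par u = v}"
      by (simp add: bij_betw_def)
    then show ?thesis by (auto simp: l_def)
  qed
  have l_axis: "l (a n) = 0" for n
    using e0[OF par_in[OF axis_in], of "a n"] axis_in by (auto simp: l_def)
  have anc_axis: "(par ^^ k) (a n) = a (n - int k)" for k n
  proof (induction k)
    case (Suc k)
    then show ?case using axis_par[of "n - int k - 1"] by (simp add: algebra_simps)
  qed simp
  define code where "code v = (lev v - lev (a 0), \<lambda>k. l ((par ^^ k) v))" for v
  \<comment> \<open>Descending from a common ancestor, equal labels force equal vertices in every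
    generation.\<close>
  have inj: "u = w" if "u \<in> A" "w \<in> A" "(par ^^ i) u = (par ^^ i) w"
    "\<And>k. l ((par ^^ k) u) = l ((par ^^ k) w)" for u w i
    using that
  proof (induction i arbitrary: u w)
    case (Suc i)
    have "par u = par w"
    proof (rule Suc.IH)
      show "l ((par ^^ k) (par u)) = l ((par ^^ k) (par w))" for k
        using Suc.prems(4)[of "Suc k"] by (simp add: funpow_swap1)
    qed (use Suc.prems in \<open>auto simp: funpow_swap1 intro: par_in\<close>)
    then show ?case using l_inj Suc.prems(1,2) Suc.prems(4)[of 0] by simp
  qed simp
  \<comment> \<open>Induction on a bound \<open>N\<close> beyond which the labels vanish: for 0 the
    vertex lies on the axis; otherwise it is the child with label \<open>f 0\<close> of the vertex
    coded by the shifted sequence.\<close>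
  have surj: "\<exists>v\<in>A. lev v - lev (a 0) = n \<and> (\<forall>k. l ((par ^^ k) v) = f k)"
    if "\<And>k. f k < q" "\<And>k. k \<ge> N \<Longrightarrow> f k = 0" for N n f
    using that
  proof (induction N arbitrary: n f)
    case 0
    then show ?case
      by (intro bexI[of _ "a n"]) (auto simp: lev_axis[of n] anc_axis l_axis axis_in)
  next
    case (Suc N)
    obtain w where w: "w \<in> A" "lev w - lev (a 0) = n - 1" "\<And>k. l ((par ^^ k) w) = f (Suc k)"
      using Suc.IH[of "f \<circ> Suc" "n - 1"] Suc.prems by auto
    obtain v where v: "v \<in> A" "par v = w" "l v = f 0"
      using l_surj[OF w(1) Suc.prems(1)] by blast
    have "l ((par ^^ k) v) = f k" for k
      using v w(3) by (cases k) (simp_all add: funpow_Suc_right del: funpow.simps)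
    then show ?case
      using v w(2) lev_par[OF v(1)] by (intro bexI[of _ v]) auto
  qed
  have "inj_on code A"
  proof (rule inj_onI)
    fix u w assume uw: "u \<in> A" "w \<in> A" and "code u = code w"
    then have "lev u = lev w" "\<And>k. l ((par ^^ k) u) = l ((par ^^ k) w)"
      by (auto simp: code_def fun_eq_iff)
    then obtain i where "(par ^^ i) u = (par ^^ i) w" using confluent uw by blast
    then show "u = w"
      by (rule inj[OF uw]) fact
  qed
  moreover have "code ` A = UNIV \<times> {f. (\<forall>k. f k < q) \<and> (\<exists>N. \<forall>k\<ge>N. f k = 0)}"
  proof (intro subset_antisym subsetI)
    fix c assume "c \<in> code ` A"
    then obtain v where v: "v \<in> A" "c = code v" by blast
    \<comment> \<open>Some ancestor of \<open>v\<close> is on the axis, and from there on all labels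
      are 0.\<close>
    obtain i j where "(par ^^ i) v = (par ^^ j) (a 0)"
      using common_ancestor[OF v(1) axis_in] by metis
    then have i: "(par ^^ i) v = a (- int j)" by (simp add: anc_axis)
    have "l ((par ^^ k) v) = 0" if "k \<ge> i" for k
    proof -
      have "(par ^^ k) v = (par ^^ (k - i)) ((par ^^ i) v)"
        using that by (metis funpow_add le_add_diff_inverse2 o_apply)
      then show ?thesis by (simp add: i anc_axis l_axis)
    qed
    then show "c \<in> UNIV \<times> {f. (\<forall>k. f k < q) \<and> (\<exists>N. \<forall>k\<ge>N. f k = 0)}"
      using v by (auto simp: code_def intro: l_less funpow_par_in)
  next
    fix c :: "int \<times> (nat \<Rightarrow> nat)"
    assume "c \<in> UNIV \<times> {f. (\<forall>k. f k < q) \<and> (\<exists>N. \<forall>k\<ge>N. f k = 0)}"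
    then obtain n f N where c: "c = (n, f)" "\<And>k. f k < q" "\<And>k. k \<ge> N \<Longrightarrow> f k = 0"
      by auto
    obtain v where "v \<in> A" "lev v - lev (a 0) = n" "\<forall>k. l ((par ^^ k) v) = f k"
      using surj[of f, OF c(2,3)] by blast
    then have "v \<in> A" "code v = c" by (auto simp: code_def c(1))
    then show "c \<in> code ` A" by blast
  qed
  ultimately have "bij_betw code A (UNIV \<times> {f. (\<forall>k. f k < q) \<and> (\<exists>N. \<forall>k\<ge>N. f k = 0)})"
    by (simp add: bij_betw_def)
  moreover have "code (par v) = (fst (code v) - 1, snd (code v) \<circ> Suc)" if "v \<in> A" for v
    using that lev_par by (auto simp: code_def fun_eq_iff funpow_swap1)
  ultimately show thesis by (rule that)
qed

end

text \<open>The set of codes depends only on \<open>q\<close>, so one coding composed with the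
  inverse of another is an isomorphism. This later places the coset tree of an intermediate subgroup
  on the given tree.\<close>

lemma level_tree_isomorphism:
  fixes a :: "int \<Rightarrow> 'v" and b :: "int \<Rightarrow> 'w"
  assumes "level_tree A p l" "\<And>n. a n \<in> A" "\<And>n. p (a (n + 1)) = a n"
    and cA: "\<And>v. v \<in> A \<Longrightarrow> finite {u \<in> A. p u = v} \<and> card {u \<in> A. p u = v} = q"
    and "level_tree B p' l'" "\<And>n. b n \<in> B" "\<And>n. p' (b (n + 1)) = b n"
    and cB: "\<And>v. v \<in> B \<Longrightarrow> finite {u \<in> B. p' u = v} \<and> card {u \<in> B. p' u = v} = q"
  obtains \<psi> where "bij_betw \<psi> A B" "\<And>v. v \<in> A \<Longrightarrow> \<psi> (p v) = p' (\<psi> v)"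
proof -
  interpret A: level_tree A p l by fact
  interpret B: level_tree B p' l' by fact
  let ?S = "UNIV \<times> {f. (\<forall>k. f k < q) \<and> (\<exists>N. \<forall>k\<ge>N. f k = 0)} :: (int \<times> (nat \<Rightarrow> nat)) set"
  obtain c where c: "bij_betw c A ?S"
    "\<And>v. v \<in> A \<Longrightarrow> c (p v) = (fst (c v) - (1::int), snd (c v) \<circ> Suc)"
    using A.coding[of a q, OF assms(2,3) cA] by blast
  obtain d where d: "bij_betw d B ?S"
    "\<And>v. v \<in> B \<Longrightarrow> d (p' v) = (fst (d v) - (1::int), snd (d v) \<circ> Suc)"
    using B.coding[of b q, OF assms(6,7) cB] by blast
  let ?\<psi> = "inv_into B d \<circ> c"
  have bij: "bij_betw ?\<psi> A B"
    by (rule bij_betw_trans[OF c(1) bij_betw_inv_into[OF d(1)]])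
  have "?\<psi> (p v) = p' (?\<psi> v)" if v: "v \<in> A" for v
  proof -
    have "c v \<in> d ` B"
      unfolding bij_betw_imp_surj_on[OF d(1)] by (rule bij_betw_apply[OF c(1) v])
    then have w: "?\<psi> v \<in> B" "d (?\<psi> v) = c v"
      by (auto simp: f_inv_into_f inv_into_into)
    then have "d (p' (?\<psi> v)) = c (p v)"
      unfolding d(2)[OF w(1)] c(2)[OF v] by simp
    with bij_betw_inv_into_left[OF d(1) B.par_in[OF w(1)]] show ?thesis
      by (metis o_apply)
  qed
  then show thesis using bij that by blast
qed

subsection \<open>Isometries fixing an end\<close>

text \<open>Links the parent map to a graph: adjacency is the parent relation, and
  \<open>some_ray\<close> says that \<open>\<omega>\<close>, a class of rays, is the end towards
  which \<open>par\<close> points.\<close>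

locale ended_tree = level_tree "verts T" par lev
  for T :: "'v ugraph" and par and lev :: "'v \<Rightarrow> int" +
  fixes \<omega> :: "(nat \<Rightarrow> 'v) set"
  assumes edge_iff: "\<lbrakk>u \<in> verts T; v \<in> verts T\<rbrakk> \<Longrightarrow> {u, v} \<in> edges T \<longleftrightarrow> u = par v \<or> v = par u"
    and \<omega>: "\<omega> \<in> ends T"
    and some_ray: "\<exists>v \<in> verts T. (\<lambda>k. (par ^^ k) v) \<in> \<omega>"
begin

lemma ancestor_ray: "v \<in> verts T \<Longrightarrow> (\<lambda>k. (par ^^ k) v) \<in> rays T"
  using inj_funpow_par by (auto simp: rays_def funpow_par_in edge_iff par_in)

text \<open>A ray that has once stepped away from \<open>\<omega>\<close> keeps doing so, since it cannot turn back.\<close>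

lemma ray_cofinal_ancestor_ray:
  assumes r: "r \<in> rays T" and v: "v \<in> verts T" and eq: "\<forall>k. r (m + k) = (par ^^ (n + k)) v"
  shows "r = (\<lambda>k. (par ^^ k) (r 0))"
proof -
  have rin: "r k \<in> verts T" for k using r by (auto simp: rays_def)
  have step: "r k = par (r (Suc k)) \<or> r (Suc k) = par (r k)" for k
    using r rin by (auto simp: rays_def edge_iff)
  have up: "r (Suc k) = par (r k)" for k
  proof (rule ccontr)
    assume "r (Suc k) \<noteq> par (r k)"
    then have "r (j + k) = par (r (Suc (j + k)))" for j
    proof (induction j)
      case 0
      then show ?case using step[of k] by auto
    next
      case (Suc j)
      show ?case
      proof (rule ccontr)
        assume "r (Suc j + k) \<noteq> par (r (Suc (Suc j + k)))"
        then have "r (Suc (Suc j + k)) = par (r (Suc j + k))" using step by metis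
        also have "\<dots> = r (j + k)" using Suc by simp
        finally have "Suc (Suc j + k) = j + k" using r by (auto simp: rays_def inj_def)
        then show False by simp
      qed
    qed
    \<comment> \<open>Beyond index \<open>m\<close> the ray also follows \<open>par\<close>; both
      directions on one edge would put \<open>r (m + k)\<close> two levels below itself.\<close>
    from this[of m] have a: "r (m + k) = par (r (m + Suc k))" by simp
    have "r (m + Suc k) = par (r (m + k))" using eq by (metis add_Suc_right funpow.simps(2) o_apply)
    with a have "lev (r (m + k)) = lev (r (m + k)) - 2"
      using rin lev_par by (metis add_diff_eq diff_diff_eq diff_add_cancel one_add_one)
    then show False by simp
  qed
  have "r k = (par ^^ k) (r 0)" for k
    by (induction k) (auto simp: up)
  then show ?thesis by blast
qed

text \<open>A ray that eventually agrees with an ancestor ray is one from its first vertex on, and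
  any two ancestor rays are cofinal. Fixing \<open>\<omega>\<close> thereby becomes a condition on
  \<open>par\<close>.\<close>

lemma end_eq: "\<omega> = (\<lambda>v k. (par ^^ k) v) ` verts T"
proof -
  obtain v0 where v0: "v0 \<in> verts T" "(\<lambda>k. (par ^^ k) v0) \<in> \<omega>" using some_ray by blast
  obtain r1 where r1: "r1 \<in> rays T" "\<omega> = cofinal T `` {r1}"
    using \<omega> by (auto simp: ends_def quotient_def)
  from v0 r1 have c1: "(r1, \<lambda>k. (par ^^ k) v0) \<in> cofinal T" by simp
  then obtain m n where mn: "\<forall>k. r1 (m + k) = (par ^^ (n + k)) v0" by (auto simp: cofinal_def)
  have r1_eq: "r1 = (\<lambda>k. (par ^^ k) (r1 0))"
    using ray_cofinal_ancestor_ray[OF r1(1) v0(1) mn] .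
  have r10: "r1 0 \<in> verts T" using r1 by (auto simp: rays_def)
  show ?thesis
  proof (intro subset_antisym subsetI)
    fix s assume "s \<in> \<omega>"
    then have s: "s \<in> rays T" "\<exists>m n. \<forall>k. r1 (m + k) = s (n + k)"
      using r1 by (auto simp: cofinal_def)
    then obtain m n where mn: "\<forall>k. s (n + k) = (par ^^ (m + k)) (r1 0)"
      using r1_eq by metis
    have "s = (\<lambda>k. (par ^^ k) (s 0))"
      using ray_cofinal_ancestor_ray[OF s(1) r10 mn] .
    moreover have "s 0 \<in> verts T" using s by (auto simp: rays_def)
    ultimately show "s \<in> (\<lambda>v k. (par ^^ k) v) ` verts T" by blast
  next
    fix s assume "s \<in> (\<lambda>v k. (par ^^ k) v) ` verts T"
    then obtain v where v: "v \<in> verts T" "s = (\<lambda>k. (par ^^ k) v)" by blast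
    obtain i j where ij: "(par ^^ i) (r1 0) = (par ^^ j) v"
      using common_ancestor[OF r10 v(1)] by metis
    have "(par ^^ (i + k)) (r1 0) = (par ^^ (j + k)) v" for k
      using ij by (metis add.commute funpow_add o_apply)
    then have "\<exists>m n. \<forall>k. r1 (m + k) = s (n + k)"
      using r1_eq v(2) by metis
    then show "s \<in> \<omega>"
      using r1 ancestor_ray[OF v(1)] v(2) by (auto simp: cofinal_def)
  qed
qed

text \<open>The ancestor ray of \<open>v\<close> is mapped to another ancestor ray; comparing the
  entries at positions 0 and 1 gives the commutation with \<open>par\<close>.\<close>

lemma Isom_endD:
  assumes "\<sigma> \<in> Isom_end T \<omega>"
  shows "\<sigma> \<in> Bij (verts T)" "v \<in> verts T \<Longrightarrow> \<sigma> (par v) = par (\<sigma> v)"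
proof -
  show "\<sigma> \<in> Bij (verts T)" using assms by (auto simp: Isom_end_def Isom_def)
  assume v: "v \<in> verts T"
  have "\<sigma> \<circ> (\<lambda>k. (par ^^ k) v) \<in> \<omega>"
    using assms v end_eq by (auto simp: Isom_end_def)
  then obtain w where w: "\<And>k. \<sigma> ((par ^^ k) v) = (par ^^ k) w"
    by (auto simp: end_eq fun_eq_iff)
  from w[of 0] w[of 1] show "\<sigma> (par v) = par (\<sigma> v)" by simp
qed

lemma walk_map:
  assumes "\<And>v. v \<in> verts T \<Longrightarrow> \<sigma> v \<in> verts T"
    and "\<And>v. v \<in> verts T \<Longrightarrow> \<sigma> (par v) = par (\<sigma> v)"
    and "walk T p"
  shows "walk T (map \<sigma> p)"
proof -
  have "successively (\<lambda>u v. {\<sigma> u, \<sigma> v} \<in> edges T) p"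
  proof (rule successively_mono[rotated])
    show "successively (\<lambda>u v. {u, v} \<in> edges T) p" using assms(3) by (simp add: walk_def)
    fix u v assume uv: "u \<in> set p" "v \<in> set p" "{u, v} \<in> edges T"
    then have "u \<in> verts T" "v \<in> verts T" using assms(3) by (auto simp: walk_def)
    with uv show "{\<sigma> u, \<sigma> v} \<in> edges T" using assms(1,2) by (auto simp: edge_iff)
  qed
  then show ?thesis using assms by (auto simp: walk_def successively_map)
qed

text \<open>The map and its inverse both commute with \<open>par\<close>, so they send walks to
  walks of the same length, which preserves distances, and they permute the ancestor rays. Together
  with \<open>Isom_endD\<close> this describes the stabiliser of \<open>\<omega>\<close> as the
  bijections commuting with \<open>par\<close>.\<close>

lemma Isom_endI:
  assumes bij: "\<sigma> \<in> Bij (verts T)" and par: "\<And>v. v \<in> verts T \<Longrightarrow> \<sigma> (par v) = par (\<sigma> v)"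
  shows "\<sigma> \<in> Isom_end T \<omega>"
proof -
  define \<tau> where "\<tau> = inv_into (verts T) \<sigma>"
  have bb: "bij_betw \<sigma> (verts T) (verts T)" using bij by (simp add: Bij_def)
  have in1: "\<sigma> v \<in> verts T" if "v \<in> verts T" for v
    using bb that by (auto simp: bij_betw_def)
  have in2: "\<tau> v \<in> verts T" "\<sigma> (\<tau> v) = v" "\<tau> (\<sigma> v) = v" if "v \<in> verts T" for v
    using bb that by (auto simp: \<tau>_def bij_betw_def f_inv_into_f inv_into_into)
  have par2: "\<tau> (par v) = par (\<tau> v)" if "v \<in> verts T" for v
    by (metis in2 par par_in that)
  have walks: "(\<exists>p. walk T p \<and> hd p = \<sigma> u \<and> last p = \<sigma> v \<and> length p = Suc n) \<longleftrightarrow>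
      (\<exists>p. walk T p \<and> hd p = u \<and> last p = v \<and> length p = Suc n)"
    if uv: "u \<in> verts T" "v \<in> verts T" for u v n
  proof
    assume "\<exists>p. walk T p \<and> hd p = \<sigma> u \<and> last p = \<sigma> v \<and> length p = Suc n"
    then obtain p where p: "walk T p" "hd p = \<sigma> u" "last p = \<sigma> v" "length p = Suc n" by blast
    then have "walk T (map \<tau> p) \<and> hd (map \<tau> p) = u \<and> last (map \<tau> p) = v \<and> length (map \<tau> p) = Suc n"
      using walk_map[of \<tau>, OF in2(1) par2 p(1)] uv in2
      by (metis Nil_is_map_conv hd_map last_map length_map walk_def)
    then show "\<exists>p. walk T p \<and> hd p = u \<and> last p = v \<and> length p = Suc n" by blast
  next
    assume "\<exists>p. walk T p \<and> hd p = u \<and> last p = v \<and> length p = Suc n"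
    then obtain p where p: "walk T p" "hd p = u" "last p = v" "length p = Suc n" by blast
    then have "walk T (map \<sigma> p) \<and> hd (map \<sigma> p) = \<sigma> u \<and> last (map \<sigma> p) = \<sigma> v \<and>
        length (map \<sigma> p) = Suc n"
      using walk_map[of \<sigma>, OF in1 par p(1)]
      by (metis Nil_is_map_conv hd_map last_map length_map walk_def)
    then show "\<exists>p. walk T p \<and> hd p = \<sigma> u \<and> last p = \<sigma> v \<and> length p = Suc n" by blast
  qed
  have isom: "\<sigma> \<in> Isom T"
    using bij walks by (simp add: Isom_def graph_dist_def)
  have "\<sigma> \<circ> (\<lambda>k. (par ^^ k) v) = (\<lambda>k. (par ^^ k) (\<sigma> v))" if "v \<in> verts T" for v
    using funpow_par_commute[of \<sigma>, OF in1 par that] by auto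
  then have "(\<lambda>r. \<sigma> \<circ> r) ` \<omega> = (\<lambda>v k. (par ^^ k) v) ` (\<sigma> ` verts T)"
    by (simp add: end_eq image_image)
  also have "\<sigma> ` verts T = verts T" using bb by (simp add: bij_betw_def)
  finally have "(\<lambda>r. \<sigma> \<circ> r) ` \<omega> = \<omega>"
    unfolding end_eq[symmetric] .
  with isom show ?thesis unfolding Isom_end_def by blast
qed

end

subsection \<open>The coset tree\<close>

lemma (in group) l_coset_eq_iff:
  assumes "subgroup K G" "g \<in> carrier G" "h \<in> carrier G"
  shows "g <#\<^bsub>G\<^esub> K = h <#\<^bsub>G\<^esub> K \<longleftrightarrow> inv g \<otimes> h \<in> K"
proof
  assume "g <#\<^bsub>G\<^esub> K = h <#\<^bsub>G\<^esub> K"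
  then have "h \<in> g <#\<^bsub>G\<^esub> K" using lcos_self[OF assms(3,1)] by simp
  then show "inv g \<otimes> h \<in> K"
    using subgroup.lcos_module_imp[OF assms(1) is_group assms(2)] by blast
next
  assume "inv g \<otimes> h \<in> K"
  then have "h \<in> g <#\<^bsub>G\<^esub> K"
    using subgroup.lcos_module_rev[OF assms(1) is_group assms(2,3)] by blast
  then show "g <#\<^bsub>G\<^esub> K = h <#\<^bsub>G\<^esub> K" using l_repr_independence assms by blast
qed

lemma (in group) inv_mult_cancel:
  "g \<in> carrier G \<Longrightarrow> y \<in> carrier G \<Longrightarrow> inv g \<otimes> (g \<otimes> y) = y"
  "g \<in> carrier G \<Longrightarrow> y \<in> carrier G \<Longrightarrow> g \<otimes> (inv g \<otimes> y) = y"
  by (simp_all flip: m_assoc)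

text \<open>Kept independent of \<open>minus_part\<close> so that it can be interpreted a second
  time with an intermediate subgroup in place of \<open>V\<close>.\<close>

locale contraction = group G for G (structure) +
  fixes x :: 'a and V :: "'a set"
  assumes x_closed [simp]: "x \<in> carrier G"
    and V: "subgroup V G"
    and contract: "conj_set G x V \<subseteq> V"
begin

declare inv_mult_cancel [simp]

definition cj :: "int \<Rightarrow> 'a \<Rightarrow> 'a"
  where "cj n g = x [^] n \<otimes> g \<otimes> inv (x [^] n)"

abbreviation Vn :: "int \<Rightarrow> 'a set"
  where "Vn n \<equiv> conj_set G (x [^] n) V"

text \<open>For \<open>V = minus_part G x U\<close> this is \<open>minus_minus_part G x U\<close>,
  the group H of the theorem.\<close>

definition VV :: "'a set"
  where "VV = (\<Union>n::int. Vn n)"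

lemma conj_set_pow: "conj_set G (x [^] n) S = cj n ` S"
  by (simp add: conj_set_def cj_def)

lemma conj_set_x: "conj_set G x S = cj 1 ` S"
  using conj_set_pow[of 1] by simp

lemma cj_closed [simp]: "g \<in> carrier G \<Longrightarrow> cj n g \<in> carrier G"
  by (simp add: cj_def)

lemma cj_mult: "g \<in> carrier G \<Longrightarrow> h \<in> carrier G \<Longrightarrow> cj n (g \<otimes> h) = cj n g \<otimes> cj n h"
  by (simp add: cj_def m_assoc)

lemma cj_one [simp]: "cj n \<one> = \<one>"
  by (simp add: cj_def)

lemma cj_inv: "g \<in> carrier G \<Longrightarrow> cj n (inv g) = inv (cj n g)"
  by (simp add: cj_def inv_mult_group m_assoc)

lemma cj_0 [simp]: "g \<in> carrier G \<Longrightarrow> cj 0 g = g"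
  by (simp add: cj_def)

lemma cj_cj [simp]: "g \<in> carrier G \<Longrightarrow> cj m (cj n g) = cj (m + n) g"
  by (simp add: cj_def int_pow_mult inv_mult_group m_assoc)

lemma cj_inj: "g \<in> carrier G \<Longrightarrow> h \<in> carrier G \<Longrightarrow> cj n g = cj n h \<longleftrightarrow> g = h"
  by (metis add.left_inverse cj_0 cj_cj)

lemma V_carrier: "g \<in> V \<Longrightarrow> g \<in> carrier G"
  using V subgroup.mem_carrier by fastforce

lemma Vn_iff: "g \<in> Vn n \<longleftrightarrow> g \<in> carrier G \<and> cj (- n) g \<in> V"
proof
  assume "g \<in> Vn n"
  then show "g \<in> carrier G \<and> cj (- n) g \<in> V" by (auto simp: conj_set_pow V_carrier)
next
  assume g: "g \<in> carrier G \<and> cj (- n) g \<in> V"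
  then have "g = cj n (cj (- n) g)" by simp
  with g show "g \<in> Vn n" unfolding conj_set_pow by blast
qed

lemma Vn_0: "Vn 0 = V"
  using V_carrier by (auto simp: Vn_iff simp del: int_pow_0)

lemma conj_set_one [simp]: "conj_set G \<one> V = V"
  using Vn_0 by simp

lemma Vn_1: "Vn 1 = conj_set G x V"
  by simp

lemma Vn_carrier: "g \<in> Vn n \<Longrightarrow> g \<in> carrier G"
  by (simp add: Vn_iff)

lemma cj_Vn_iff: "g \<in> carrier G \<Longrightarrow> cj k g \<in> Vn n \<longleftrightarrow> g \<in> Vn (n - k)"
  by (simp add: Vn_iff)

lemma Vn_subgroup: "subgroup (Vn n) G"
proof (rule subgroupI)
  show "Vn n \<subseteq> carrier G" using Vn_carrier by blast
  have "\<one> \<in> Vn n" using subgroup.one_closed[OF V] by (simp add: Vn_iff)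
  then show "Vn n \<noteq> {}" by blast
  show "inv a \<in> Vn n" if "a \<in> Vn n" for a
    using that subgroup.m_inv_closed[OF V] by (simp add: Vn_iff cj_inv)
  show "a \<otimes> b \<in> Vn n" if "a \<in> Vn n" "b \<in> Vn n" for a b
    using that subgroup.m_closed[OF V] by (simp add: Vn_iff cj_mult)
qed

lemma Vn_Suc: "Vn (n + 1) \<subseteq> Vn n"
proof
  fix g assume g: "g \<in> Vn (n + 1)"
  then have "cj (- n - 1) g \<in> V" "g \<in> carrier G" by (simp_all add: Vn_iff)
  then have "cj 1 (cj (- n - 1) g) \<in> V" using contract by (auto simp: conj_set_x)
  then show "g \<in> Vn n" using g by (simp add: Vn_iff)
qed

lemma Vn_antimono: "m \<le> n \<Longrightarrow> Vn n \<subseteq> Vn m"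
proof (induction n rule: int_ge_induct)
  case (step i)
  then show ?case using Vn_Suc by blast
qed simp

lemma VV_carrier: "g \<in> VV \<Longrightarrow> g \<in> carrier G"
  by (auto simp: VV_def Vn_iff)

text \<open>The groups \<open>Vn n\<close> grow as \<open>n\<close> decreases, so their union is
  directed; the bound \<open>k\<close> allows the common index to be taken as low as
  desired.\<close>

lemma VV_common_level:
  assumes "g \<in> VV" "h \<in> VV"
  obtains n where "n \<le> k" "g \<in> Vn n" "h \<in> Vn n"
proof -
  obtain m n where mn: "g \<in> Vn m" "h \<in> Vn n" using assms by (auto simp: VV_def)
  let ?n = "min k (min m n)"
  have "g \<in> Vn ?n" "h \<in> Vn ?n"
    by (rule subsetD[OF Vn_antimono]; use mn in simp)+
  then show thesis using that[of ?n] by simp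
qed

lemma VV_subgroup: "subgroup VV G"
proof (rule subgroupI)
  show "VV \<subseteq> carrier G" using VV_carrier by blast
  show "VV \<noteq> {}" using subgroup.one_closed[OF Vn_subgroup] by (auto simp: VV_def)
  show "inv a \<in> VV" if "a \<in> VV" for a
    using that subgroup.m_inv_closed[OF Vn_subgroup] by (auto simp: VV_def)
  show "a \<otimes> b \<in> VV" if ab: "a \<in> VV" "b \<in> VV" for a b
  proof -
    obtain n where "a \<in> Vn n" "b \<in> Vn n" using VV_common_level ab by metis
    then show ?thesis using subgroup.m_closed[OF Vn_subgroup] by (auto simp: VV_def)
  qed
qed

lemma VV_mult: "g \<in> VV \<Longrightarrow> h \<in> VV \<Longrightarrow> g \<otimes> h \<in> VV"
  and VV_inv: "g \<in> VV \<Longrightarrow> inv g \<in> VV"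
  and VV_one: "\<one> \<in> VV"
  using VV_subgroup by (auto intro: subgroup.m_closed subgroup.m_inv_closed subgroup.one_closed)

lemma Vn_VV: "g \<in> Vn n \<Longrightarrow> g \<in> VV"
  by (auto simp: VV_def)

lemma V_VV: "g \<in> V \<Longrightarrow> g \<in> VV"
  using Vn_VV[of g 0] by simp

lemma cj_VV: "g \<in> VV \<Longrightarrow> cj n g \<in> VV"
proof -
  assume "g \<in> VV"
  then obtain m where "g \<in> Vn m" by (auto simp: VV_def)
  then have "cj n g \<in> Vn (m + n)" using cj_Vn_iff[of g n "m + n"] Vn_carrier by simp
  then show ?thesis by (rule Vn_VV)
qed

definition pt :: "int \<Rightarrow> 'a \<Rightarrow> int \<times> 'a set"
  where "pt n g = (n, g <#\<^bsub>G\<^esub> Vn n)"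

definition Q :: "(int \<times> 'a set) set"
  where "Q = {pt n g | n g. g \<in> VV}"

lemma verts_eq: "verts (coset_graph G VV x V) = Q"
  by (simp add: coset_graph_def Q_def pt_def)

lemma pt_in_Q [simp]: "g \<in> VV \<Longrightarrow> pt n g \<in> Q"
  by (auto simp: Q_def)

lemma Q_cases:
  assumes "u \<in> Q"
  obtains n g where "u = pt n g" "g \<in> VV"
  using assms by (auto simp: Q_def)

lemma fst_pt [simp]: "fst (pt n g) = n"
  by (simp add: pt_def)

lemma pt_eq_iff:
  assumes "g \<in> carrier G" "h \<in> carrier G"
  shows "pt n g = pt m h \<longleftrightarrow> n = m \<and> inv g \<otimes> h \<in> Vn n"
  using l_coset_eq_iff[OF Vn_subgroup assms] by (auto simp: pt_def)

text \<open>The choice of representative is immaterial, by \<open>up_pt\<close>.\<close>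

definition up :: "int \<times> 'a set \<Rightarrow> int \<times> 'a set"
  where "up u = pt (fst u - 1) (SOME g. g \<in> snd u)"

lemma up_pt:
  assumes g: "g \<in> carrier G"
  shows "up (pt n g) = pt (n - 1) g"
proof -
  define h where "h = (SOME h. h \<in> snd (pt n g))"
  have "g \<in> snd (pt n g)" using lcos_self[OF g Vn_subgroup] by (simp add: pt_def)
  then have h: "h \<in> g <#\<^bsub>G\<^esub> Vn n" unfolding h_def pt_def by (metis someI snd_conv)
  then have hc: "h \<in> carrier G" using l_coset_carrier[OF _ g Vn_subgroup] by blast
  have "inv g \<otimes> h \<in> Vn n"
    using subgroup.lcos_module_imp[OF Vn_subgroup is_group g h] .
  then have "inv g \<otimes> h \<in> Vn (n - 1)" using Vn_antimono[of "n - 1" n] by auto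
  then have "pt (n - 1) g = pt (n - 1) h" using g hc by (simp add: pt_eq_iff)
  then show ?thesis by (simp add: up_def h_def)
qed

lemma funpow_up_pt: "g \<in> carrier G \<Longrightarrow> (up ^^ k) (pt n g) = pt (n - int k) g"
  by (induction k) (simp_all add: up_pt algebra_simps)

sublocale Q: level_tree Q up fst
proof
  show "up v \<in> Q" if "v \<in> Q" for v
    using that by (auto elim!: Q_cases simp: up_pt VV_carrier)
  show "fst (up v) = fst v - 1" if "v \<in> Q" for v
    by (simp add: up_def)
  fix u v assume "u \<in> Q" "v \<in> Q" "fst u = fst v"
  then obtain n g h where uv: "u = pt n g" "v = pt n h" "g \<in> VV" "h \<in> VV"
    by (elim Q_cases) auto
  have "inv g \<otimes> h \<in> VV" using uv by (simp add: VV_mult VV_inv)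
  \<comment> \<open>The cosets of \<open>g\<close> and \<open>h\<close> merge at a level low enough
    for \<open>Vn m\<close> to contain \<open>inv g \<otimes> h\<close>.\<close>
  then obtain m where m: "m \<le> n" "inv g \<otimes> h \<in> Vn m" using VV_common_level by metis
  then have "pt m g = pt m h" using uv by (simp add: pt_eq_iff VV_carrier)
  then have "(up ^^ nat (n - m)) u = (up ^^ nat (n - m)) v"
    using uv m(1) by (simp add: funpow_up_pt VV_carrier)
  then show "\<exists>i. (up ^^ i) u = (up ^^ i) v" by blast
qed

lemma edges_iff:
  assumes "u \<in> Q" "v \<in> Q"
  shows "{u, v} \<in> edges (coset_graph G VV x V) \<longleftrightarrow> u = up v \<or> v = up u"
proof -
  have edges: "edges (coset_graph G VV x V) = {{pt n g, pt (n + 1) g} | n g. g \<in> VV}"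
    by (simp add: coset_graph_def pt_def)
  have up': "up (pt (n + 1) g) = pt n g" if "g \<in> VV" for n g
    using up_pt[of g "n + 1"] that by (simp add: VV_carrier)
  have *: "{up u, u} \<in> edges (coset_graph G VV x V)" if "u \<in> Q" for u
  proof -
    from that obtain n g where u: "u = pt n g" "g \<in> VV" by (rule Q_cases)
    then have "{up u, u} = {pt (n - 1) g, pt (n - 1 + 1) g}" by (simp add: up_pt VV_carrier)
    then show ?thesis using u unfolding edges by blast
  qed
  show ?thesis
  proof
    assume "{u, v} \<in> edges (coset_graph G VV x V)"
    then obtain n g where "g \<in> VV" "{u, v} = {pt n g, pt (n + 1) g}" unfolding edges by blast
    then show "u = up v \<or> v = up u" using up' by (auto simp: doubleton_eq_iff)
  next
    assume "u = up v \<or> v = up u"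
    then show "{u, v} \<in> edges (coset_graph G VV x V)"
      using *[OF assms(1)] *[OF assms(2)] by (auto simp: insert_commute)
  qed
qed

text \<open>The action of \<open>(h, x [^] k)\<close> with the exponent as an explicit argument,
  which avoids the \<open>THE\<close> in \<open>coset_action\<close>.\<close>

definition act :: "'a \<Rightarrow> int \<Rightarrow> int \<times> 'a set \<Rightarrow> int \<times> 'a set"
  where "act h k u = (fst u + k, h <#\<^bsub>G\<^esub> cj k ` snd u)"

lemma act_pt:
  assumes "h \<in> carrier G" "g \<in> carrier G"
  shows "act h k (pt n g) = pt (n + k) (h \<otimes> cj k g)"
proof -
  have "cj k ` (g <#\<^bsub>G\<^esub> Vn n) = cj k g <#\<^bsub>G\<^esub> cj k ` Vn n"
    using assms Vn_carrier by (force simp: l_coset_def cj_mult)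
  also have "cj k ` Vn n = Vn (n + k)"
    using V_carrier by (force simp: conj_set_pow image_image add.commute)
  finally show ?thesis
    using assms subgroup.subset[OF Vn_subgroup] by (simp add: act_def pt_def lcos_m_assoc)
qed

text \<open>\<open>act g n\<close> takes the base vertex \<open>pt 0 \<one>\<close> to
  \<open>pt n g\<close> and respects parents. The children of the base vertex are the cosets of
  \<open>Vn 1\<close> in \<open>V\<close>, so every vertex has as many children as the index of
  \<open>Vn 1\<close> in \<open>V\<close>.\<close>

lemma children_bij:
  assumes g: "g \<in> VV"
  shows "bij_betw (act g n) (pt 1 ` V) {w \<in> Q. up w = pt n g}"
proof (rule bij_betw_imageI)
  have gc: "g \<in> carrier G" using g VV_carrier by blast
  show "inj_on (act g n) (pt 1 ` V)"
  proof (rule inj_onI)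
    fix u w assume "u \<in> pt 1 ` V" "w \<in> pt 1 ` V" "act g n u = act g n w"
    then obtain k l where uw: "u = pt 1 k" "w = pt 1 l"
      and kl: "k \<in> V" "l \<in> V" "act g n (pt 1 k) = act g n (pt 1 l)" by blast
    then have c: "k \<in> carrier G" "l \<in> carrier G" using V_carrier by auto
    with kl gc have "inv (g \<otimes> cj n k) \<otimes> (g \<otimes> cj n l) \<in> Vn (1 + n)"
      by (simp add: act_pt pt_eq_iff)
    also have "inv (g \<otimes> cj n k) \<otimes> (g \<otimes> cj n l) = cj n (inv k \<otimes> l)"
      using c gc by (simp add: inv_mult_group cj_mult cj_inv m_assoc)
    finally have "inv k \<otimes> l \<in> Vn 1" using c cj_Vn_iff[of "inv k \<otimes> l" n "1 + n"] by simp
    then show "u = w" using c by (simp add: uw pt_eq_iff)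
  qed
  show "act g n ` pt 1 ` V = {w \<in> Q. up w = pt n g}"
  proof (intro subset_antisym subsetI)
    fix w assume "w \<in> act g n ` pt 1 ` V"
    then obtain k where k: "k \<in> V" "w = act g n (pt 1 k)" by blast
    have kc: "k \<in> carrier G" using k V_carrier by blast
    have w: "w = pt (1 + n) (g \<otimes> cj n k)" using k kc gc by (simp add: act_pt)
    have "inv (g \<otimes> cj n k) \<otimes> g = inv (cj n k)"
      using kc gc by (simp add: inv_mult_group m_assoc)
    also have "\<dots> \<in> Vn n"
      using k kc cj_Vn_iff[of k n n] subgroup.m_inv_closed[OF Vn_subgroup] by simp
    finally have "up w = pt n g"
      using kc gc by (simp add: w up_pt pt_eq_iff)
    moreover have "w \<in> Q" unfolding w by (simp add: g k(1) VV_mult cj_VV V_VV)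
    ultimately show "w \<in> {w \<in> Q. up w = pt n g}" by blast
  next
    fix w assume "w \<in> {w \<in> Q. up w = pt n g}"
    then obtain m h where w: "w = pt m h" "h \<in> VV" "up w = pt n g" by (auto elim: Q_cases)
    have hc: "h \<in> carrier G" using w VV_carrier by blast
    from w(1,3) gc hc have m: "m = n + 1" and "inv h \<otimes> g \<in> Vn n"
      by (auto simp: up_pt pt_eq_iff)
    then have "inv (inv h \<otimes> g) \<in> Vn n" using subgroup.m_inv_closed[OF Vn_subgroup] by blast
    then have gh: "inv g \<otimes> h \<in> Vn n" using gc hc by (simp add: inv_mult_group)
    define k where "k = cj (- n) (inv g \<otimes> h)"
    have k: "k \<in> V" using gh by (simp add: k_def Vn_iff)
    have "w = act g n (pt 1 k)"
      using w m gc hc k V_carrier by (simp add: act_pt k_def add.commute)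
    with k show "w \<in> act g n ` pt 1 ` V" by blast
  qed
qed

lemma lcosets_V: "lcosets\<^bsub>G\<lparr>carrier := V\<rparr>\<^esub> (conj_set G x V) = (\<lambda>g. g <#\<^bsub>G\<^esub> Vn 1) ` V"
  by (auto simp: LCOSETS_def)

lemma pt1_V: "pt 1 ` V = Pair 1 ` (lcosets\<^bsub>G\<lparr>carrier := V\<rparr>\<^esub> (conj_set G x V))"
  unfolding lcosets_V by (auto simp: pt_def)

lemma card_children:
  assumes "u \<in> Q"
  shows "card {w \<in> Q. up w = u} = card (lcosets\<^bsub>G\<lparr>carrier := V\<rparr>\<^esub> (conj_set G x V))"
    and "finite {w \<in> Q. up w = u} = finite (lcosets\<^bsub>G\<lparr>carrier := V\<rparr>\<^esub> (conj_set G x V))"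
proof -
  from assms obtain n g where u: "u = pt n g" "g \<in> VV" by (rule Q_cases)
  have inj: "inj_on (Pair (1::int)) S" for S :: "'a set set" by (simp add: inj_on_def)
  show "card {w \<in> Q. up w = u} = card (lcosets\<^bsub>G\<lparr>carrier := V\<rparr>\<^esub> (conj_set G x V))"
    using bij_betw_same_card[OF children_bij[OF u(2), of n]] card_image[OF inj]
    by (simp add: u pt1_V)
  show "finite {w \<in> Q. up w = u} = finite (lcosets\<^bsub>G\<lparr>carrier := V\<rparr>\<^esub> (conj_set G x V))"
    using bij_betw_finite[OF children_bij[OF u(2), of n]] finite_image_iff[OF inj]
    by (simp add: u pt1_V)
qed

end

text \<open>If \<open>xVx\<^sup>-\<^sup>1\<close> is a proper subgroup then \<open>x\<close> has infinite order, so that \<open>THE\<close> in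
  \<^const>\<open>coset_action\<close> is meaningful.\<close>

locale proper_contraction = contraction +
  assumes proper: "conj_set G x V \<noteq> V"
begin

text \<open>If two powers with exponents \<open>i < j\<close> agreed, then
  \<open>Vn i = Vn j\<close> would lie in \<open>Vn (i + 1)\<close>, and conjugating back by
  \<open>x [^] i\<close> would give \<open>V = Vn 1\<close>.\<close>

lemma pow_inj: "x [^] (m::int) = x [^] n \<longleftrightarrow> m = n"
proof
  assume eq: "x [^] m = x [^] n"
  have False if "i < j" and ij: "x [^] i = x [^] j" for i j :: int
  proof -
    have "Vn i \<subseteq> Vn (i + 1)" using Vn_antimono[of "i + 1" j] that by simp
    have "V \<subseteq> Vn 1"
    proof
      fix g assume g: "g \<in> V"
      then have "cj i g \<in> Vn i" using V_carrier cj_Vn_iff[of g i i] by simp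
      then have "cj i g \<in> Vn (i + 1)" using \<open>Vn i \<subseteq> Vn (i + 1)\<close> by blast
      then show "g \<in> Vn 1" using g V_carrier cj_Vn_iff[of g i "i + 1"] by simp
    qed
    then show False using proper contract by (auto simp: Vn_1)
  qed
  from this[of m n] this[of n m] eq show "m = n" by (metis linorder_neqE)
qed simp

lemma the_exponent [simp]: "(THE k::int. x [^] k = x [^] n) = n"
  by (rule the_equality) (simp_all add: pow_inj)

lemma coset_action_eq: "coset_action G x (h, x [^] k) u = act h k u"
  by (simp add: coset_action_def act_def conj_set_pow split: prod.split)

end

subsection \<open>The semidirect product and its action on the coset tree\<close>

context contraction
begin

lemma generate_x: "generate G {x} = range (\<lambda>k::int. x [^] k)"
  using generate_pow[OF x_closed] by auto

lemma semidirect_cases: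
  assumes "p \<in> carrier (semidirect G VV x)"
  obtains h k where "p = (h, x [^] (k::int))" "h \<in> VV"
  using assms by (auto simp: semidirect_def generate_x)

lemma semidirect_carrier_iff [simp]:
  "(h, x [^] (k::int)) \<in> carrier (semidirect G VV x) \<longleftrightarrow> h \<in> VV"
  by (auto simp: semidirect_def generate_x)

lemma semidirect_mult:
  "(h, x [^] (k::int)) \<otimes>\<^bsub>semidirect G VV x\<^esub> (g, x [^] (l::int)) = (h \<otimes> cj k g, x [^] (k + l))"
  by (simp add: semidirect_def cj_def int_pow_mult)

lemma semidirect_one: "\<one>\<^bsub>semidirect G VV x\<^esub> = (\<one>, x [^] (0::int))"
  by (simp add: semidirect_def)

lemma group_semidirect: "group (semidirect G VV x)"
proof (rule groupI)
  let ?S = "semidirect G VV x"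
  show "\<one>\<^bsub>?S\<^esub> \<in> carrier ?S" unfolding semidirect_one semidirect_carrier_iff by (rule VV_one)
  fix p assume "p \<in> carrier ?S"
  then obtain h k where p: "p = (h, x [^] (k::int))" "h \<in> VV" by (rule semidirect_cases)
  have hc: "h \<in> carrier G" using p VV_carrier by blast
  show "\<one>\<^bsub>?S\<^esub> \<otimes>\<^bsub>?S\<^esub> p = p"
    unfolding semidirect_one p(1) semidirect_mult using hc by simp
  have "(cj (- k) (inv h), x [^] (- k)) \<otimes>\<^bsub>?S\<^esub> p = \<one>\<^bsub>?S\<^esub>"
    unfolding semidirect_one p(1) semidirect_mult using hc by (simp add: cj_inv)
  moreover have "(cj (- k) (inv h), x [^] (- k)) \<in> carrier ?S"
    using p by (simp only: semidirect_carrier_iff cj_VV VV_inv)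
  ultimately show "\<exists>y\<in>carrier ?S. y \<otimes>\<^bsub>?S\<^esub> p = \<one>\<^bsub>?S\<^esub>" by blast
  fix p' assume "p' \<in> carrier ?S"
  then obtain h' k' where p': "p' = (h', x [^] (k'::int))" "h' \<in> VV" by (rule semidirect_cases)
  show "p \<otimes>\<^bsub>?S\<^esub> p' \<in> carrier ?S"
    unfolding p(1) p'(1) semidirect_mult semidirect_carrier_iff
    using p(2) p'(2) by (simp add: VV_mult cj_VV)
  fix p'' assume "p'' \<in> carrier ?S"
  then obtain h'' k'' where p'': "p'' = (h'', x [^] (k''::int))" "h'' \<in> VV"
    by (rule semidirect_cases)
  show "p \<otimes>\<^bsub>?S\<^esub> p' \<otimes>\<^bsub>?S\<^esub> p'' = p \<otimes>\<^bsub>?S\<^esub> (p' \<otimes>\<^bsub>?S\<^esub> p'')"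
    unfolding p(1) p'(1) p''(1) semidirect_mult
    using p(2) p'(2) p''(2) by (simp add: VV_carrier cj_mult m_assoc add.assoc)
qed

lemma act_in_Q: "h \<in> VV \<Longrightarrow> u \<in> Q \<Longrightarrow> act h k u \<in> Q"
  by (auto elim!: Q_cases simp: act_pt VV_carrier VV_mult cj_VV)

lemma act_act:
  "h \<in> VV \<Longrightarrow> g \<in> VV \<Longrightarrow> u \<in> Q \<Longrightarrow> act h k (act g l u) = act (h \<otimes> cj k g) (k + l) u"
  by (auto elim!: Q_cases simp: act_pt VV_carrier cj_mult m_assoc add.commute add.left_commute)

lemma act_one: "u \<in> Q \<Longrightarrow> act \<one> 0 u = u"
  by (auto elim!: Q_cases simp: act_pt VV_carrier)

lemma up_act: "h \<in> VV \<Longrightarrow> u \<in> Q \<Longrightarrow> up (act h k u) = act h k (up u)"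
  by (auto elim!: Q_cases simp: act_pt up_pt VV_carrier algebra_simps)

lemma act_inverse:
  assumes "h \<in> VV" "u \<in> Q"
  shows "act h k (act (cj (- k) (inv h)) (- k) u) = u"
    and "act (cj (- k) (inv h)) (- k) (act h k u) = u"
  using assms by (simp_all add: act_act act_one cj_VV VV_inv VV_carrier cj_inv)

text \<open>The power of \<open>x\<close> adjusts the level and turns the representative into
  \<open>cj (m - n) g\<close>; the left factor then corrects it to \<open>h\<close>.\<close>

lemma act_transitive:
  assumes "g \<in> VV" "h \<in> VV"
  shows "act (h \<otimes> inv (cj (m - n) g)) (m - n) (pt n g) = pt m h"
  using assms by (simp add: act_pt VV_carrier m_assoc)

lemma act_fixes_iff:
  assumes "h \<in> VV"
  shows "act h 0 (pt n \<one>) = pt n \<one> \<longleftrightarrow> h \<in> Vn n"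
  using assms subgroup.m_inv_closed[OF Vn_subgroup, of h n] subgroup.m_inv_closed[OF Vn_subgroup, of "inv h" n]
  by (auto simp: act_pt pt_eq_iff VV_carrier)

end

section \<open>The isometry group of a tree, and conjugacy of representations\<close>

lemma subgroup_Isom: "subgroup (Isom T) (BijGroup (verts T))"
proof (rule group.subgroupI[OF group_BijGroup])
  let ?B = "BijGroup (verts T)"
  show "Isom T \<subseteq> carrier ?B" by (auto simp: Isom_def BijGroup_def)
  have "(\<lambda>v\<in>verts T. v) \<in> Isom T" by (simp add: Isom_def id_Bij)
  then show "Isom T \<noteq> {}" by blast
  fix a assume a: "a \<in> Isom T"
  then have aB: "a \<in> Bij (verts T)" by (simp add: Isom_def)
  then have bb: "bij_betw a (verts T) (verts T)" by (simp add: Bij_def)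
  show "inv\<^bsub>?B\<^esub> a \<in> Isom T"
  proof -
    have "graph_dist T (inv_into (verts T) a u) (inv_into (verts T) a v) = graph_dist T u v"
      if uv: "u \<in> verts T" "v \<in> verts T" for u v
    proof -
      let ?u = "inv_into (verts T) a u" and ?v = "inv_into (verts T) a v"
      have "?u \<in> verts T" "?v \<in> verts T" using uv aB by (auto intro: Bij_inv_into_mem)
      then have "graph_dist T (a ?u) (a ?v) = graph_dist T ?u ?v" using a by (simp add: Isom_def)
      moreover have "a ?u = u" "a ?v = v" using uv bb by (auto simp: bij_betw_inv_into_right)
      ultimately show ?thesis by simp
    qed
    then show ?thesis using aB by (simp add: inv_BijGroup Isom_def restrict_inv_into_Bij)
  qed
  fix b assume b: "b \<in> Isom T"
  then have bB: "b \<in> Bij (verts T)" by (simp add: Isom_def)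
  have "b v \<in> verts T" if "v \<in> verts T" for v using bB that by (auto dest: Bij_imp_funcset)
  then show "a \<otimes>\<^bsub>?B\<^esub> b \<in> Isom T"
    using a b by (auto simp: Isom_def BijGroup_def compose_Bij compose_eq)
qed

lemma group_IsomGroup: "group (IsomGroup T)"
  unfolding IsomGroup_def by (rule group.subgroup_imp_group[OF group_BijGroup subgroup_Isom])

lemma IsomGroup_mult:
  "\<sigma> \<in> Isom T \<Longrightarrow> \<tau> \<in> Isom T \<Longrightarrow> \<sigma> \<otimes>\<^bsub>IsomGroup T\<^esub> \<tau> = compose (verts T) \<sigma> \<tau>"
  by (simp add: IsomGroup_def BijGroup_def Isom_def)

lemma Isom_in_verts: "\<sigma> \<in> Isom T \<Longrightarrow> v \<in> verts T \<Longrightarrow> \<sigma> v \<in> verts T"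
  by (auto simp: Isom_def dest: Bij_imp_funcset)

lemma Isom_eqI:
  assumes "\<sigma> \<in> Isom T" "\<tau> \<in> Isom T" "\<And>v. v \<in> verts T \<Longrightarrow> \<sigma> v = \<tau> v"
  shows "\<sigma> = \<tau>"
  using assms by (intro extensionalityI[of _ "verts T"]) (auto simp: Isom_def Bij_def)

text \<open>Conjugacy is intertwining, which avoids inverses of isometries.\<close>

lemma conjugate_reps_iff:
  assumes "\<And>p. p \<in> carrier (semidirect G H x) \<Longrightarrow> \<rho>\<^sub>1 p \<in> Isom T"
    and "\<And>p. p \<in> carrier (semidirect G H x) \<Longrightarrow> \<rho>\<^sub>2 p \<in> Isom T"
  shows "conjugate_reps G H x T \<omega> \<rho>\<^sub>1 \<rho>\<^sub>2 \<longleftrightarrow>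
    (\<exists>\<sigma> \<in> Isom_end T \<omega>. \<forall>p \<in> carrier (semidirect G H x). \<forall>v \<in> verts T.
      \<rho>\<^sub>2 p (\<sigma> v) = \<sigma> (\<rho>\<^sub>1 p v))"
proof -
  interpret I: group "IsomGroup T" by (rule group_IsomGroup)
  have carrier: "carrier (IsomGroup T) = Isom T" by (simp add: IsomGroup_def)
  have "\<rho>\<^sub>2 p = \<sigma> \<otimes>\<^bsub>IsomGroup T\<^esub> \<rho>\<^sub>1 p \<otimes>\<^bsub>IsomGroup T\<^esub> inv\<^bsub>IsomGroup T\<^esub> \<sigma> \<longleftrightarrow>
      (\<forall>v \<in> verts T. \<rho>\<^sub>2 p (\<sigma> v) = \<sigma> (\<rho>\<^sub>1 p v))"
    if p: "p \<in> carrier (semidirect G H x)" and \<sigma>: "\<sigma> \<in> Isom_end T \<omega>" for p \<sigma>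
  proof -
    have s: "\<sigma> \<in> Isom T" using \<sigma> by (simp add: Isom_end_def)
    note r = assms(1)[OF p] assms(2)[OF p]
    have "\<rho>\<^sub>2 p = \<sigma> \<otimes>\<^bsub>IsomGroup T\<^esub> \<rho>\<^sub>1 p \<otimes>\<^bsub>IsomGroup T\<^esub> inv\<^bsub>IsomGroup T\<^esub> \<sigma> \<longleftrightarrow>
        \<sigma> \<otimes>\<^bsub>IsomGroup T\<^esub> \<rho>\<^sub>1 p = \<rho>\<^sub>2 p \<otimes>\<^bsub>IsomGroup T\<^esub> \<sigma>"
      using I.inv_solve_right[of "\<rho>\<^sub>2 p" "\<sigma> \<otimes>\<^bsub>IsomGroup T\<^esub> \<rho>\<^sub>1 p" \<sigma>] r s
        I.m_closed[of \<sigma> "\<rho>\<^sub>1 p"] by (simp add: carrier)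
    also have "\<dots> \<longleftrightarrow> compose (verts T) \<sigma> (\<rho>\<^sub>1 p) = compose (verts T) (\<rho>\<^sub>2 p) \<sigma>"
      using r s by (simp add: IsomGroup_mult)
    also have "\<dots> \<longleftrightarrow> (\<forall>v \<in> verts T. \<rho>\<^sub>2 p (\<sigma> v) = \<sigma> (\<rho>\<^sub>1 p v))"
      by (auto simp: compose_def restrict_def fun_eq_iff)
    finally show ?thesis .
  qed
  then show ?thesis by (auto simp: conjugate_reps_def)
qed

subsection \<open>The representation on a tree\<close>

text \<open>The tree keeps its own parent map, while \<open>\<psi>\<close> is any parent-preserving
  bijection from the coset tree. This serves both \<open>V\<close> and an intermediate subgroup,
  represented on the same tree with the same end.\<close>

locale coset_tree_rep = proper_contraction + ended_tree +
  fixes \<psi>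
  assumes \<psi>_bij: "bij_betw \<psi> Q (verts T)"
    and \<psi>_up: "u \<in> Q \<Longrightarrow> \<psi> (up u) = par (\<psi> u)"
begin

abbreviation rep :: "'a \<times> 'a \<Rightarrow> 'c \<Rightarrow> 'c"
  where "rep \<equiv> coset_rep G VV x V T \<psi>"

lemma \<psi>_in: "u \<in> Q \<Longrightarrow> \<psi> u \<in> verts T"
  using \<psi>_bij by (auto simp: bij_betw_def)

lemma \<psi>_eq_iff: "u \<in> Q \<Longrightarrow> w \<in> Q \<Longrightarrow> \<psi> u = \<psi> w \<longleftrightarrow> u = w"
  using \<psi>_bij by (auto simp: bij_betw_def inj_on_def)

lemma \<psi>_cases:
  assumes "v \<in> verts T"
  obtains u where "u \<in> Q" "v = \<psi> u"
proof -
  have "v \<in> \<psi> ` Q" using assms bij_betw_imp_surj_on[OF \<psi>_bij] by simp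
  then show thesis using that by blast
qed

lemma rep_apply:
  assumes "u \<in> Q"
  shows "rep (h, x [^] (k::int)) (\<psi> u) = \<psi> (act h k u)"
  using assms bij_betw_inv_into_left[OF \<psi>_bij assms]
  by (simp add: coset_rep_def \<psi>_in verts_eq coset_action_eq)

lemma rep_Isom_end:
  assumes "p \<in> carrier (semidirect G VV x)"
  shows "rep p \<in> Isom_end T \<omega>"
proof -
  from assms obtain h k where p: "p = (h, x [^] (k::int))" "h \<in> VV" by (rule semidirect_cases)
  have "bij_betw (rep p) (verts T) (verts T)"
  proof (rule bij_betwI)
    let ?q = "(cj (- k) (inv h), x [^] (- k))"
    have q: "cj (- k) (inv h) \<in> VV" using p by (simp add: cj_VV VV_inv)
    show "rep p \<in> verts T \<rightarrow> verts T" "rep ?q \<in> verts T \<rightarrow> verts T"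
      using p q by (auto elim!: \<psi>_cases simp: rep_apply act_in_Q \<psi>_in)
    show "rep ?q (rep p v) = v" "rep p (rep ?q v) = v" if "v \<in> verts T" for v
      using that p q by (auto elim!: \<psi>_cases simp: rep_apply act_in_Q act_inverse)
  qed
  then have "rep p \<in> Bij (verts T)" by (simp add: Bij_def coset_rep_def)
  moreover have "rep p (par v) = par (rep p v)" if v: "v \<in> verts T" for v
  proof -
    from v obtain u where u: "u \<in> Q" "v = \<psi> u" by (rule \<psi>_cases)
    then show ?thesis
      using p by (simp add: rep_apply Q.par_in act_in_Q up_act flip: \<psi>_up)
  qed
  ultimately show ?thesis by (rule Isom_endI)
qed

lemma rep_Isom: "p \<in> carrier (semidirect G VV x) \<Longrightarrow> rep p \<in> Isom T"
  using rep_Isom_end by (simp add: Isom_end_def)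

lemma rep_mult:
  assumes "p \<in> carrier (semidirect G VV x)" "p' \<in> carrier (semidirect G VV x)"
  shows "rep (p \<otimes>\<^bsub>semidirect G VV x\<^esub> p') = compose (verts T) (rep p) (rep p')"
proof (rule Isom_eqI[of _ T])
  from assms obtain h k h' k' where p: "p = (h, x [^] (k::int))" "h \<in> VV"
    "p' = (h', x [^] (k'::int))" "h' \<in> VV" by (elim semidirect_cases)
  interpret S: group "semidirect G VV x" by (rule group_semidirect)
  interpret I: group "IsomGroup T" by (rule group_IsomGroup)
  show "rep (p \<otimes>\<^bsub>semidirect G VV x\<^esub> p') \<in> Isom T" using assms by (intro rep_Isom S.m_closed)
  show "compose (verts T) (rep p) (rep p') \<in> Isom T"
    using I.m_closed[of "rep p" "rep p'"] rep_Isom[OF assms(1)] rep_Isom[OF assms(2)]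
    by (simp add: IsomGroup_mult) (simp add: IsomGroup_def)
  fix v assume "v \<in> verts T"
  then obtain u where "u \<in> Q" "v = \<psi> u" by (rule \<psi>_cases)
  then show "rep (p \<otimes>\<^bsub>semidirect G VV x\<^esub> p') v = compose (verts T) (rep p) (rep p') v"
    unfolding p(1,3) semidirect_mult
    using p(2,4) by (simp add: compose_eq \<psi>_in rep_apply act_in_Q act_act)
qed

lemma rep_hom: "rep \<in> hom (semidirect G VV x) (IsomEndGroup T \<omega>)"
proof (rule homI)
  show "rep p \<in> carrier (IsomEndGroup T \<omega>)" if "p \<in> carrier (semidirect G VV x)" for p
    using rep_Isom_end[OF that] by (simp add: IsomEndGroup_def)
  show "rep (p \<otimes>\<^bsub>semidirect G VV x\<^esub> p') = rep p \<otimes>\<^bsub>IsomEndGroup T \<omega>\<^esub> rep p'"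
    if "p \<in> carrier (semidirect G VV x)" "p' \<in> carrier (semidirect G VV x)" for p p'
    using rep_mult[OF that] rep_Isom[OF that(1)] rep_Isom[OF that(2)]
    by (simp add: IsomEndGroup_def BijGroup_def Isom_def)
qed

lemma rep_image_subgroup: "subgroup (rep ` carrier (semidirect G VV x)) (IsomGroup T)"
proof -
  have "rep \<in> hom (semidirect G VV x) (IsomGroup T)"
    using rep_mult rep_Isom by (auto intro!: homI simp: IsomGroup_mult) (simp add: IsomGroup_def)
  then have "group_hom (semidirect G VV x) (IsomGroup T) rep"
    by (intro group_hom.intro group_hom_axioms.intro group_semidirect group_IsomGroup)
  then show ?thesis by (rule group_hom.img_is_subgroup)
qed

lemma rep_transitive:
  assumes "u \<in> verts T" "v \<in> verts T"
  obtains p where "p \<in> carrier (semidirect G VV x)" "rep p u = v"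
proof -
  from assms obtain n g m h where uv: "u = \<psi> (pt n g)" "v = \<psi> (pt m h)" "g \<in> VV" "h \<in> VV"
    by (metis Q_cases \<psi>_cases)
  let ?p = "(h \<otimes> inv (cj (m - n) g), x [^] (m - n))"
  have "?p \<in> carrier (semidirect G VV x)"
    unfolding semidirect_carrier_iff using uv by (simp add: VV_mult VV_inv cj_VV)
  moreover have "rep ?p u = v"
    unfolding uv(1,2) using uv(3,4) by (simp add: rep_apply act_transitive)
  ultimately show thesis by (rule that)
qed

end

section \<open>Continuity in topological groups and in the isometry group\<close>

context topological_group
begin

lemma in_topspace [simp]: "g \<in> topspace X \<longleftrightarrow> g \<in> carrier G"
  by (simp add: topspace_eq)

lemma continuous_mult':
  assumes "continuous_map Y X f" "continuous_map Y X g"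
  shows "continuous_map Y X (\<lambda>y. f y \<otimes> g y)"
  using continuous_map_compose[OF continuous_map_pairedI[OF assms] continuous_mult]
  by (simp add: o_def)

lemma continuous_translation:
  assumes "a \<in> carrier G" "b \<in> carrier G"
  shows "continuous_map X X (\<lambda>g. a \<otimes> g \<otimes> b)"
  using assms by (intro continuous_mult') (auto simp: continuous_map_const)

end

text \<open>Openness is relative to \<open>VV\<close>, matching the topology of the semidirect
  product; \<open>V\<close> is in general not open in the whole group.\<close>

locale topological_contraction = proper_contraction G x V + topological_group G X
  for G (structure) and x V X +
  assumes V_compact: "compactin X V"
    and V_open: "openin (subtopology X VV) V"
begin

lemma continuous_cj: "continuous_map X X (cj n)"
  unfolding cj_def by (rule continuous_translation) auto

lemma topspace_VV: "topspace (subtopology X VV) = VV"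
  using VV_carrier by (auto simp: topspace_eq)

lemma Vn_compact: "compactin X (Vn n)"
  unfolding conj_set_pow by (rule image_compactin[OF V_compact continuous_cj])

lemma Vn_open: "openin (subtopology X VV) (Vn n)"
proof -
  have "continuous_map (subtopology X VV) (subtopology X VV) (cj (- n))"
    using continuous_map_from_subtopology[OF continuous_cj] cj_VV
    by (auto simp: continuous_map_in_subtopology topspace_VV)
  from openin_continuous_map_preimage[OF this V_open]
  have "openin (subtopology X VV) {g \<in> VV. cj (- n) g \<in> V}" unfolding topspace_VV .
  also have "{g \<in> VV. cj (- n) g \<in> V} = Vn n" using Vn_iff VV_carrier Vn_VV by blast
  finally show ?thesis .
qed

lemma topspace_semidirect:
  "topspace (semidirect_topology G X VV x) = carrier (semidirect G VV x)"
  by (simp add: semidirect_topology_def topspace_VV[simplified] semidirect_def)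

end

lemma topspace_isom [simp]: "topspace (isom_topology T) = Isom T"
proof -
  have "Isom T \<subseteq> verts T \<rightarrow>\<^sub>E verts T"
    by (auto simp: Isom_def PiE_def dest: Bij_imp_funcset Bij_imp_extensional)
  then show ?thesis by (auto simp: isom_topology_def)
qed

lemma Hausdorff_isom: "Hausdorff_space (isom_topology T)"
  unfolding isom_topology_def
  by (intro Hausdorff_space_subtopology) (simp add: Hausdorff_space_product_topology)

lemma continuous_evaluation:
  "v \<in> verts T \<Longrightarrow> continuous_map (isom_topology T) (discrete_topology (verts T)) (\<lambda>\<sigma>. \<sigma> v)"
  unfolding isom_topology_def
  by (rule continuous_map_from_subtopology) (rule continuous_map_product_projection)

lemma continuous_into_isom:
  "continuous_map Y (isom_topology T) f \<longleftrightarrow> f \<in> topspace Y \<rightarrow> Isom T \<and>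
    (\<forall>v \<in> verts T. continuous_map Y (discrete_topology (verts T)) (\<lambda>y. f y v))"
proof -
  have "f ` topspace Y \<subseteq> extensional (verts T)" if "f \<in> topspace Y \<rightarrow> Isom T"
    using that by (auto simp: Isom_def Bij_def Pi_iff)
  then show ?thesis
    by (auto simp: isom_topology_def continuous_map_in_subtopology continuous_map_componentwise)
qed

locale coset_scale_rep = coset_tree_rep G x V T par lev \<omega> \<psi> + topological_contraction G x V X
  for G (structure) and x V X T par lev \<omega> \<psi>
begin

lemma rep_pt:
  assumes "g \<in> carrier G" "g \<in> VV" "h \<in> VV"
  shows "rep (h, x [^] (k::int)) (\<psi> (pt n g)) = \<psi> (pt (n + k) (h \<otimes> cj k g))"
  using assms by (simp add: rep_apply act_pt VV_carrier)

text \<open>Tested one vertex at a time: two elements with the same exponent \<open>k\<close> move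
  \<open>\<psi> (pt n g)\<close> alike when the resulting cosets of \<open>Vn (n + k)\<close> agree,
  which is an open condition because \<open>Vn (n + k)\<close> is open.\<close>

lemma rep_continuous: "continuous_map (semidirect_topology G X VV x) (isom_topology T) rep"
  unfolding continuous_into_isom topspace_semidirect
proof (intro conjI ballI funcsetI)
  show "rep p \<in> Isom T" if "p \<in> carrier (semidirect G VV x)" for p using that by (rule rep_Isom)
  fix v assume v: "v \<in> verts T"
  obtain n g where g: "v = \<psi> (pt n g)" "g \<in> VV" using v by (metis Q_cases \<psi>_cases)
  have gc: "g \<in> carrier G" using g VV_carrier by blast
  let ?S = "semidirect_topology G X VV x"
  have nbhd: "\<exists>W. openin ?S W \<and> p \<in> W \<and> (\<forall>p'\<in>W. rep p' v = rep p v)"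
    if p: "p \<in> carrier (semidirect G VV x)" for p
  proof -
    from p obtain h k where hk: "p = (h, x [^] (k::int))" "h \<in> VV" by (rule semidirect_cases)
    have hc: "h \<in> carrier G" using hk VV_carrier by blast
    define a where "a = h \<otimes> cj k g"
    have a: "a \<in> carrier G" "a \<in> VV" using hc gc hk g by (simp_all add: a_def VV_mult cj_VV)
    \<comment> \<open>The quotient of the representatives of the two images of \<open>v\<close>: the
      images coincide when it lies in \<open>Vn (n + k)\<close>.\<close>
    let ?f = "\<lambda>h'. inv a \<otimes> h' \<otimes> cj k g"
    have cont: "continuous_map (subtopology X VV) (subtopology X VV) ?f"
      unfolding continuous_map_in_subtopology
    proof
      show "continuous_map (subtopology X VV) X ?f"
        using a gc by (intro continuous_map_from_subtopology continuous_translation) auto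
      show "?f \<in> topspace (subtopology X VV) \<rightarrow> VV"
        using a g VV_carrier by (auto simp: VV_mult VV_inv cj_VV)
    qed
    define N where "N = {h' \<in> VV. ?f h' \<in> Vn (n + k)}"
    have "openin (subtopology X VV) N"
      using openin_continuous_map_preimage[OF cont Vn_open] unfolding N_def topspace_VV .
    then have "openin ?S (N \<times> {x [^] k})" (is "openin _ ?W")
      by (simp add: semidirect_topology_def openin_prod_Times_iff generate_x)
    moreover have "?f h = \<one>" using hc gc by (simp add: a_def inv_mult_group m_assoc)
    then have "p \<in> ?W" using hk subgroup.one_closed[OF Vn_subgroup] by (simp add: N_def)
    moreover have "\<forall>p'\<in>?W. rep p' v = rep p v"
    proof
      fix p' assume "p' \<in> ?W"
      then obtain h' where h': "p' = (h', x [^] k)" "h' \<in> VV" "?f h' \<in> Vn (n + k)"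
        by (auto simp: N_def)
      have "pt (n + k) a = pt (n + k) (h' \<otimes> cj k g)"
        using h' a gc VV_carrier by (simp add: pt_eq_iff m_assoc)
      then show "rep p' v = rep p v"
        unfolding g(1) h'(1) hk(1) rep_pt[OF gc g(2) h'(2)] rep_pt[OF gc g(2) hk(2)]
        by (simp add: a_def)
    qed
    ultimately show ?thesis by blast
  qed
  have "openin ?S {p \<in> topspace ?S. rep p v \<in> U}" for U
  proof (subst openin_subopen, rule ballI)
    fix p assume p: "p \<in> {p \<in> topspace ?S. rep p v \<in> U}"
    then obtain W where W: "openin ?S W" "p \<in> W" "\<forall>p'\<in>W. rep p' v = rep p v"
      using nbhd unfolding topspace_semidirect by blast
    have "W \<subseteq> {p \<in> topspace ?S. rep p v \<in> U}"
    proof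
      fix p' assume "p' \<in> W"
      moreover have "rep p v \<in> U" using p by blast
      ultimately show "p' \<in> {p \<in> topspace ?S. rep p v \<in> U}"
        using bspec[OF W(3)] subsetD[OF openin_subset[OF W(1)]] by (metis (no_types, lifting) mem_Collect_eq)
    qed
    then show "\<exists>W. openin ?S W \<and> p \<in> W \<and> W \<subseteq> {p \<in> topspace ?S. rep p v \<in> U}"
      using W by blast
  qed
  moreover have "rep p v \<in> verts T" if "p \<in> carrier (semidirect G VV x)" for p
    using Isom_in_verts[OF rep_Isom[OF that] v] .
  ultimately show "continuous_map ?S (discrete_topology (verts T)) (\<lambda>p. rep p v)"
    by (auto simp: continuous_map_def topspace_semidirect)
qed

text \<open>The elements sending a base vertex to a given vertex form a coset of \<open>V\<close>, which is compact,
  and the isometries doing so form an open set.\<close>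

lemma rep_closed: "closedin (isom_topology T) (rep ` carrier (semidirect G VV x))"
  (is "closedin _ ?P")
  unfolding closedin_def
proof
  let ?v0 = "\<psi> (pt 0 \<one>)"
  have v0: "?v0 \<in> verts T" by (simp add: \<psi>_in VV_one)
  show "?P \<subseteq> topspace (isom_topology T)" using rep_Isom by auto
  show "openin (isom_topology T) (topspace (isom_topology T) - ?P)"
  proof (subst openin_subopen, rule ballI)
    fix \<sigma> assume "\<sigma> \<in> topspace (isom_topology T) - ?P"
    then have \<sigma>: "\<sigma> \<in> Isom T" "\<sigma> \<notin> ?P" by auto
    have "\<sigma> ?v0 \<in> verts T" using Isom_in_verts[OF \<sigma>(1) v0] .
    then obtain k h where w: "\<sigma> ?v0 = \<psi> (pt k h)" "h \<in> VV" by (metis Q_cases \<psi>_cases)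
    have hc: "h \<in> carrier G" using w VV_carrier by blast
    \<comment> \<open>\<open>C\<close> collects the elements that send \<open>?v0\<close> to
      \<open>\<sigma> ?v0\<close>. The trailing factor \<open>\<one>\<close> only matches the
      two-sided form of \<open>continuous_translation\<close>.\<close>
    define C where "C = (\<lambda>g. h \<otimes> g \<otimes> \<one>) ` Vn k \<times> {x [^] k}"
    have C: "compactin (semidirect_topology G X VV x) C"
      unfolding C_def semidirect_topology_def compactin_Times compactin_subtopology
      using image_compactin[OF Vn_compact continuous_translation[OF hc one_closed]] w(2)
      by (auto simp: generate_x compactin_discrete_topology VV_mult Vn_VV VV_one)
    let ?F = "{\<tau> \<in> Isom T. \<tau> ?v0 = \<sigma> ?v0}"
    have "openin (isom_topology T) {\<tau> \<in> topspace (isom_topology T). \<tau> ?v0 \<in> {\<sigma> ?v0}}"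
      by (rule openin_continuous_map_preimage[OF continuous_evaluation[OF v0]])
        (simp add: Isom_in_verts[OF \<sigma>(1) v0])
    then have F: "openin (isom_topology T) ?F" by simp
    have PF: "\<tau> \<in> rep ` C" if "\<tau> \<in> ?P" "\<tau> ?v0 = \<sigma> ?v0" for \<tau>
    proof -
      from that(1) obtain p where p: "p \<in> carrier (semidirect G VV x)" "\<tau> = rep p" by blast
      from p(1) obtain h' k' where hk': "p = (h', x [^] (k'::int))" "h' \<in> VV"
        by (rule semidirect_cases)
      have h'c: "h' \<in> carrier G" using hk' VV_carrier by blast
      have "\<psi> (pt k' h') = \<psi> (pt k h)"
        using that(2) rep_pt[OF one_closed VV_one hk'(2), of k' 0] h'c
        by (simp add: p(2) hk'(1) w(1))
      then have "pt k h = pt k' h'" using hk' w by (simp add: \<psi>_eq_iff)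
      then have "k' = k" "inv h \<otimes> h' \<in> Vn k" using hc h'c by (auto simp: pt_eq_iff)
      moreover have "h' = h \<otimes> (inv h \<otimes> h') \<otimes> \<one>" using hc h'c by simp
      ultimately have "p \<in> C" unfolding C_def hk'(1) by blast
      then show ?thesis using p(2) by blast
    qed
    have "C \<subseteq> carrier (semidirect G VV x)"
      using compactin_subset_topspace[OF C] by (simp add: topspace_semidirect)
    then have "\<sigma> \<notin> rep ` C" using \<sigma>(2) by blast
    moreover have "closedin (isom_topology T) (rep ` C)"
      by (rule compactin_imp_closedin[OF Hausdorff_isom image_compactin[OF C rep_continuous]])
    then have "openin (isom_topology T) (?F - rep ` C)" using F by (rule openin_diff[rotated])
    ultimately show "\<exists>W. openin (isom_topology T) W \<and> \<sigma> \<in> W \<and> W \<subseteq> topspace (isom_topology T) - ?P"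
      using \<sigma>(1) PF by (intro exI[of _ "?F - rep ` C"]) auto
  qed
qed

theorem rep_scale_group_rep: "scale_group_rep G X VV x T \<omega> rep"
proof -
  let ?P = "rep ` carrier (semidirect G VV x)"
  have "continuous_map (semidirect_topology G X VV x)
      (subtopology (isom_topology T) (Isom_end T \<omega>)) rep"
    using rep_continuous rep_Isom_end
    by (auto simp: continuous_map_in_subtopology topspace_semidirect)
  moreover have "?P \<subseteq> Isom_end T \<omega>" using rep_Isom_end by blast
  moreover have "\<exists>\<sigma>\<in>?P. \<sigma> u = v" if "u \<in> verts T" "v \<in> verts T" for u v
    using rep_transitive[OF that] by blast
  ultimately show ?thesis
    unfolding scale_group_rep_def scale_group_def
    using rep_hom rep_image_subgroup rep_closed by blast
qed

end

subsection \<open>Rigidity\<close>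

text \<open>\<open>Y\<close> and \<open>Z\<close> are the restrictions to \<open>H\<close> and to the powers of \<open>x\<close> of an action of the semidirect
  product. Compactness enters only through finite orbits of \<open>V\<close>.\<close>

locale level_action = contraction + level_tree +
  fixes Y :: "'a \<Rightarrow> 'c \<Rightarrow> 'c" and Z :: "int \<Rightarrow> 'c \<Rightarrow> 'c"
  assumes Y_in: "h \<in> VV \<Longrightarrow> v \<in> A \<Longrightarrow> Y h v \<in> A"
    and Z_in: "v \<in> A \<Longrightarrow> Z k v \<in> A"
    and Y_par: "h \<in> VV \<Longrightarrow> v \<in> A \<Longrightarrow> Y h (par v) = par (Y h v)"
    and Z_par: "v \<in> A \<Longrightarrow> Z k (par v) = par (Z k v)"
    and Y_mult: "h \<in> VV \<Longrightarrow> g \<in> VV \<Longrightarrow> v \<in> A \<Longrightarrow> Y (h \<otimes> g) v = Y h (Y g v)"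
    and Y_one: "v \<in> A \<Longrightarrow> Y \<one> v = v"
    and Z_add: "v \<in> A \<Longrightarrow> Z (k + l) v = Z k (Z l v)"
    and Z_0: "v \<in> A \<Longrightarrow> Z 0 v = v"
    and Z_Y: "h \<in> VV \<Longrightarrow> v \<in> A \<Longrightarrow> Z k (Y h v) = Y (cj k h) (Z k v)"
    and orbit_finite: "v \<in> A \<Longrightarrow> finite ((\<lambda>h. Y h v) ` V)"
    and transitive: "u \<in> A \<Longrightarrow> v \<in> A \<Longrightarrow> \<exists>h\<in>VV. \<exists>k. Y h (Z k u) = v"
    and branching: "\<exists>u\<in>A. \<exists>v\<in>A. u \<noteq> v \<and> par u = par v"
begin

lemma Z_inverse: "v \<in> A \<Longrightarrow> Z k (Z (- k) v) = v" "v \<in> A \<Longrightarrow> Z (- k) (Z k v) = v"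
  using Z_add[of v k "- k"] Z_add[of v "- k" k] by (simp_all add: Z_0)

lemma Y_anc: "h \<in> VV \<Longrightarrow> v \<in> A \<Longrightarrow> Y h ((par ^^ k) v) = (par ^^ k) (Y h v)"
  by (rule funpow_par_commute) (auto intro: Y_in Y_par)

lemma Z_anc: "v \<in> A \<Longrightarrow> Z n ((par ^^ k) v) = (par ^^ k) (Z n v)"
  by (rule funpow_par_commute) (auto intro: Z_in Z_par)

text \<open>If \<open>h\<close> shifted levels by a nonzero amount, its powers, which stay in
  \<open>V\<close>, would give the finite orbit of \<open>v\<close> infinitely many levels.\<close>

lemma Y_lev_V:
  assumes h: "h \<in> V" and v: "v \<in> A"
  shows "lev (Y h v) = lev v"
proof (rule ccontr)
  define b where "b = lev (Y h v) - lev v"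
  assume "lev (Y h v) \<noteq> lev v"
  then have b: "b \<noteq> 0" by (simp add: b_def)
  have hV: "h \<in> VV" and hc: "h \<in> carrier G" using h by (simp_all add: V_VV V_carrier)
  have powV: "h [^] n \<in> V" for n :: nat
    by (induction n) (simp_all add: subgroup.one_closed[OF V] subgroup.m_closed[OF V] h)
  have shift: "lev (Y h w) = lev w + b" if "w \<in> A" for w
    using level_shift_const[of "Y h" w v] Y_in Y_par hV that v by (simp add: b_def)
  have lev_pow: "lev (Y (h [^] n) v) = lev v + int n * b" for n :: nat
  proof (induction n)
    case 0
    then show ?case by (simp add: Y_one v)
  next
    case (Suc n)
    have pn: "h [^] n \<in> VV" using powV V_VV by blast
    have "h [^] Suc n = h \<otimes> h [^] n" using hc nat_pow_Suc2 by blast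
    then have "lev (Y (h [^] Suc n) v) = lev (Y (h [^] n) v) + b"
      using Y_mult[OF hV pn v] shift[OF Y_in[OF pn v]] by simp
    then show ?case using Suc by (simp add: algebra_simps)
  qed
  have "lev v + int n * b \<in> lev ` (\<lambda>h. Y h v) ` V" for n
    using imageI[OF imageI[OF powV[of n], of "\<lambda>h. Y h v"], of lev] by (simp add: lev_pow)
  then have "range (\<lambda>n. lev v + int n * b) \<subseteq> lev ` (\<lambda>h. Y h v) ` V" by blast
  then have "finite (range (\<lambda>n. lev v + int n * b))"
    using orbit_finite[OF v] by (meson finite_imageI finite_subset)
  moreover have "inj (\<lambda>n. lev v + int n * b)" using b by (simp add: inj_def)
  ultimately show False using range_inj_infinite by blast
qed

text \<open>A conjugate of \<open>h\<close> by a power of \<open>x\<close> lies in \<open>V\<close>,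
  and \<open>Z\<close> with any exponent shifts all levels equally.\<close>

lemma Y_lev:
  assumes h: "h \<in> VV" and v: "v \<in> A"
  shows "lev (Y h v) = lev v"
proof -
  obtain n where "h \<in> Vn n" using h by (auto simp: VV_def)
  then have n: "cj (- n) h \<in> V" by (simp add: Vn_iff)
  have "lev (Z (- n) (Y h v)) = lev (Z (- n) v)"
    using Y_lev_V[OF n Z_in[OF v]] h v by (simp add: Z_Y)
  moreover have "lev (Z (- n) (Y h v)) - lev (Y h v) = lev (Z (- n) v) - lev v"
    using level_shift_const[of "Z (- n)", OF Z_in Z_par Y_in[OF h v] v] by simp
  ultimately show ?thesis by simp
qed

text \<open>By transitivity some \<open>Y h (Z k v0)\<close> is the parent of \<open>v0\<close>. As
  \<open>Y h\<close> preserves levels, \<open>k * d = - 1\<close>, so the shift \<open>d\<close> is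
  a unit.\<close>

lemma Z_lev:
  obtains d where "d = 1 \<or> d = - 1" "\<And>v k. v \<in> A \<Longrightarrow> lev (Z k v) = lev v + k * d"
proof -
  obtain v0 where v0: "v0 \<in> A" using branching by blast
  define d where "d = lev (Z 1 v0) - lev v0"
  have step: "lev (Z 1 v) = lev v + d" if "v \<in> A" for v
    using level_shift_const[of "Z 1", OF Z_in Z_par that v0] by (simp add: d_def)
  have lev: "lev (Z k v) = lev v + k * d" if v: "v \<in> A" for k v
  proof (induction k rule: int_induct[where k = 0])
    case base
    then show ?case by (simp add: Z_0 v)
  next
    case (step1 i)
    then show ?case
      using Z_add[OF v, of 1 i] step[OF Z_in[OF v], of i] by (simp add: algebra_simps)
  next
    case (step2 i)
    then show ?case
      using Z_add[OF v, of 1 "i - 1"] step[OF Z_in[OF v], of "i - 1"] by (simp add: algebra_simps)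
  qed
  obtain h k where hk: "h \<in> VV" "Y h (Z k v0) = par v0"
    using transitive[OF v0 par_in[OF v0]] by blast
  then have "lev (Z k v0) = lev v0 - 1" using Y_lev[OF hk(1) Z_in[OF v0]] lev_par[OF v0] by metis
  then have "k * d = - 1" using lev[OF v0] by simp
  then have "d dvd 1" by (metis dvd_minus_iff dvd_triv_right)
  then have "d = 1 \<or> d = - 1" by auto
  with lev that show thesis by blast
qed

text \<open>The power of \<open>x\<close> in the element moving \<open>u\<close> to \<open>v\<close>
  must be trivial, since only that factor changes the level.\<close>

lemma level_transitive:
  assumes "u \<in> A" "v \<in> A" "lev u = lev v"
  shows "\<exists>h\<in>VV. Y h u = v"
proof -
  obtain d where d: "d = 1 \<or> d = - 1" "\<And>v k. v \<in> A \<Longrightarrow> lev (Z k v) = lev v + k * d"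
    using Z_lev by blast
  obtain h k where hk: "h \<in> VV" "Y h (Z k u) = v" using transitive assms by blast
  have "lev v = lev u + k * d" using Y_lev[OF hk(1) Z_in[OF assms(1)], of k] hk(2) d(2) assms by simp
  then have "k = 0" using d(1) assms by auto
  then show ?thesis using hk Z_0 assms by auto
qed

lemma fixed_conj:
  assumes "h \<in> VV" "v \<in> A"
  shows "Y h (Z n v) = Z n v \<longleftrightarrow> Y (cj (- n) h) v = v"
proof -
  have c: "cj (- n) h \<in> VV" using assms cj_VV by blast
  have "Z n (Y (cj (- n) h) v) = Y h (Z n v)"
    using Z_Y[OF c assms(2), of n] assms VV_carrier by simp
  then show ?thesis using Z_inverse(2) assms Y_in[OF c] by metis
qed

text \<open>If \<open>VV\<close> fixed \<open>v\<close>, it would fix every \<open>Z k v\<close>,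
  one vertex on each level. Being transitive on levels, it would leave each level with a single
  vertex, against \<open>branching\<close>.\<close>

lemma not_fixed:
  assumes v: "v \<in> A"
  shows "\<exists>h\<in>VV. Y h v \<noteq> v"
proof (rule ccontr)
  assume "\<not> (\<exists>h\<in>VV. Y h v \<noteq> v)"
  then have fx: "Y h (Z k v) = Z k v" if "h \<in> VV" for h k
    using fixed_conj[OF that v] cj_VV[OF that] by blast
  obtain d where d: "d = 1 \<or> d = - 1" "\<And>v k. v \<in> A \<Longrightarrow> lev (Z k v) = lev v + k * d"
    using Z_lev by blast
  obtain u w where uw: "u \<in> A" "w \<in> A" "u \<noteq> w" "par u = par w" using branching by blast
  then have "lev u = lev w" using lev_par[of u] lev_par[of w] by simp
  \<comment> \<open>Since \<open>d\<close> is 1 or -1, \<open>d * d = 1\<close>, so this exponent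
    moves \<open>v\<close> to the level of \<open>u\<close>.\<close>
  define k where "k = (lev u - lev v) * d"
  have "lev (Z k v) = lev u" using d v by (auto simp: k_def)
  then have "Z k v = u" "Z k v = w"
    using level_transitive[OF Z_in[OF v] uw(1)] level_transitive[OF Z_in[OF v] uw(2)]
      fx \<open>lev u = lev w\<close> by metis+
  with uw show False by simp
qed

text \<open>The orbit of \<open>v\<close> under \<open>V\<close> is finite and lies on one level, so
  a far enough ancestor is shared by the whole orbit.\<close>

lemma fixes_ancestor:
  assumes v: "v \<in> A"
  shows "\<exists>m. \<forall>h\<in>V. Y h ((par ^^ m) v) = (par ^^ m) v"
proof -
  let ?O = "(\<lambda>h. Y h v) ` V"
  have "\<forall>u\<in>?O. \<exists>i. (par ^^ i) u = (par ^^ i) v"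
    using confluent Y_in Y_lev V_VV v by blast
  then obtain f where f: "\<forall>u\<in>?O. (par ^^ f u) u = (par ^^ f u) v" by metis
  define m where "m = Max (f ` ?O)"
  have "Y h ((par ^^ m) v) = (par ^^ m) v" if h: "h \<in> V" for h
  proof -
    have "f (Y h v) \<le> m" unfolding m_def using orbit_finite[OF v] h by (intro Max_ge) auto
    moreover have "(par ^^ f (Y h v)) (Y h v) = (par ^^ f (Y h v)) v" using f h by blast
    ultimately have "(par ^^ m) (Y h v) = (par ^^ m) v" by (rule funpow_par_eq_mono[rotated])
    then show ?thesis using Y_anc h V_VV v by simp
  qed
  then show ?thesis by blast
qed

text \<open>If \<open>x\<close> moves away from the end, \<open>par (Z 1 v)\<close> and
  \<open>v\<close> are on the same level and hence share an ancestor; that ancestor is on an axis of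
  \<open>x\<close>. The opposite direction is excluded.\<close>

lemma axis:
  obtains u where "u \<in> A" "par (Z 1 u) = u" "\<And>k v. v \<in> A \<Longrightarrow> lev (Z k v) = lev v + k"
proof -
  obtain d where d: "d = 1 \<or> d = - 1" "\<And>v k. v \<in> A \<Longrightarrow> lev (Z k v) = lev v + k * d"
    using Z_lev by blast
  obtain v where v: "v \<in> A" using branching by blast
  show thesis
  proof (cases "d = 1")
    case True
    then have "lev (par (Z 1 v)) = lev v" using d v by (simp add: lev_par Z_in)
    then obtain N where N: "(par ^^ N) (par (Z 1 v)) = (par ^^ N) v"
      using confluent par_in Z_in v by blast
    have "par (Z 1 ((par ^^ N) v)) = (par ^^ N) v"
      using N by (simp add: Z_anc v funpow_swap1)
    then show thesis using that[of "(par ^^ N) v"] d True funpow_par_in v by simp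
  next
    case False
    text \<open>If \<open>x\<close> moved vertices towards the end, then all of \<open>H\<close> would fix a vertex of its axis.\<close>
    then have dm: "d = - 1" using d by blast
    then have "lev (Z 1 v) = lev (par v)" using d v by (simp add: lev_par)
    then obtain N where N: "(par ^^ N) (Z 1 v) = (par ^^ N) (par v)"
      using confluent par_in Z_in v by blast
    define u where "u = (par ^^ N) v"
    have u: "u \<in> A" "Z 1 u = par u"
      using N by (simp_all add: u_def Z_anc v funpow_par_in funpow_swap1)
    have Zpow: "Z (int k) u = (par ^^ k) u" for k
    proof (induction k)
      case (Suc k)
      have "Z (int (Suc k)) u = Z (int k) (Z 1 u)" using Z_add[OF u(1), of "int k" 1] by (simp add: add.commute)
      also have "\<dots> = par (Z (int k) u)" using u Z_par by simp
      finally show ?case using Suc by simp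
    qed (simp add: Z_0 u)
    obtain m where m: "\<forall>h\<in>V. Y h ((par ^^ m) u) = (par ^^ m) u"
      using fixes_ancestor[OF u(1)] by blast
    define w where "w = (par ^^ m) u"
    have w: "w \<in> A" using u by (simp add: w_def funpow_par_in)
    have Zw: "Z (int k) w = (par ^^ k) w" for k
      unfolding w_def Z_anc[OF u(1)] Zpow by (simp add: funpow_add[THEN fun_cong, simplified, symmetric] add.commute)
    have "Y h w = w" if h: "h \<in> VV" for h
    proof -
      obtain n where n: "n \<le> 0" "h \<in> Vn n" using VV_common_level[OF h h, of 0] by metis
      then have "cj (- n) h \<in> V" by (simp add: Vn_iff)
      then have "Y (cj (- n) h) w = w" using m by (simp add: w_def)
      then have fx: "Y h (Z n w) = Z n w" using fixed_conj[OF h w] by simp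
      \<comment> \<open>In this case positive powers of \<open>x\<close> act on \<open>w\<close> as
        passage to ancestors. As \<open>n\<close> is at most 0, \<open>w\<close> is an ancestor of
        \<open>Z n w\<close>, and \<open>h\<close> fixes the latter.\<close>
      have "w = Z (int (nat (- n))) (Z n w)" using n w by (simp add: Z_inverse)
      also have "\<dots> = Z n (Z (int (nat (- n))) w)"
        using Z_add[OF w, of "int (nat (- n))" n] Z_add[OF w, of n "int (nat (- n))"]
        by (simp add: add.commute)
      also have "\<dots> = (par ^^ nat (- n)) (Z n w)"
        unfolding Zw using Z_anc[OF w] by simp
      finally have w': "w = (par ^^ nat (- n)) (Z n w)" .
      have "Y h ((par ^^ nat (- n)) (Z n w)) = (par ^^ nat (- n)) (Y h (Z n w))"
        by (rule Y_anc[OF h Z_in[OF w]])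
      then show ?thesis using w' fx by simp
    qed
    then show thesis using not_fixed[OF w] by blast
  qed
qed

text \<open>Among the axis vertices fixed by \<open>V\<close> there is a lowest one, and maximality identifies its
  stabiliser.\<close>

lemma stabilizer:
  assumes maximal: "\<And>K. \<lbrakk>subgroup K G; Vn 1 \<subseteq> K; K \<subseteq> V\<rbrakk> \<Longrightarrow> K = Vn 1 \<or> K = V"
  obtains v0 where "v0 \<in> A" "par (Z 1 v0) = v0" "\<And>k v. v \<in> A \<Longrightarrow> lev (Z k v) = lev v + k"
    "\<And>h. h \<in> VV \<Longrightarrow> Y h v0 = v0 \<longleftrightarrow> h \<in> V"
proof -
  obtain u where u: "u \<in> A" "par (Z 1 u) = u" and lev: "\<And>k v. v \<in> A \<Longrightarrow> lev (Z k v) = lev v + k"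
    by (rule axis) (rule that)
  have par_Z: "par (Z (n + 1) u) = Z n u" for n
    using Z_add[OF u(1), of n 1] Z_par[OF Z_in[OF u(1)], of n 1] u(2) by simp
  have anc: "(par ^^ k) (Z n u) = Z (n - int k) u" for k n
  proof (induction k)
    case (Suc k)
    then show ?case using par_Z[of "n - int k - 1"] by (simp add: algebra_simps)
  qed simp
  define F where "F n \<longleftrightarrow> (\<forall>h\<in>V. Y h (Z n u) = Z n u)" for n
  obtain m where "\<forall>h\<in>V. Y h ((par ^^ m) (Z 0 u)) = (par ^^ m) (Z 0 u)"
    using fixes_ancestor[OF Z_in[OF u(1)]] by blast
  then have Fm: "F (- int m)" unfolding anc F_def by simp
  \<comment> \<open>\<open>F\<close> passes from a vertex to its ancestors. If it never failed,
    \<open>V\<close> would fix the whole axis, and conjugating by powers of \<open>x\<close> all of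
    \<open>VV\<close> would fix \<open>u\<close>, against \<open>not_fixed\<close>.\<close>
  have "\<exists>n. F n \<and> \<not> F (n + 1)"
  proof (rule ccontr)
    assume no: "\<not> (\<exists>n. F n \<and> \<not> F (n + 1))"
    have "F n" if "- int m \<le> n" for n
      using that by (induction n rule: int_ge_induct) (use Fm no in auto)
    moreover have "\<exists>n\<ge>- int m. n \<ge> k" for k by (intro exI[of _ "max (- int m) k"]) simp
    moreover have "F n" if "F k" "n \<le> k" for n k
    proof -
      have n: "Z n u = (par ^^ nat (k - n)) (Z k u)" using that(2) by (simp add: anc)
      have "Y h (Z n u) = Z n u" if "h \<in> V" for h
      proof -
        have "Y h (Z n u) = (par ^^ nat (k - n)) (Y h (Z k u))"
          unfolding n
          by (rule Y_anc[OF V_VV[OF that] Z_in[OF u(1)]])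
        also have "Y h (Z k u) = Z k u" using \<open>F k\<close> that by (simp add: F_def)
        finally show ?thesis using n by simp
      qed
      then show ?thesis by (simp add: F_def)
    qed
    ultimately have F: "F n" for n by blast
    have "Y h u = u" if h: "h \<in> VV" for h
    proof -
      obtain n where "h \<in> Vn n" using h by (auto simp: VV_def)
      then have "cj (- n) h \<in> V" by (simp add: Vn_iff)
      then have "Y (cj (- n) h) (Z (- n) u) = Z (- n) u" using F by (simp add: F_def)
      then have "Y h (Z n (Z (- n) u)) = Z n (Z (- n) u)"
        using fixed_conj[OF h Z_in[OF u(1)]] by simp
      then show ?thesis by (simp add: Z_inverse u)
    qed
    then show False using not_fixed[OF u(1)] by blast
  qed
  then obtain n where n: "F n" "\<not> F (n + 1)" by blast
  define v0 where "v0 = Z n u"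
  have v0: "v0 \<in> A" by (simp add: v0_def Z_in u)
  have Zv0: "Z k v0 = Z (k + n) u" for k by (simp add: v0_def Z_add u)
  have Vfix: "Y h v0 = v0" if "h \<in> V" for h using n(1) that by (simp add: F_def v0_def)
  \<comment> \<open>This lies between \<open>Vn 1\<close> and \<open>V\<close> and differs from
    \<open>V\<close> by the choice of \<open>n\<close>, so maximality forces it to be
    \<open>Vn 1\<close>.\<close>
  define D where "D = {h \<in> V. Y h (Z 1 v0) = Z 1 v0}"
  have "subgroup D G"
  proof (rule subgroupI)
    show "D \<subseteq> carrier G" using V_carrier by (auto simp: D_def)
    have "\<one> \<in> D" using subgroup.one_closed[OF V] v0 by (simp add: D_def Y_one Z_in)
    then show "D \<noteq> {}" by blast
    fix a assume a: "a \<in> D"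
    then have aV: "a \<in> V" "a \<in> VV" "a \<in> carrier G" by (auto simp: D_def V_VV V_carrier)
    have "Y (inv a) (Y a (Z 1 v0)) = Z 1 v0"
      using Y_mult[of "inv a" a] Y_one aV v0 by (simp add: VV_inv Z_in)
    then show "inv a \<in> D" using a subgroup.m_inv_closed[OF V aV(1)] by (simp add: D_def)
    fix b assume "b \<in> D"
    then show "a \<otimes> b \<in> D"
      using a subgroup.m_closed[OF V] v0 by (simp add: D_def Y_mult V_VV Z_in)
  qed
  moreover have "Vn 1 \<subseteq> D"
  proof
    fix h assume h: "h \<in> Vn 1"
    then have "h \<in> V" using Vn_antimono[of 0 1] Vn_0 by auto
    moreover have "Y h (Z 1 v0) = Z 1 v0"
      unfolding fixed_conj[OF Vn_VV[OF h] v0] using h Vfix by (simp add: Vn_iff del: int_pow_1)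
    ultimately show "h \<in> D" by (simp add: D_def)
  qed
  moreover have "D \<subseteq> V" by (auto simp: D_def)
  moreover have "D \<noteq> V" using n(2) by (auto simp: D_def F_def Zv0 add.commute)
  ultimately have D: "D = Vn 1" using maximal by blast
  \<comment> \<open>Fixing a vertex far down the axis implies fixing its ancestor
    \<open>Z 1 v0\<close>, so \<open>h\<close> is in \<open>Vn 1\<close>. Conjugating by the inverse
    of \<open>x\<close> then gives an element of \<open>V\<close> and moves one step back towards
    \<open>v0\<close>.\<close>
  have deep: "h \<in> Vn (int k)" if "h \<in> V" "Y h (Z (int k) v0) = Z (int k) v0" for h k
    using that
  proof (induction k arbitrary: h)
    case 0
    then show ?case by simp
  next
    case (Suc k)
    have hV: "h \<in> VV" and hc: "h \<in> carrier G" using Suc.prems by (simp_all add: V_VV V_carrier)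
    have Z1: "(par ^^ k) (Z (int (Suc k)) v0) = Z 1 v0" by (simp add: Zv0 anc)
    have "Y h (Z 1 v0) = Z 1 v0"
      using Y_anc[OF hV Z_in[OF v0], of k "int (Suc k)"] by (simp only: Suc.prems(2) Z1)
    then have "h \<in> Vn 1" using Suc.prems(1) D by (auto simp: D_def)
    then have h1: "cj (- 1) h \<in> V" by (simp add: Vn_iff del: int_pow_1)
    have "Y h (Z 1 (Z (int k) v0)) = Z 1 (Z (int k) v0)"
      using Suc.prems(2) Z_add[OF v0, of 1 "int k"] by (simp add: add.commute)
    then have "Y (cj (- 1) h) (Z (int k) v0) = Z (int k) v0"
      using fixed_conj[OF hV Z_in[OF v0]] by simp
    then have "cj (- 1) h \<in> Vn (int k)" using Suc.IH h1 by blast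
    then show ?case using cj_Vn_iff[OF hc, of "- 1" "int k"] by (simp add: add.commute)
  qed
  \<comment> \<open>A general \<open>h\<close> is first conjugated into \<open>V\<close> by a power
    \<open>k\<close> of \<open>x\<close>; \<open>deep\<close> applies there, at
    \<open>Z (int k) v0\<close>, and conjugating back returns \<open>h\<close> to
    \<open>V\<close>.\<close>
  have "h \<in> V" if h: "h \<in> VV" "Y h v0 = v0" for h
  proof -
    obtain n where n: "n \<le> 0" "h \<in> Vn n" using VV_common_level[OF h(1) h(1), of 0] by metis
    define k where "k = nat (- n)"
    have hc: "h \<in> carrier G" using h VV_carrier by blast
    have k: "cj (int k) h \<in> V" using n by (simp add: k_def Vn_iff)
    have "Y (cj (int k) h) (Z (int k) v0) = Z (int k) v0"
      using fixed_conj[OF cj_VV[OF h(1)] v0, of "int k" "int k"] h hc by simp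
    then have "cj (int k) h \<in> Vn (int k)" using deep k by blast
    then show ?thesis using cj_Vn_iff[OF hc, of "int k" "int k"] by simp
  qed
  with Vfix have "\<And>h. h \<in> VV \<Longrightarrow> Y h v0 = v0 \<longleftrightarrow> h \<in> V" by blast
  moreover have "par (Z 1 v0) = v0" using par_Z[of n] by (metis Zv0 add.commute v0_def)
  ultimately show thesis using that v0 lev by blast
qed

text \<open>The map sends \<open>pt n g\<close> to \<open>Y g (Z n v0)\<close>, where
  \<open>v0\<close> has stabiliser \<open>V\<close> in \<open>VV\<close>. It is well defined and
  injective because \<open>Z n v0\<close> then has stabiliser \<open>Vn n\<close>, and surjective by
  transitivity on levels.\<close>

lemma intertwiner:
  assumes maximal: "\<And>K. \<lbrakk>subgroup K G; Vn 1 \<subseteq> K; K \<subseteq> V\<rbrakk> \<Longrightarrow> K = Vn 1 \<or> K = V"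
  obtains s where "bij_betw s Q A" "\<And>u. u \<in> Q \<Longrightarrow> s (up u) = par (s u)"
    "\<And>h k u. h \<in> VV \<Longrightarrow> u \<in> Q \<Longrightarrow> s (act h k u) = Y h (Z k (s u))"
proof -
  obtain v0 where v0: "v0 \<in> A" "par (Z 1 v0) = v0" and lev: "\<And>k v. v \<in> A \<Longrightarrow> lev (Z k v) = lev v + k"
    and stab: "\<And>h. h \<in> VV \<Longrightarrow> Y h v0 = v0 \<longleftrightarrow> h \<in> V"
    using stabilizer[OF maximal] by blast
  have stab_n: "Y h (Z n v0) = Z n v0 \<longleftrightarrow> h \<in> Vn n" if "h \<in> VV" for h n
    using fixed_conj[OF that v0(1)] stab[OF cj_VV[OF that]] Vn_iff VV_carrier[OF that] by simp
  have eq_iff: "Y g (Z n v0) = Y h (Z n v0) \<longleftrightarrow> pt n g = pt n h" if gh: "g \<in> VV" "h \<in> VV" for g h n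
  proof -
    have "Y g (Z n v0) = Y h (Z n v0) \<longleftrightarrow> Y (inv g) (Y g (Z n v0)) = Y (inv g) (Y h (Z n v0))"
    proof
      assume "Y (inv g) (Y g (Z n v0)) = Y (inv g) (Y h (Z n v0))"
      then have "Y g (Y (inv g) (Y g (Z n v0))) = Y g (Y (inv g) (Y h (Z n v0)))" by simp
      moreover have "Y g (Y (inv g) w) = w" if "w \<in> A" for w
        using Y_mult[of g "inv g" w] gh that by (simp add: VV_inv Y_one VV_carrier)
      ultimately show "Y g (Z n v0) = Y h (Z n v0)" using gh v0 by (simp add: Y_in Z_in)
    qed simp
    also have "Y (inv g) (Y g (Z n v0)) = Z n v0"
      using Y_mult[of "inv g" g] gh v0 by (simp add: VV_inv Y_one VV_carrier Z_in)
    also have "Y (inv g) (Y h (Z n v0)) = Y (inv g \<otimes> h) (Z n v0)"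
      using gh v0 by (simp add: Y_mult VV_inv Z_in)
    also have "Z n v0 = Y (inv g \<otimes> h) (Z n v0) \<longleftrightarrow> inv g \<otimes> h \<in> Vn n"
      using stab_n[of "inv g \<otimes> h" n] gh by (auto simp: VV_mult VV_inv)
    finally show ?thesis using gh by (simp add: pt_eq_iff VV_carrier)
  qed
  define s where "s u = Y (SOME g. g \<in> VV \<and> u = pt (fst u) g) (Z (fst u) v0)" for u
  have s_pt: "s (pt n g) = Y g (Z n v0)" if g: "g \<in> VV" for n g
  proof -
    define g' where "g' = (SOME g'. g' \<in> VV \<and> pt n g = pt n g')"
    have "g' \<in> VV \<and> pt n g = pt n g'" unfolding g'_def by (rule someI[of _ g]) (simp add: g)
    then have "Y g' (Z n v0) = Y g (Z n v0)" using eq_iff g by metis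
    then show ?thesis by (simp add: s_def g'_def)
  qed
  have lev_s: "lev (s (pt n g)) = lev v0 + n" if "g \<in> VV" for n g
    using that v0 lev by (simp add: s_pt Y_lev Z_in)
  have "bij_betw s Q A"
  proof (rule bij_betw_imageI)
    show "inj_on s Q"
    proof (rule inj_onI)
      fix u w assume uw: "u \<in> Q" "w \<in> Q" "s u = s w"
      obtain n g m h where p: "u = pt n g" "g \<in> VV" "w = pt m h" "h \<in> VV"
        using uw by (metis Q_cases)
      then have "n = m" using lev_s uw(3) by (metis add_left_cancel)
      then show "u = w" using p uw(3) eq_iff by (simp add: s_pt)
    qed
    show "s ` Q = A"
    proof (intro subset_antisym subsetI)
      fix v assume "v \<in> s ` Q"
      then show "v \<in> A" using v0 by (auto elim!: Q_cases simp: s_pt Y_in Z_in)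
    next
      fix v assume v: "v \<in> A"
      define n where "n = lev v - lev v0"
      have "lev (Z n v0) = lev v" using lev[OF v0(1)] by (simp add: n_def)
      then obtain h where h: "h \<in> VV" "Y h (Z n v0) = v"
        using level_transitive Z_in v0 v by blast
      then have "v = s (pt n h)" by (simp add: s_pt)
      then show "v \<in> s ` Q" using h by simp
    qed
  qed
  moreover have "s (up u) = par (s u)" if "u \<in> Q" for u
  proof -
    from that obtain n g where u: "u = pt n g" "g \<in> VV" by (rule Q_cases)
    have "par (Z n v0) = Z (n - 1) (par (Z 1 v0))"
      using Z_add[OF v0(1), of "n - 1" 1] Z_par[OF Z_in[OF v0(1)], of "n - 1" 1] by simp
    then show ?thesis
      using u v0 by (simp add: up_pt VV_carrier s_pt Z_in flip: Y_par)
  qed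
  moreover have "s (act h k u) = Y h (Z k (s u))" if "h \<in> VV" "u \<in> Q" for h k u
  proof -
    from that(2) obtain n g where u: "u = pt n g" "g \<in> VV" by (rule Q_cases)
    then show ?thesis using that(1) v0
      by (simp add: act_pt VV_carrier s_pt VV_mult cj_VV Y_mult Z_in Z_Y Z_add add.commute[of n k])
  qed
  ultimately show thesis by (rule that)
qed

end

subsection \<open>Tree identifications\<close>

locale identified_contraction = contraction +
  fixes T :: "'c ugraph" and \<omega> and \<phi> and q :: nat
  assumes regular: "regular_tree (q + 1) T"
    and end_in: "\<omega> \<in> ends T"
    and ident: "tree_identification G VV x V T \<omega> \<phi>"
    and q: "q > 1"
begin

text \<open>The parent map of the coset tree of \<open>V\<close>, carried to the tree by
  \<open>\<phi>\<close>. It serves as the direction towards \<open>\<omega>\<close> for every other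
  representation as well.\<close>

definition up' :: "'c \<Rightarrow> 'c"
  where "up' v = \<phi> (up (inv_into Q \<phi> v))"

definition lev' :: "'c \<Rightarrow> int"
  where "lev' v = fst (inv_into Q \<phi> v)"

lemma \<phi>_bij: "bij_betw \<phi> Q (verts T)"
  using ident by (simp add: tree_identification_def verts_eq)

lemma \<phi>_in: "u \<in> Q \<Longrightarrow> \<phi> u \<in> verts T"
  using \<phi>_bij by (auto simp: bij_betw_def)

lemma \<phi>_cases:
  assumes "v \<in> verts T"
  obtains u where "u \<in> Q" "v = \<phi> u"
proof -
  have "v \<in> \<phi> ` Q" using assms bij_betw_imp_surj_on[OF \<phi>_bij] by simp
  then show thesis using that by blast
qed

lemma \<phi>_eq_iff: "u \<in> Q \<Longrightarrow> w \<in> Q \<Longrightarrow> \<phi> u = \<phi> w \<longleftrightarrow> u = w"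
  using \<phi>_bij by (auto simp: bij_betw_def inj_on_def)

lemma up'_\<phi>: "u \<in> Q \<Longrightarrow> up' (\<phi> u) = \<phi> (up u)"
  by (simp add: up'_def bij_betw_inv_into_left[OF \<phi>_bij])

lemma lev'_\<phi>: "u \<in> Q \<Longrightarrow> lev' (\<phi> u) = fst u"
  by (simp add: lev'_def bij_betw_inv_into_left[OF \<phi>_bij])

lemma funpow_up'_\<phi>: "u \<in> Q \<Longrightarrow> (up' ^^ k) (\<phi> u) = \<phi> ((up ^^ k) u)"
  by (induction k) (simp_all add: up'_\<phi> Q.funpow_par_in)

sublocale ended_tree T up' lev' \<omega>
proof
  show "up' v \<in> verts T" if "v \<in> verts T" for v
    using that by (auto elim!: \<phi>_cases simp: up'_\<phi> Q.par_in \<phi>_in)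
  show "lev' (up' v) = lev' v - 1" if v: "v \<in> verts T" for v
  proof -
    from v obtain u where "u \<in> Q" "v = \<phi> u" by (rule \<phi>_cases)
    then show ?thesis by (simp add: up'_\<phi> lev'_\<phi> Q.par_in Q.lev_par)
  qed
  show "\<exists>i. (up' ^^ i) v = (up' ^^ i) w"
    if vw: "v \<in> verts T" "w \<in> verts T" "lev' v = lev' w" for v w
  proof -
    from vw(1) obtain u where u: "u \<in> Q" "v = \<phi> u" by (rule \<phi>_cases)
    from vw(2) obtain u' where u': "u' \<in> Q" "w = \<phi> u'" by (rule \<phi>_cases)
    have "fst u = fst u'" using vw(3) u u' by (simp add: lev'_\<phi>)
    then obtain i where "(up ^^ i) u = (up ^^ i) u'" using Q.confluent u u' by blast
    then have "(up' ^^ i) v = (up' ^^ i) w" using u u' by (simp add: funpow_up'_\<phi>)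
    then show ?thesis by blast
  qed
  show "\<omega> \<in> ends T" by (rule end_in)
  show "{v, w} \<in> edges T \<longleftrightarrow> v = up' w \<or> w = up' v" if vw: "v \<in> verts T" "w \<in> verts T" for v w
  proof -
    from vw(1) obtain u where u: "u \<in> Q" "v = \<phi> u" by (rule \<phi>_cases)
    from vw(2) obtain u' where u': "u' \<in> Q" "w = \<phi> u'" by (rule \<phi>_cases)
    have "{v, w} \<in> edges T \<longleftrightarrow> {u, u'} \<in> edges (coset_graph G VV x V)"
      using ident u u' by (simp add: tree_identification_def verts_eq)
    also have "\<dots> \<longleftrightarrow> u = up u' \<or> u' = up u" using edges_iff u u' by simp
    also have "\<dots> \<longleftrightarrow> v = up' w \<or> w = up' v"
      using u u' by (simp add: up'_\<phi> \<phi>_eq_iff Q.par_in)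
    finally show ?thesis .
  qed
  \<comment> \<open>The ray of trivial cosets becomes an ancestor ray, so its membership in
    \<open>\<omega>\<close> identifies the end.\<close>
  have "\<phi> (coset_ray G x V \<one> k) = (up' ^^ k) (\<phi> (pt 0 \<one>))" for k
    by (simp add: funpow_up'_\<phi> VV_one funpow_up_pt coset_ray_def) (simp add: pt_def)
  then have "\<phi> \<circ> coset_ray G x V \<one> = (\<lambda>k. (up' ^^ k) (\<phi> (pt 0 \<one>)))" by auto
  moreover have "\<phi> \<circ> coset_ray G x V \<one> \<in> \<omega>"
    using ident VV_one by (simp add: tree_identification_def)
  ultimately show "\<exists>v\<in>verts T. (\<lambda>k. (up' ^^ k) v) \<in> \<omega>"
    using \<phi>_in[of "pt 0 \<one>"] VV_one by auto
qed

text \<open>Exactly one of the \<open>q + 1\<close> neighbours is the parent; levels prevent it from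
  also being a child.\<close>

lemma T_children:
  assumes v: "v \<in> verts T"
  shows "finite {u \<in> verts T. up' u = v}" "card {u \<in> verts T. up' u = v} = q"
proof -
  have "{u \<in> verts T. {u, v} \<in> edges T} = insert (up' v) {u \<in> verts T. up' u = v}"
    using v par_in by (auto simp: edge_iff)
  moreover have "finite {u \<in> verts T. {u, v} \<in> edges T}"
    "card {u \<in> verts T. {u, v} \<in> edges T} = q + 1"
    using regular v by (simp_all add: regular_tree_def)
  moreover have "up' v \<notin> {u \<in> verts T. up' u = v}"
  proof
    assume "up' v \<in> {u \<in> verts T. up' u = v}"
    then have "lev' (up' (up' v)) = lev' v" by simp
    then show False using v by (simp add: lev_par par_in)
  qed
  ultimately show "finite {u \<in> verts T. up' u = v}" "card {u \<in> verts T. up' u = v} = q"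
    by simp_all
qed

text \<open>\<open>\<phi>\<close> matches the children of the base vertex, which correspond to the
  cosets, with the \<open>q\<close> children of its image.\<close>

lemma index_q:
  "finite (lcosets\<^bsub>G\<lparr>carrier := V\<rparr>\<^esub> (conj_set G x V))"
  "card (lcosets\<^bsub>G\<lparr>carrier := V\<rparr>\<^esub> (conj_set G x V)) = q"
proof -
  have u: "pt 0 \<one> \<in> Q" by (simp add: VV_one)
  let ?C = "{w \<in> Q. up w = pt 0 \<one>}"
  have "\<phi> ` ?C = {w \<in> verts T. up' w = \<phi> (pt 0 \<one>)}"
    using u by (auto elim!: \<phi>_cases simp: \<phi>_in up'_\<phi> \<phi>_eq_iff Q.par_in)
  then have bij: "bij_betw \<phi> ?C {w \<in> verts T. up' w = \<phi> (pt 0 \<one>)}"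
    using \<phi>_bij by (auto simp: bij_betw_def intro: inj_on_subset)
  have "finite ?C" "card ?C = q"
    using T_children[OF \<phi>_in[OF u]] bij_betw_finite[OF bij] bij_betw_same_card[OF bij] by simp_all
  then show "finite (lcosets\<^bsub>G\<lparr>carrier := V\<rparr>\<^esub> (conj_set G x V))"
    "card (lcosets\<^bsub>G\<lparr>carrier := V\<rparr>\<^esub> (conj_set G x V)) = q"
    using card_children[OF u] by simp_all
qed

sublocale proper_contraction
proof
  show "conj_set G x V \<noteq> V"
  proof
    assume eq: "conj_set G x V = V"
    have "g <#\<^bsub>G\<^esub> V = V" if "g \<in> V" for g
      using coset_join3 V that V_carrier by blast
    then have "lcosets\<^bsub>G\<lparr>carrier := V\<rparr>\<^esub> (conj_set G x V) \<subseteq> {V}"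
      by (auto simp: LCOSETS_def eq)
    then have "q \<le> card {V}" using index_q by (metis card_mono finite.emptyI finite.insertI)
    then show False using q by simp
  qed
qed

sublocale coset_tree_rep G x V T up' lev' \<omega> \<phi>
  by unfold_locales (simp_all add: \<phi>_bij up'_\<phi>)

lemma T_branching: "\<exists>u\<in>verts T. \<exists>v\<in>verts T. u \<noteq> v \<and> up' u = up' v"
proof -
  let ?C = "{u \<in> verts T. up' u = \<phi> (pt 0 \<one>)}"
  have v: "\<phi> (pt 0 \<one>) \<in> verts T" using \<phi>_in VV_one by simp
  have "\<not> card ?C \<le> Suc 0" using T_children(2)[OF v] q by simp
  then obtain u v where "u \<in> ?C" "v \<in> ?C" "u \<noteq> v"
    unfolding card_le_Suc0_iff_eq[OF T_children(1)[OF v]] by blast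
  then show ?thesis by (intro bexI[of _ u] bexI[of _ v]) simp_all
qed

end

subsection \<open>Intermediate subgroups\<close>

text \<open>The multiplicativity of the index, as a bijection so that finiteness transfers too:
  \<open>(P, R)\<close> goes to the translate of \<open>R\<close> by a chosen representative of
  \<open>P\<close>.\<close>

lemma (in group) index_tower:
  assumes A: "subgroup A G" and B: "subgroup B G" and C: "subgroup C G"
    and "C \<subseteq> B" "B \<subseteq> A"
  obtains f where "bij_betw f ((\<lambda>g. g <#\<^bsub>G\<^esub> B) ` A \<times> (\<lambda>g. g <#\<^bsub>G\<^esub> C) ` B) ((\<lambda>g. g <#\<^bsub>G\<^esub> C) ` A)"
proof -
  note carr = subgroup.mem_carrier[OF A] subgroup.mem_carrier[OF B] subgroup.mem_carrier[OF C]
  define r where "r P = (SOME g. g \<in> A \<and> P = g <#\<^bsub>G\<^esub> B)" for P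
  have r: "r P \<in> A \<and> P = r P <#\<^bsub>G\<^esub> B" if "P \<in> (\<lambda>g. g <#\<^bsub>G\<^esub> B) ` A" for P
    unfolding r_def by (rule someI_ex) (use that in blast)
  define f where "f = (\<lambda>(P, R). r P <#\<^bsub>G\<^esub> R)"
  have f: "f (P, b <#\<^bsub>G\<^esub> C) = (r P \<otimes> b) <#\<^bsub>G\<^esub> C"
    if "P \<in> (\<lambda>g. g <#\<^bsub>G\<^esub> B) ` A" "b \<in> B" for P b
    using r[OF that(1)] that(2) carr subgroup.subset[OF C] by (simp add: f_def lcos_m_assoc)
  have "bij_betw f ((\<lambda>g. g <#\<^bsub>G\<^esub> B) ` A \<times> (\<lambda>g. g <#\<^bsub>G\<^esub> C) ` B) ((\<lambda>g. g <#\<^bsub>G\<^esub> C) ` A)"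
  proof (rule bij_betw_imageI)
    show "inj_on f ((\<lambda>g. g <#\<^bsub>G\<^esub> B) ` A \<times> (\<lambda>g. g <#\<^bsub>G\<^esub> C) ` B)"
    proof (rule inj_onI)
      fix u w
      assume u: "u \<in> (\<lambda>g. g <#\<^bsub>G\<^esub> B) ` A \<times> (\<lambda>g. g <#\<^bsub>G\<^esub> C) ` B"
        and w: "w \<in> (\<lambda>g. g <#\<^bsub>G\<^esub> B) ` A \<times> (\<lambda>g. g <#\<^bsub>G\<^esub> C) ` B" and fuw: "f u = f w"
      obtain P b where P: "P \<in> (\<lambda>g. g <#\<^bsub>G\<^esub> B) ` A" "b \<in> B" "u = (P, b <#\<^bsub>G\<^esub> C)"
        using u by blast
      obtain P' b' where P': "P' \<in> (\<lambda>g. g <#\<^bsub>G\<^esub> B) ` A" "b' \<in> B" "w = (P', b' <#\<^bsub>G\<^esub> C)"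
        using w by blast
      have c: "r P \<in> carrier G" "r P' \<in> carrier G" "b \<in> carrier G" "b' \<in> carrier G"
        using r[OF P(1)] r[OF P'(1)] P P' carr by blast+
      have "(r P \<otimes> b) <#\<^bsub>G\<^esub> C = (r P' \<otimes> b') <#\<^bsub>G\<^esub> C"
        using fuw f[OF P(1,2)] f[OF P'(1,2)] unfolding P(3) P'(3) by simp
      then have mem: "inv (r P \<otimes> b) \<otimes> (r P' \<otimes> b') \<in> C" using c by (simp add: l_coset_eq_iff[OF C])
      then have "b \<otimes> (inv (r P \<otimes> b) \<otimes> (r P' \<otimes> b')) \<otimes> inv b' \<in> B"
        using P(2) P'(2) assms(4) B by (blast intro: subgroup.m_closed subgroup.m_inv_closed)
      also have "b \<otimes> (inv (r P \<otimes> b) \<otimes> (r P' \<otimes> b')) \<otimes> inv b' = inv (r P) \<otimes> r P'"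
        using c by (simp add: inv_mult_group m_assoc inv_mult_cancel)
      finally have "r P <#\<^bsub>G\<^esub> B = r P' <#\<^bsub>G\<^esub> B" using c by (simp add: l_coset_eq_iff[OF B])
      then have PP: "P = P'" using r[OF P(1)] r[OF P'(1)] by metis
      have "inv (r P \<otimes> b) \<otimes> (r P' \<otimes> b') = inv b \<otimes> b'"
        unfolding PP[symmetric] using c by (simp add: inv_mult_group m_assoc inv_mult_cancel)
      then have "b <#\<^bsub>G\<^esub> C = b' <#\<^bsub>G\<^esub> C" using mem c by (simp add: l_coset_eq_iff[OF C])
      then show "u = w" by (simp add: P(3) P'(3) PP)
    qed
    show "f ` ((\<lambda>g. g <#\<^bsub>G\<^esub> B) ` A \<times> (\<lambda>g. g <#\<^bsub>G\<^esub> C) ` B) = (\<lambda>g. g <#\<^bsub>G\<^esub> C) ` A"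
    proof (intro subset_antisym subsetI)
      fix z assume "z \<in> f ` ((\<lambda>g. g <#\<^bsub>G\<^esub> B) ` A \<times> (\<lambda>g. g <#\<^bsub>G\<^esub> C) ` B)"
      then obtain P b where P: "P \<in> (\<lambda>g. g <#\<^bsub>G\<^esub> B) ` A" "b \<in> B" "z = f (P, b <#\<^bsub>G\<^esub> C)" by blast
      have "r P \<otimes> b \<in> A" using r[OF P(1)] P(2) assms(5) subgroup.m_closed[OF A] by blast
      then show "z \<in> (\<lambda>g. g <#\<^bsub>G\<^esub> C) ` A" using P f by blast
    next
      fix z assume "z \<in> (\<lambda>g. g <#\<^bsub>G\<^esub> C) ` A"
      then obtain g where g: "g \<in> A" "z = g <#\<^bsub>G\<^esub> C" by blast
      let ?P = "g <#\<^bsub>G\<^esub> B"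
      have P: "?P \<in> (\<lambda>g. g <#\<^bsub>G\<^esub> B) ` A" using g by blast
      have c: "r ?P \<in> carrier G" "g \<in> carrier G" using r[OF P] g carr by blast+
      have "r ?P <#\<^bsub>G\<^esub> B = g <#\<^bsub>G\<^esub> B" using r[OF P] by simp
      then have b: "inv (r ?P) \<otimes> g \<in> B" using c by (simp add: l_coset_eq_iff[OF B])
      have "r ?P \<otimes> (inv (r ?P) \<otimes> g) = g" using c by (simp flip: m_assoc)
      then have "z = f (?P, (inv (r ?P) \<otimes> g) <#\<^bsub>G\<^esub> C)" using f[OF P b] g by simp
      then show "z \<in> f ` ((\<lambda>g. g <#\<^bsub>G\<^esub> B) ` A \<times> (\<lambda>g. g <#\<^bsub>G\<^esub> C) ` B)" using P b by blast
    qed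
  qed
  then show thesis by (rule that)
qed

context contraction
begin

text \<open>The second premise puts the vertex \<open>pt n g\<close> on an axis of \<open>x\<close>; the only axis consists of the
  vertices \<open>pt n \<one>\<close>.\<close>

lemma axis_unique:
  assumes g: "g \<in> VV" and commutator: "inv g \<otimes> cj 1 g \<in> Vn n"
  shows "g \<in> Vn n"
proof -
  have gc: "g \<in> carrier G" using g VV_carrier by blast
  \<comment> \<open>Conjugation by \<open>x\<close> puts \<open>cj 1 g\<close> one level deeper than
    \<open>g\<close>; since the commutator is in \<open>Vn n\<close>, \<open>g\<close> itself gains
    that level until it reaches \<open>n\<close>.\<close>
  have "g \<in> Vn n" if "g \<in> Vn (n - int k)" for k
    using that
  proof (induction k)
    case (Suc k)
    have 1: "cj 1 g \<in> Vn (n - int k)"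
      using Suc.prems gc cj_Vn_iff[of g 1 "n - int k"] by (simp add: algebra_simps)
    have 2: "inv g \<otimes> cj 1 g \<in> Vn (n - int k)"
      using commutator Vn_antimono[of "n - int k" n] by auto
    have "cj 1 g \<otimes> inv (inv g \<otimes> cj 1 g) \<in> Vn (n - int k)"
      using 1 2 Vn_subgroup by (meson subgroup.m_closed subgroup.m_inv_closed)
    also have "cj 1 g \<otimes> inv (inv g \<otimes> cj 1 g) = g" using gc by (simp add: inv_mult_group)
    finally show ?case by (rule Suc.IH)
  qed simp
  moreover obtain m where "m \<le> n" "g \<in> Vn m" using VV_common_level[OF g g] by metis
  ultimately show ?thesis by (metis add_diff_cancel_left' diff_add_cancel diff_diff_eq2 zle_iff_zadd)
qed

lemma conj_cosets:
  assumes L: "L \<subseteq> carrier G"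
  shows "bij_betw ((`) (cj n)) ((\<lambda>g. g <#\<^bsub>G\<^esub> L) ` V) ((\<lambda>g. g <#\<^bsub>G\<^esub> cj n ` L) ` cj n ` V)"
proof (rule bij_betw_imageI)
  have "inj_on (cj n) (carrier G)" by (simp add: inj_on_def cj_inj)
  moreover have "(\<lambda>g. g <#\<^bsub>G\<^esub> L) ` V \<subseteq> Pow (carrier G)"
    using L V_carrier by (auto simp: l_coset_def)
  ultimately show "inj_on ((`) (cj n)) ((\<lambda>g. g <#\<^bsub>G\<^esub> L) ` V)"
    by (meson inj_on_image_Pow inj_on_subset)
  have "cj n ` (g <#\<^bsub>G\<^esub> L) = cj n g <#\<^bsub>G\<^esub> cj n ` L" if "g \<in> V" for g
    using that L V_carrier by (force simp: l_coset_def cj_mult)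
  then show "(`) (cj n) ` (\<lambda>g. g <#\<^bsub>G\<^esub> L) ` V = (\<lambda>g. g <#\<^bsub>G\<^esub> cj n ` L) ` cj n ` V"
    by (auto simp: image_image)
qed

end

locale topological_identification =
  identified_contraction G x V T \<omega> \<phi> q + topological_contraction G x V X
  for G (structure) and x V T \<omega> \<phi> q X
begin

text \<open>Write \<open>W\<close> for \<open>Vn 1\<close>. Then [L : xLx^-1] = [L : W][W : xLx^-1],
  and conjugation by \<open>x\<close> turns the second factor into [V : L], so the product is
  [V : W] = q.\<close>

lemma intermediate_index:
  assumes L: "subgroup L G" "Vn 1 \<subseteq> L" "L \<subseteq> V"
  shows "finite ((\<lambda>g. g <#\<^bsub>G\<^esub> conj_set G x L) ` L)"
    and "card ((\<lambda>g. g <#\<^bsub>G\<^esub> conj_set G x L) ` L) = q"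
proof -
  have Lc: "L \<subseteq> carrier G" using subgroup.subset[OF L(1)] .
  have "conj_set G x L \<subseteq> L" using L by (force simp: conj_set_x)
  then interpret L: contraction G x L
    by (intro contraction.intro contraction_axioms.intro is_group x_closed L(1))
  have xL: "subgroup (conj_set G x L) G" "conj_set G x L \<subseteq> Vn 1"
    using L.Vn_subgroup[of 1] L(3) by (auto simp: conj_set_x)
  obtain f1 where f1: "bij_betw f1 ((\<lambda>g. g <#\<^bsub>G\<^esub> L) ` V \<times> (\<lambda>g. g <#\<^bsub>G\<^esub> Vn 1) ` L) ((\<lambda>g. g <#\<^bsub>G\<^esub> Vn 1) ` V)"
    using index_tower[OF V L(1) Vn_subgroup L(2,3)] by blast
  obtain f2 where f2: "bij_betw f2 ((\<lambda>g. g <#\<^bsub>G\<^esub> Vn 1) ` L \<times> (\<lambda>g. g <#\<^bsub>G\<^esub> conj_set G x L) ` Vn 1)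
      ((\<lambda>g. g <#\<^bsub>G\<^esub> conj_set G x L) ` L)"
    using index_tower[OF L(1) Vn_subgroup xL(1,2) L(2)] by blast
  have f3: "bij_betw ((`) (cj 1)) ((\<lambda>g. g <#\<^bsub>G\<^esub> L) ` V) ((\<lambda>g. g <#\<^bsub>G\<^esub> conj_set G x L) ` Vn 1)"
    using conj_cosets[OF Lc, of 1] by (simp add: conj_set_x)
  have ne: "(\<lambda>g. g <#\<^bsub>G\<^esub> L) ` V \<noteq> {}" "(\<lambda>g. g <#\<^bsub>G\<^esub> Vn 1) ` L \<noteq> {}"
    using subgroup.one_closed V L(1) by blast+
  have "finite ((\<lambda>g. g <#\<^bsub>G\<^esub> Vn 1) ` V)" "card ((\<lambda>g. g <#\<^bsub>G\<^esub> Vn 1) ` V) = q"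
    using index_q unfolding lcosets_V by simp_all
  then have fin: "finite ((\<lambda>g. g <#\<^bsub>G\<^esub> L) ` V)" "finite ((\<lambda>g. g <#\<^bsub>G\<^esub> Vn 1) ` L)"
    and q1: "card ((\<lambda>g. g <#\<^bsub>G\<^esub> L) ` V) * card ((\<lambda>g. g <#\<^bsub>G\<^esub> Vn 1) ` L) = q"
    using bij_betw_finite[OF f1] bij_betw_same_card[OF f1] ne
    by (auto simp: finite_cartesian_product_iff card_cartesian_product)
  show "finite ((\<lambda>g. g <#\<^bsub>G\<^esub> conj_set G x L) ` L)"
    using bij_betw_finite[OF f2] bij_betw_finite[OF f3] fin by simp
  show "card ((\<lambda>g. g <#\<^bsub>G\<^esub> conj_set G x L) ` L) = q"
    using bij_betw_same_card[OF f2] bij_betw_same_card[OF f3] q1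
    by (simp add: card_cartesian_product mult.commute)
qed

text \<open>The inclusions of \<open>Vn (n + 1)\<close> in \<open>L.Vn n\<close> and of
  \<open>L.Vn n\<close> in \<open>Vn n\<close> give both chains the same union, so \<open>L\<close>
  yields a representation of the same semidirect product.\<close>

lemma intermediate_rep:
  assumes L: "subgroup L G" "Vn 1 \<subseteq> L" "L \<subseteq> V" and proper_L: "L \<noteq> Vn 1" "L \<noteq> V"
  obtains \<rho>' where "scale_group_rep G X VV x T \<omega> \<rho>'" "\<not> conjugate_reps G VV x T \<omega> rep \<rho>'"
proof -
  have Lc: "L \<subseteq> carrier G" using subgroup.subset[OF L(1)] .
  have "conj_set G x L \<subseteq> Vn 1" using L by (auto simp: conj_set_x)
  then have "conj_set G x L \<subseteq> L" "conj_set G x L \<noteq> L" using L proper_L(1) by auto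
  then interpret L: proper_contraction G x L
    by (intro proper_contraction.intro proper_contraction_axioms.intro contraction.intro
        contraction_axioms.intro is_group x_closed L(1))
  have LVn: "L.Vn n \<subseteq> Vn n" for n using L(3) by (auto simp: conj_set_def)
  have VnL: "Vn (n + 1) \<subseteq> L.Vn n" for n
  proof
    fix g assume g: "g \<in> Vn (n + 1)"
    then have gc: "g \<in> carrier G" by (rule Vn_carrier)
    then have "cj (- n) g \<in> Vn 1" using g cj_Vn_iff[of g "- n" 1] by (simp add: add.commute)
    then show "g \<in> L.Vn n" using L(2) gc by (auto simp: L.Vn_iff)
  qed
  have VV_eq: "L.VV = VV"
  proof
    show "L.VV \<subseteq> VV" using LVn by (auto simp: L.VV_def VV_def)
    have "Vn n \<subseteq> L.VV" for n using VnL[of "n - 1"] L.Vn_VV by auto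
    then show "VV \<subseteq> L.VV" by (auto simp: VV_def)
  qed
  have transl: "continuous_map X X ((\<otimes>) l)" if "l \<in> carrier G" for l
    using that continuous_mult'[of X "\<lambda>_. l" "\<lambda>g. g"] by (simp add: continuous_map_const)
  have coset: "g <#\<^bsub>G\<^esub> Vn 1 = (\<otimes>) g ` Vn 1" for g by (auto simp: l_coset_def)
  \<comment> \<open>\<open>L\<close> is a finite union of cosets of \<open>Vn 1\<close>, hence
    compact and open in \<open>VV\<close>.\<close>
  have L_Un: "L = \<Union>((\<lambda>g. g <#\<^bsub>G\<^esub> Vn 1) ` L)"
  proof
    show "L \<subseteq> \<Union>((\<lambda>g. g <#\<^bsub>G\<^esub> Vn 1) ` L)" using lcos_self[OF _ Vn_subgroup] Lc by blast
    show "\<Union>((\<lambda>g. g <#\<^bsub>G\<^esub> Vn 1) ` L) \<subseteq> L"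
      using L(2) subgroup.m_closed[OF L(1)] unfolding coset by blast
  qed
  interpret L: topological_contraction G x L X
  proof
    have "(\<lambda>g. g <#\<^bsub>G\<^esub> Vn 1) ` L \<subseteq> lcosets\<^bsub>G\<lparr>carrier := V\<rparr>\<^esub> (conj_set G x V)"
      unfolding lcosets_V using L(3) by blast
    then have "finite ((\<lambda>g. g <#\<^bsub>G\<^esub> Vn 1) ` L)" using index_q(1) finite_subset by blast
    moreover have "compactin X (l <#\<^bsub>G\<^esub> Vn 1)" if "l \<in> L" for l
      unfolding coset using that Lc by (intro image_compactin[OF Vn_compact transl]) blast
    ultimately have "compactin X (\<Union>((\<lambda>g. g <#\<^bsub>G\<^esub> Vn 1) ` L))" by (intro compactin_Union) blast+
    then show "compactin X L" using L_Un by simp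
    have "openin (subtopology X VV) (l <#\<^bsub>G\<^esub> Vn 1)" if l: "l \<in> L" for l
    proof -
      have lV: "l \<in> VV" "l \<in> carrier G" using l L(3) V_VV Lc by blast+
      have "continuous_map (subtopology X VV) (subtopology X VV) ((\<otimes>) (inv l))"
        unfolding continuous_map_in_subtopology topspace_VV
        using lV VV_mult VV_inv by (auto intro: continuous_map_from_subtopology transl)
      from openin_continuous_map_preimage[OF this Vn_open[of 1]]
      have "openin (subtopology X VV) {g \<in> VV. inv l \<otimes> g \<in> Vn 1}" unfolding topspace_VV .
      also have "{g \<in> VV. inv l \<otimes> g \<in> Vn 1} = l <#\<^bsub>G\<^esub> Vn 1"
      proof (intro subset_antisym subsetI)
        fix g assume "g \<in> {g \<in> VV. inv l \<otimes> g \<in> Vn 1}"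
        then have g: "g \<in> carrier G" "inv l \<otimes> g \<in> Vn 1" using VV_carrier by auto
        then have "g = l \<otimes> (inv l \<otimes> g)" using lV by simp
        then show "g \<in> l <#\<^bsub>G\<^esub> Vn 1" unfolding coset using g by blast
      next
        fix g assume "g \<in> l <#\<^bsub>G\<^esub> Vn 1"
        then obtain k where k: "k \<in> Vn 1" "g = l \<otimes> k" unfolding coset by blast
        then show "g \<in> {g \<in> VV. inv l \<otimes> g \<in> Vn 1}"
          using lV Vn_carrier[OF k(1)] VV_mult[OF lV(1) Vn_VV[OF k(1)]] by simp
      qed
      finally show ?thesis .
    qed
    then have "openin (subtopology X VV) (\<Union>((\<lambda>g. g <#\<^bsub>G\<^esub> Vn 1) ` L))" by blast
    then show "openin (subtopology X L.VV) L" using L_Un VV_eq by simp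
  qed
  have lcosets_L: "lcosets\<^bsub>G\<lparr>carrier := L\<rparr>\<^esub> (conj_set G x L) = (\<lambda>g. g <#\<^bsub>G\<^esub> conj_set G x L) ` L"
    by (auto simp: LCOSETS_def)
  have L_children: "finite {u \<in> L.Q. L.up u = v} \<and> card {u \<in> L.Q. L.up u = v} = q" if "v \<in> L.Q" for v
    using L.card_children[OF that] intermediate_index[OF L] unfolding lcosets_L by simp
  have pt_up: "L.up (L.pt (n + 1) \<one>) = L.pt n \<one>" "up' (\<phi> (pt (n + 1) \<one>)) = \<phi> (pt n \<one>)" for n
    using L.up_pt[OF one_closed, of "n + 1"] up_pt[OF one_closed, of "n + 1"]
    by (simp_all add: up'_\<phi> VV_one)
  \<comment> \<open>The coset trees of \<open>L\<close> and \<open>V\<close> both have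
    \<open>q\<close> children at each vertex, with the trivial cosets as axes. The isomorphism
    respects parents and hence the end.\<close>
  obtain \<psi> where \<psi>: "bij_betw \<psi> L.Q (verts T)" "\<And>v. v \<in> L.Q \<Longrightarrow> \<psi> (L.up v) = up' (\<psi> v)"
  proof (rule level_tree_isomorphism[of L.Q L.up fst "\<lambda>n. L.pt n \<one>" q "verts T" up' lev' "\<lambda>n. \<phi> (pt n \<one>)"])
    show "level_tree L.Q L.up fst" by (rule L.Q.level_tree_axioms)
    show "level_tree (verts T) up' lev'" by (rule level_tree_axioms)
  qed (use pt_up L_children T_children in \<open>simp_all add: L.VV_one VV_one \<phi>_in\<close>)
  interpret LR: coset_scale_rep G x L X T up' lev' \<omega> \<psi>
    by unfold_locales (simp_all add: \<psi>)
  have LR_Isom: "LR.rep p \<in> Isom T" if "p \<in> carrier (semidirect G VV x)" for p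
    using LR.rep_Isom[of p] that unfolding VV_eq .
  have LR_scale: "scale_group_rep G X VV x T \<omega> LR.rep"
    using LR.rep_scale_group_rep unfolding VV_eq .
  have "\<not> conjugate_reps G VV x T \<omega> rep LR.rep"
  proof
    assume "conjugate_reps G VV x T \<omega> rep LR.rep"
    then obtain \<sigma> where \<sigma>: "\<sigma> \<in> Isom_end T \<omega>"
      and conj: "\<And>p v. p \<in> carrier (semidirect G VV x) \<Longrightarrow> v \<in> verts T \<Longrightarrow> LR.rep p (\<sigma> v) = \<sigma> (rep p v)"
      using conjugate_reps_iff[of G VV x rep T LR.rep \<omega>, OF rep_Isom LR_Isom]
      by blast
    have \<sigma>_inj: "\<sigma> v = \<sigma> w \<longleftrightarrow> v = w" if "v \<in> verts T" "w \<in> verts T" for v w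
      using Isom_endD(1)[OF \<sigma>] that by (auto simp: Bij_def bij_betw_def inj_on_def)
    let ?v0 = "\<phi> (pt 0 \<one>)"
    have v0: "?v0 \<in> verts T" by (simp add: \<phi>_in VV_one)
    have "\<sigma> ?v0 \<in> verts T" using \<sigma> v0 by (auto simp: Isom_end_def intro: Isom_in_verts)
    then obtain n g where g: "\<sigma> ?v0 = \<psi> (L.pt n g)" "g \<in> VV"
      by (metis LR.\<psi>_cases L.Q_cases VV_eq)
    have gc: "g \<in> carrier G" using g VV_carrier by blast
    \<comment> \<open>The base vertex is the parent of its image under \<open>x\<close>. Transported
      by \<open>\<sigma>\<close>, this becomes the commutator condition of
      \<open>axis_unique\<close>, so \<open>\<sigma> ?v0\<close> is on the axis
      \<open>L.pt n \<one>\<close>.\<close>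
    have "rep (\<one>, x [^] (1::int)) ?v0 = \<phi> (pt 1 \<one>)"
      using rep_apply[of "pt 0 \<one>" \<one> 1] by (simp add: VV_one act_pt del: int_pow_1)
    then have "up' (rep (\<one>, x [^] (1::int)) ?v0) = ?v0" using pt_up(2)[of 0] by simp
    moreover have "rep (\<one>, x [^] (1::int)) ?v0 \<in> verts T"
      using Isom_in_verts[OF rep_Isom v0] VV_one by (simp only: semidirect_carrier_iff)
    ultimately have "up' (LR.rep (\<one>, x [^] (1::int)) (\<sigma> ?v0)) = \<sigma> ?v0"
      using conj[of "(\<one>, x [^] (1::int))" ?v0] Isom_endD(2)[OF \<sigma>] v0 VV_one
      by (metis semidirect_carrier_iff)
    moreover have "LR.rep (\<one>, x [^] (1::int)) (\<sigma> ?v0) = \<psi> (L.pt (n + 1) (cj 1 g))"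
      using LR.rep_pt[OF gc, of \<one> 1 n] g gc by (simp add: VV_eq VV_one del: int_pow_1)
    moreover have "up' (\<psi> (L.pt (n + 1) (cj 1 g))) = \<psi> (L.pt n (cj 1 g))"
      using \<psi>(2)[of "L.pt (n + 1) (cj 1 g)"] g gc by (simp add: VV_eq cj_VV L.up_pt)
    ultimately have "\<psi> (L.pt n g) = \<psi> (L.pt n (cj 1 g))" using g(1) by simp
    then have "inv g \<otimes> cj 1 g \<in> L.Vn n"
      using g gc by (simp add: LR.\<psi>_eq_iff VV_eq cj_VV L.pt_eq_iff)
    then have "g \<in> L.Vn n" using L.axis_unique g(2) VV_eq by blast
    then have "L.pt n g = L.pt n \<one>"
      using gc subgroup.m_inv_closed[OF L.Vn_subgroup] by (simp add: L.pt_eq_iff)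
    then have \<sigma>v0: "\<sigma> ?v0 = \<psi> (L.pt n \<one>)" using g(1) by simp
    \<comment> \<open>Conjugacy makes the stabilisers in \<open>VV\<close> of \<open>?v0\<close> and
      of \<open>\<sigma> ?v0\<close> equal.\<close>
    have "h \<in> V \<longleftrightarrow> h \<in> L.Vn n" if h: "h \<in> VV" for h
    proof -
      have p: "(h, x [^] (0::int)) \<in> carrier (semidirect G VV x)"
        using h by (simp only: semidirect_carrier_iff)
      have "h \<in> V \<longleftrightarrow> rep (h, x [^] (0::int)) ?v0 = ?v0"
        using h act_fixes_iff[OF h, of 0]
        by (simp add: rep_apply \<psi>_eq_iff act_in_Q VV_one del: int_pow_0) (simp only: Vn_0)
      also have "\<dots> \<longleftrightarrow> LR.rep (h, x [^] (0::int)) (\<sigma> ?v0) = \<sigma> ?v0"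
        using conj[OF p v0] \<sigma>_inj[OF Isom_in_verts[OF rep_Isom[OF p] v0] v0] by simp
      also have "\<dots> \<longleftrightarrow> h \<in> L.Vn n"
      proof -
        have hL: "h \<in> L.VV" and pt: "L.pt n \<one> \<in> L.Q" using h VV_eq L.VV_one by simp_all
        show ?thesis
          unfolding \<sigma>v0 LR.rep_apply[OF pt] LR.\<psi>_eq_iff[OF L.act_in_Q[OF hL pt] pt]
          by (rule L.act_fixes_iff[OF hL])
      qed
      finally show ?thesis .
    qed
    then have V_eq: "V = L.Vn n" using V_VV L.Vn_VV VV_eq by blast
    \<comment> \<open>The three ranges would give that \<open>V\<close> lies in \<open>Vn 1\<close>,
      that \<open>L = V\<close>, and that \<open>L\<close> lies in \<open>Vn 1\<close>,
      respectively.\<close>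
    consider "n \<ge> 1" | "n = 0" | "n \<le> - 1" by linarith
    then show False
    proof cases
      case 1
      then have "V \<subseteq> Vn 1" using V_eq L.Vn_antimono[of 1 n] LVn[of 1] by blast
      then show False using proper contract by (simp add: subset_antisym)
    next
      case 2
      then show False using V_eq L.Vn_0 proper_L by simp
    next
      case 3
      have "L \<subseteq> Vn 1"
      proof
        fix g assume g: "g \<in> L"
        then have gc: "g \<in> carrier G" using Lc by blast
        then have "cj (- 1) g \<in> L.Vn (- 1)" using g L.cj_Vn_iff[of g "- 1" "- 1"] by simp
        then have "cj (- 1) g \<in> V" using V_eq L.Vn_antimono[of n "- 1"] 3 by blast
        then show "g \<in> Vn 1" using gc unfolding Vn_iff by simp
      qed
      then show False using L proper_L by blast
    qed
  qed
  then show thesis using LR_scale that by blast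
qed

end

section \<open>Uniqueness of the representation when \<open>Vn 1\<close> is maximal in
  \<open>V\<close>\<close>

context topological_identification
begin

lemma unique_rep:
  assumes maximal: "\<And>K. \<lbrakk>subgroup K G; Vn 1 \<subseteq> K; K \<subseteq> V\<rbrakk> \<Longrightarrow> K = Vn 1 \<or> K = V"
    and \<rho>': "scale_group_rep G X VV x T \<omega> \<rho>'"
  shows "conjugate_reps G VV x T \<omega> rep \<rho>'"
proof -
  let ?S = "semidirect G VV x"
  have cont: "continuous_map (semidirect_topology G X VV x) (isom_topology T) \<rho>'"
    using \<rho>' by (simp add: scale_group_rep_def continuous_map_in_subtopology)
  have isom: "\<rho>' p \<in> Isom_end T \<omega>" if "p \<in> carrier ?S" for p
    using \<rho>' that by (auto simp: scale_group_rep_def hom_def IsomEndGroup_def)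
  then have isom': "\<rho>' p \<in> Isom T" if "p \<in> carrier ?S" for p
    using that by (simp add: Isom_end_def)
  have mult: "\<rho>' (p \<otimes>\<^bsub>?S\<^esub> p') v = \<rho>' p (\<rho>' p' v)"
    if "p \<in> carrier ?S" "p' \<in> carrier ?S" "v \<in> verts T" for p p' v
  proof -
    have "\<rho>' (p \<otimes>\<^bsub>?S\<^esub> p') = \<rho>' p \<otimes>\<^bsub>IsomEndGroup T \<omega>\<^esub> \<rho>' p'"
      using \<rho>' that by (simp add: scale_group_rep_def hom_def)
    also have "\<dots> = compose (verts T) (\<rho>' p) (\<rho>' p')"
      using isom'[OF that(1)] isom'[OF that(2)] by (simp add: IsomEndGroup_def BijGroup_def Isom_def)
    finally show ?thesis using that(3) by (simp add: compose_eq)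
  qed
  have one: "\<rho>' \<one>\<^bsub>?S\<^esub> v = v" if v: "v \<in> verts T" for v
  proof -
    interpret S: group ?S by (rule group_semidirect)
    \<comment> \<open>The image of the unit is idempotent and injective, hence the identity on
      vertices.\<close>
    have "\<rho>' \<one>\<^bsub>?S\<^esub> (\<rho>' \<one>\<^bsub>?S\<^esub> v) = \<rho>' \<one>\<^bsub>?S\<^esub> v" using mult[of "\<one>\<^bsub>?S\<^esub>" "\<one>\<^bsub>?S\<^esub>" v] v by simp
    moreover have "inj_on (\<rho>' \<one>\<^bsub>?S\<^esub>) (verts T)"
      using isom'[of "\<one>\<^bsub>?S\<^esub>"] by (simp add: Isom_def Bij_def bij_betw_def)
    ultimately show ?thesis using v Isom_in_verts[OF isom'[OF S.one_closed] v] by (auto dest: inj_onD)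
  qed
  define Y where "Y h = \<rho>' (h, x [^] (0::int))" for h
  define Z where "Z k = \<rho>' (\<one>, x [^] (k::int))" for k
  have in_S: "(h, x [^] (k::int)) \<in> carrier ?S \<longleftrightarrow> h \<in> VV" for h k
    by (rule semidirect_carrier_iff)
  have YZ: "\<rho>' (h, x [^] k) v = Y h (Z k v)" if "h \<in> VV" "v \<in> verts T" for h v and k :: int
    using mult[of "(h, x [^] (0::int))" "(\<one>, x [^] k)" v] that VV_one VV_carrier
    unfolding in_S semidirect_mult Y_def Z_def by simp
  have Y_in: "Y h v \<in> verts T" if "h \<in> VV" "v \<in> verts T" for h v
    unfolding Y_def by (rule Isom_in_verts[OF isom']) (use that in \<open>simp_all only: in_S\<close>)
  have Z_in: "Z k v \<in> verts T" if "v \<in> verts T" for k v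
    unfolding Z_def by (rule Isom_in_verts[OF isom']) (use that VV_one in \<open>simp_all only: in_S\<close>)
  interpret R: level_action G x V "verts T" up' lev' Y Z
  proof
    show "Y h v \<in> verts T" if "h \<in> VV" "v \<in> verts T" for h v using that by (rule Y_in)
    show "Z k v \<in> verts T" if "v \<in> verts T" for k v using that by (rule Z_in)
    show "Y h (up' v) = up' (Y h v)" if "h \<in> VV" "v \<in> verts T" for h v
      unfolding Y_def by (rule Isom_endD(2)[OF isom]) (use that in \<open>simp_all only: in_S\<close>)
    show "Z k (up' v) = up' (Z k v)" if "v \<in> verts T" for k v
      unfolding Z_def by (rule Isom_endD(2)[OF isom]) (use that VV_one in \<open>simp_all only: in_S\<close>)
    show "Y (h \<otimes> g) v = Y h (Y g v)" if "h \<in> VV" "g \<in> VV" "v \<in> verts T" for h g v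
      using mult[of "(h, x [^] (0::int))" "(g, x [^] (0::int))" v] that VV_carrier
      unfolding in_S semidirect_mult Y_def by simp
    show "Y \<one> v = v" if "v \<in> verts T" for v
      using one[OF that] unfolding semidirect_one Y_def .
    show "Z (k + l) v = Z k (Z l v)" if "v \<in> verts T" for k l v
      using mult[of "(\<one>, x [^] k)" "(\<one>, x [^] l)" v] that VV_one
      unfolding in_S semidirect_mult Z_def by simp
    show "Z 0 v = v" if "v \<in> verts T" for v
      using one[OF that] unfolding semidirect_one Z_def .
    show "Z k (Y h v) = Y (cj k h) (Z k v)" if "h \<in> VV" "v \<in> verts T" for h k v
    proof -
      have "Z k (Y h v) = \<rho>' (cj k h, x [^] k) v"
        using mult[of "(\<one>, x [^] k)" "(h, x [^] (0::int))" v] that VV_one VV_carrier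
        unfolding in_S semidirect_mult Y_def Z_def by simp
      then show ?thesis using YZ that cj_VV by simp
    qed
    show "finite ((\<lambda>h. Y h v) ` V)" if v: "v \<in> verts T" for v
    proof -
      \<comment> \<open>The orbit is a continuous image of the compact set \<open>V\<close> in a
        discrete space, hence finite.\<close>
      have "compactin (semidirect_topology G X VV x) (V \<times> {x [^] (0::int)})"
        using V_compact V_VV
        by (auto simp: semidirect_topology_def compactin_Times compactin_subtopology
            compactin_discrete_topology generate_x simp del: int_pow_0)
      then have "compactin (isom_topology T) (\<rho>' ` (V \<times> {x [^] (0::int)}))"
        using cont by (rule image_compactin)
      then have "compactin (discrete_topology (verts T)) ((\<lambda>\<sigma>. \<sigma> v) ` \<rho>' ` (V \<times> {x [^] (0::int)}))"
        using continuous_evaluation[OF v] by (rule image_compactin)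
      moreover have "(\<lambda>\<sigma>. \<sigma> v) ` \<rho>' ` (V \<times> {x [^] (0::int)}) = (\<lambda>h. Y h v) ` V"
        unfolding Y_def by force
      ultimately show ?thesis by (simp add: compactin_discrete_topology)
    qed
    show "\<exists>h\<in>VV. \<exists>k. Y h (Z k u) = v" if uv: "u \<in> verts T" "v \<in> verts T" for u v
    proof -
      obtain p where p: "p \<in> carrier ?S" "\<rho>' p u = v"
        using \<rho>' uv unfolding scale_group_rep_def scale_group_def by blast
      from p(1) obtain h k where hk: "p = (h, x [^] (k::int))" "h \<in> VV" by (rule semidirect_cases)
      then have "Y h (Z k u) = v" using YZ[OF hk(2) uv(1), of k] p(2) by simp
      then show ?thesis using hk(2) by blast
    qed
    show "\<exists>u\<in>verts T. \<exists>v\<in>verts T. u \<noteq> v \<and> up' u = up' v" by (rule T_branching)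
  qed
  obtain s where s: "bij_betw s Q (verts T)" "\<And>u. u \<in> Q \<Longrightarrow> s (up u) = up' (s u)"
    "\<And>h k u. h \<in> VV \<Longrightarrow> u \<in> Q \<Longrightarrow> s (act h k u) = Y h (Z k (s u))"
    using R.intertwiner[OF maximal] by blast
  \<comment> \<open>The intertwiner starts at the coset tree; composing with the inverse of
    \<open>\<phi>\<close> makes it a map of the tree to itself.\<close>
  define \<sigma> where "\<sigma> = restrict (s \<circ> inv_into Q \<phi>) (verts T)"
  have \<sigma>\<phi>: "\<sigma> (\<phi> u) = s u" if "u \<in> Q" for u
    using that by (simp add: \<sigma>_def \<phi>_in bij_betw_inv_into_left[OF \<phi>_bij])
  have "\<sigma> \<in> Isom_end T \<omega>"
  proof (rule Isom_endI)
    have "bij_betw (s \<circ> inv_into Q \<phi>) (verts T) (verts T)"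
      by (rule bij_betw_trans[OF bij_betw_inv_into[OF \<phi>_bij] s(1)])
    then show "\<sigma> \<in> Bij (verts T)" by (simp add: \<sigma>_def Bij_def)
    fix v assume "v \<in> verts T"
    then obtain u where u: "u \<in> Q" "v = \<phi> u" by (rule \<phi>_cases)
    then show "\<sigma> (up' v) = up' (\<sigma> v)" by (simp add: up'_\<phi> \<sigma>\<phi> Q.par_in s(2))
  qed
  moreover have "\<rho>' p (\<sigma> v) = \<sigma> (rep p v)" if p: "p \<in> carrier ?S" and v: "v \<in> verts T" for p v
  proof -
    from p obtain h k where hk: "p = (h, x [^] (k::int))" "h \<in> VV" by (rule semidirect_cases)
    from v obtain u where u: "u \<in> Q" "v = \<phi> u" by (rule \<phi>_cases)
    have "s u \<in> verts T" using bij_betw_apply[OF s(1) u(1)] .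
    then show ?thesis
      using hk(2) u(1) unfolding hk(1) u(2)
      by (simp add: \<sigma>\<phi> rep_apply act_in_Q s(3) YZ)
  qed
  ultimately have "\<exists>\<sigma>\<in>Isom_end T \<omega>. \<forall>p\<in>carrier ?S. \<forall>v\<in>verts T. \<rho>' p (\<sigma> v) = \<sigma> (rep p v)"
    by blast
  then show ?thesis by (subst conjugate_reps_iff) (simp_all add: rep_Isom isom')
qed

end

subsection \<open>Primitivity\<close>

text \<open>Invariant equivalence relations on the coset space correspond to subgroups between
  \<open>B\<close> and \<open>A\<close>: the subgroup consists of the elements that move the trivial
  coset within its class. Equality and the full relation correspond to \<open>B\<close> and
  \<open>A\<close>.\<close>

lemma (in group) primitive_left_translation_iff:
  assumes A: "subgroup A G" and B: "subgroup B G" and BA: "B \<subseteq> A"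
  defines "E \<equiv> (\<lambda>g. g <#\<^bsub>G\<^esub> B) ` A"
  shows "primitive_action (G\<lparr>carrier := A\<rparr>) E (left_translation G E) \<longleftrightarrow>
    (\<forall>K. subgroup K G \<and> B \<subseteq> K \<and> K \<subseteq> A \<longrightarrow> K = B \<or> K = A)"
proof -
  let ?t = "left_translation G E"
  note carr = subgroup.mem_carrier[OF A] subgroup.mem_carrier[OF B]
  have t: "?t g (h <#\<^bsub>G\<^esub> B) = (g \<otimes> h) <#\<^bsub>G\<^esub> B" if "g \<in> A" "h \<in> A" for g h
    using that carr subgroup.subset[OF B] by (auto simp: left_translation_def E_def lcos_m_assoc)
  have E_in: "g <#\<^bsub>G\<^esub> B \<in> E" if "g \<in> A" for g using that by (simp add: E_def)
  have E_cases: "\<exists>g\<in>A. C = g <#\<^bsub>G\<^esub> B" if "C \<in> E" for C using that by (auto simp: E_def)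
  have Bij: "?t g \<in> Bij E" if g: "g \<in> A" for g
  proof -
    have ig: "inv g \<in> A" using g subgroup.m_inv_closed[OF A] by blast
    have "bij_betw (?t g) E E"
    proof (rule bij_betwI)
      show "?t g \<in> E \<rightarrow> E" "?t (inv g) \<in> E \<rightarrow> E"
        using g ig subgroup.m_closed[OF A] by (auto dest!: E_cases simp: t E_in)
      show "?t (inv g) (?t g C) = C" "?t g (?t (inv g) C) = C" if "C \<in> E" for C
        using E_cases[OF that] g ig carr subgroup.m_closed[OF A] by (auto simp: t inv_mult_cancel)
    qed
    then show ?thesis by (simp add: Bij_def left_translation_def)
  qed
  have "transitive_action (G\<lparr>carrier := A\<rparr>) E ?t"
  proof (intro transitive_action.intro group_action.intro group_hom.intro group_hom_axioms.intro
      transitive_action_axioms.intro)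
    show "group (G\<lparr>carrier := A\<rparr>)" using A by (rule subgroup_imp_group)
    show "group (BijGroup E)" by (rule group_BijGroup)
    show "?t \<in> hom (G\<lparr>carrier := A\<rparr>) (BijGroup E)"
    proof (rule homI)
      show "?t g \<in> carrier (BijGroup E)" if "g \<in> carrier (G\<lparr>carrier := A\<rparr>)" for g
        using that Bij by (simp add: BijGroup_def)
      fix g h assume "g \<in> carrier (G\<lparr>carrier := A\<rparr>)" "h \<in> carrier (G\<lparr>carrier := A\<rparr>)"
      then have gh: "g \<in> A" "h \<in> A" by simp_all
      have "?t (g \<otimes> h) = compose E (?t g) (?t h)"
      proof (rule extensionalityI[of _ E])
        show "?t (g \<otimes> h) \<in> extensional E" by (simp add: left_translation_def)
        show "compose E (?t g) (?t h) \<in> extensional E" by simp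
        show "?t (g \<otimes> h) C = compose E (?t g) (?t h) C" if "C \<in> E" for C
          using E_cases[OF that] gh carr subgroup.m_closed[OF A]
          by (auto simp: t compose_eq that m_assoc E_in)
      qed
      then show "?t (g \<otimes>\<^bsub>G\<lparr>carrier := A\<rparr>\<^esub> h) = ?t g \<otimes>\<^bsub>BijGroup E\<^esub> ?t h"
        using gh Bij by (simp add: BijGroup_def)
    qed
    fix C D assume "C \<in> E" "D \<in> E"
    then obtain a b where ab: "a \<in> A" "b \<in> A" "C = a <#\<^bsub>G\<^esub> B" "D = b <#\<^bsub>G\<^esub> B"
      using E_cases by blast
    have "b \<otimes> inv a \<in> A" using ab A by (meson subgroup.m_closed subgroup.m_inv_closed)
    moreover have "b \<otimes> inv a \<otimes> a = b" using ab carr by (simp add: m_assoc)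
    ultimately show "\<exists>g\<in>carrier (G\<lparr>carrier := A\<rparr>). ?t g C = D"
      using ab by (intro bexI[of _ "b \<otimes> inv a"]) (simp_all add: t)
  qed
  moreover have "(\<forall>R. equiv E R \<and> (\<forall>g\<in>A. \<forall>(a, b)\<in>R. (?t g a, ?t g b) \<in> R) \<longrightarrow> R = Id_on E \<or> R = E \<times> E)
    \<longleftrightarrow> (\<forall>K. subgroup K G \<and> B \<subseteq> K \<and> K \<subseteq> A \<longrightarrow> K = B \<or> K = A)" (is "?L \<longleftrightarrow> ?R")
  proof
    assume ?L
    show ?R
    proof (intro allI impI)
      fix K assume K: "subgroup K G \<and> B \<subseteq> K \<and> K \<subseteq> A"
      then have KG: "subgroup K G" and BK: "B \<subseteq> K" and KA: "K \<subseteq> A" by auto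
      \<comment> \<open>Two cosets of \<open>B\<close> are related when they lie in the same left
        coset of \<open>K\<close>.\<close>
      define R where "R = {(a <#\<^bsub>G\<^esub> B, b <#\<^bsub>G\<^esub> B) | a b. a \<in> A \<and> b \<in> A \<and> inv a \<otimes> b \<in> K}"
      have R_iff: "(a <#\<^bsub>G\<^esub> B, b <#\<^bsub>G\<^esub> B) \<in> R \<longleftrightarrow> inv a \<otimes> b \<in> K" if ab: "a \<in> A" "b \<in> A" for a b
      proof
        assume "(a <#\<^bsub>G\<^esub> B, b <#\<^bsub>G\<^esub> B) \<in> R"
        then obtain a' b' where ab': "a' \<in> A" "b' \<in> A" "inv a' \<otimes> b' \<in> K"
          "a <#\<^bsub>G\<^esub> B = a' <#\<^bsub>G\<^esub> B" "b' <#\<^bsub>G\<^esub> B = b <#\<^bsub>G\<^esub> B" by (auto simp: R_def)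
        note c = carr(1)[OF ab(1)] carr(1)[OF ab(2)] carr(1)[OF ab'(1)] carr(1)[OF ab'(2)]
        have "inv a \<otimes> a' \<in> K" "inv b' \<otimes> b \<in> K"
          using ab' c BK by (auto simp: l_coset_eq_iff[OF B])
        then have "inv a \<otimes> a' \<otimes> (inv a' \<otimes> b') \<otimes> (inv b' \<otimes> b) \<in> K"
          using ab'(3) by (meson KG subgroup.m_closed)
        also have "inv a \<otimes> a' \<otimes> (inv a' \<otimes> b') \<otimes> (inv b' \<otimes> b) = inv a \<otimes> b"
          using c by (simp add: m_assoc inv_mult_cancel)
        finally show "inv a \<otimes> b \<in> K" .
      qed (use ab R_def in blast)
      have R_E: "R \<subseteq> E \<times> E" by (auto simp: R_def E_in)
      have "equiv E R"
      proof (rule equivI)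
        show "R \<subseteq> E \<times> E" by (rule R_E)
        show "refl_on E R"
          using subgroup.one_closed[OF KG] carr by (auto intro!: refl_onI dest!: E_cases simp: R_iff)
        show "sym R"
        proof (rule symI)
          fix C D assume CD: "(C, D) \<in> R"
          then obtain a b where ab: "a \<in> A" "b \<in> A" "C = a <#\<^bsub>G\<^esub> B" "D = b <#\<^bsub>G\<^esub> B" using R_def by auto
          then have "inv (inv a \<otimes> b) \<in> K" using CD R_iff subgroup.m_inv_closed[OF KG] by simp
          then show "(D, C) \<in> R" using ab carr by (simp add: R_iff inv_mult_group)
        qed
        show "trans R"
        proof (rule transI)
          fix C D F assume CDF: "(C, D) \<in> R" "(D, F) \<in> R"
          then have "C \<in> E" "D \<in> E" "F \<in> E" using R_E by auto
          then obtain a b c where abc: "a \<in> A" "b \<in> A" "c \<in> A"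
            "C = a <#\<^bsub>G\<^esub> B" "D = b <#\<^bsub>G\<^esub> B" "F = c <#\<^bsub>G\<^esub> B"
            by (auto dest!: E_cases)
          then have "inv a \<otimes> b \<otimes> (inv b \<otimes> c) \<in> K"
            using CDF R_iff subgroup.m_closed[OF KG] by simp
          also have "inv a \<otimes> b \<otimes> (inv b \<otimes> c) = inv a \<otimes> c"
            using abc carr by (simp add: m_assoc inv_mult_cancel)
          finally show "(C, F) \<in> R" using abc by (simp add: R_iff)
        qed
      qed
      moreover have "\<forall>g\<in>A. \<forall>(C, D)\<in>R. (?t g C, ?t g D) \<in> R"
      proof (intro ballI, clarify)
        fix g C D assume g: "g \<in> A" and CD: "(C, D) \<in> R"
        then have "C \<in> E" "D \<in> E" using R_E by auto
        then obtain a b where ab: "a \<in> A" "b \<in> A" "C = a <#\<^bsub>G\<^esub> B" "D = b <#\<^bsub>G\<^esub> B"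
          by (auto dest!: E_cases)
        have "inv (g \<otimes> a) \<otimes> (g \<otimes> b) = inv a \<otimes> b"
          using g ab carr by (simp add: inv_mult_group m_assoc inv_mult_cancel)
        then show "(?t g C, ?t g D) \<in> R"
          using CD g ab subgroup.m_closed[OF A] by (simp add: t R_iff)
      qed
      ultimately have "R = Id_on E \<or> R = E \<times> E" using \<open>?L\<close> by blast
      then show "K = B \<or> K = A"
      proof
        assume R: "R = Id_on E"
        have "K \<subseteq> B"
        proof
          fix k assume k: "k \<in> K"
          then have kA: "k \<in> A" "\<one> \<in> A" using KA subgroup.one_closed[OF A] by auto
          then have "(\<one> <#\<^bsub>G\<^esub> B, k <#\<^bsub>G\<^esub> B) \<in> R" using k carr by (simp add: R_iff)
          then have "\<one> <#\<^bsub>G\<^esub> B = k <#\<^bsub>G\<^esub> B" using R by (simp add: Id_on_iff)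
          then show "k \<in> B" using kA carr by (simp add: l_coset_eq_iff[OF B])
        qed
        then show ?thesis using BK by blast
      next
        assume R: "R = E \<times> E"
        have "A \<subseteq> K"
        proof
          fix a assume a: "a \<in> A"
          have "\<one> \<in> A" using subgroup.one_closed[OF A] .
          then show "a \<in> K" using R_iff[of \<one> a] a R carr by (simp add: E_in)
        qed
        then show ?thesis using KA by blast
      qed
    qed
  next
    assume ?R
    show ?L
    proof (intro allI impI)
      fix R assume "equiv E R \<and> (\<forall>g\<in>A. \<forall>(a, b)\<in>R. (?t g a, ?t g b) \<in> R)"
      then have eq: "equiv E R" and inv: "\<And>g a b. g \<in> A \<Longrightarrow> (a, b) \<in> R \<Longrightarrow> (?t g a, ?t g b) \<in> R"
        by auto
      have R_E: "R \<subseteq> E \<times> E" and R_sym: "\<And>C D. (C, D) \<in> R \<Longrightarrow> (D, C) \<in> R"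
        and R_trans: "\<And>C D F. (C, D) \<in> R \<Longrightarrow> (D, F) \<in> R \<Longrightarrow> (C, F) \<in> R"
        and R_refl: "\<And>C. C \<in> E \<Longrightarrow> (C, C) \<in> R"
        using eq by (auto simp: equiv_def refl_on_def dest: symD transD)
      have oneA: "\<one> \<in> A" using subgroup.one_closed[OF A] .
      let ?b = "\<one> <#\<^bsub>G\<^esub> B"
      define K where "K = {g \<in> A. (?b, g <#\<^bsub>G\<^esub> B) \<in> R}"
      have R_iff: "(a <#\<^bsub>G\<^esub> B, c <#\<^bsub>G\<^esub> B) \<in> R \<longleftrightarrow> inv a \<otimes> c \<in> K" if ac: "a \<in> A" "c \<in> A" for a c
      proof -
        have ia: "inv a \<in> A" "inv a \<otimes> c \<in> A"
          using ac A by (meson subgroup.m_closed subgroup.m_inv_closed)+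
        have "(?b, (inv a \<otimes> c) <#\<^bsub>G\<^esub> B) \<in> R" if "(a <#\<^bsub>G\<^esub> B, c <#\<^bsub>G\<^esub> B) \<in> R"
          using inv[OF ia(1) that] ac ia carr by (simp add: t)
        moreover have "(a <#\<^bsub>G\<^esub> B, c <#\<^bsub>G\<^esub> B) \<in> R" if "(?b, (inv a \<otimes> c) <#\<^bsub>G\<^esub> B) \<in> R"
          using inv[OF ac(1) that] ac ia oneA carr by (simp add: t inv_mult_cancel)
        ultimately show ?thesis using ia by (auto simp: K_def)
      qed
      have "subgroup K G"
      proof (rule subgroupI)
        show "K \<subseteq> carrier G" using carr by (auto simp: K_def)
        show "K \<noteq> {}" using oneA R_refl E_in by (auto simp: K_def)
        fix a assume a: "a \<in> K"
        then have aA: "a \<in> A" "a \<in> carrier G" and ab: "(?b, a <#\<^bsub>G\<^esub> B) \<in> R" using carr by (auto simp: K_def)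
        show "inv a \<in> K" using R_iff[of a \<one>] R_sym[OF ab] aA oneA by simp
        fix c assume c: "c \<in> K"
        then have cA: "c \<in> A" "c \<in> carrier G" and cb: "(?b, c <#\<^bsub>G\<^esub> B) \<in> R" using carr by (auto simp: K_def)
        have acA: "a \<otimes> c \<in> A" using aA cA subgroup.m_closed[OF A] by blast
        have "(a <#\<^bsub>G\<^esub> B, (a \<otimes> c) <#\<^bsub>G\<^esub> B) \<in> R"
          using inv[OF aA(1) cb] aA cA oneA by (simp add: t)
        then have "(?b, (a \<otimes> c) <#\<^bsub>G\<^esub> B) \<in> R" using R_trans ab by blast
        then show "a \<otimes> c \<in> K" using acA by (simp add: K_def)
      qed
      moreover have "B \<subseteq> K"
      proof
        fix k assume k: "k \<in> B"
        then have "?b = k <#\<^bsub>G\<^esub> B" using carr by (simp add: l_coset_eq_iff[OF B])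
        then show "k \<in> K" using k BA R_refl[of ?b] oneA E_in by (auto simp: K_def)
      qed
      moreover have "K \<subseteq> A" by (auto simp: K_def)
      ultimately consider "K = B" | "K = A" using \<open>?R\<close> by blast
      then show "R = Id_on E \<or> R = E \<times> E"
      proof cases
        case 1
        have "C = D" if CD: "(C, D) \<in> R" for C D
        proof -
          have "C \<in> E" "D \<in> E" using CD R_E by auto
          then obtain a c where ac: "a \<in> A" "c \<in> A" "C = a <#\<^bsub>G\<^esub> B" "D = c <#\<^bsub>G\<^esub> B"
            by (auto dest!: E_cases)
          then have "inv a \<otimes> c \<in> B" using CD R_iff 1 by simp
          then show ?thesis using ac carr by (simp add: l_coset_eq_iff[OF B])
        qed
        then have "R \<subseteq> Id_on E" using R_E by (intro subrelI) (auto simp: Id_on_iff)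
        moreover have "Id_on E \<subseteq> R" using R_refl by (auto simp: Id_on_def)
        ultimately show ?thesis by blast
      next
        case 2
        have "(C, D) \<in> R" if CD: "C \<in> E" "D \<in> E" for C D
        proof -
          obtain a c where ac: "a \<in> A" "c \<in> A" "C = a <#\<^bsub>G\<^esub> B" "D = c <#\<^bsub>G\<^esub> B"
            using CD by (auto dest!: E_cases)
          have "inv a \<otimes> c \<in> A" using ac A by (meson subgroup.m_closed subgroup.m_inv_closed)
          then show ?thesis using ac R_iff 2 by simp
        qed
        then show ?thesis using R_E by auto
      qed
    qed
  qed
  ultimately show ?thesis by (simp add: primitive_action_def)
qed

subsection \<open>The contracted subgroup\<close>

text \<open>As a closed subspace, \<open>VV\<close> is locally compact Hausdorff, and it is a
  countable union of the compact groups \<open>Vn n\<close>. By Baire category one of them has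
  interior, so this subgroup is open, and conjugating by a power of \<open>x\<close> shows that
  \<open>V\<close> is open.\<close>

lemma open_of_closed_union:
  fixes G (structure)
  assumes "contraction G x V" "tdlc_group G X" "compactin X V"
    and closed: "closedin X (contraction.VV G x V)"
  shows "openin (subtopology X (contraction.VV G x V)) V"
proof -
  interpret contraction G x V by fact
  interpret tdlc_group G X by fact
  let ?Y = "subtopology X VV"
  have topspace_Y: "topspace ?Y = VV" using VV_carrier by (auto simp: topspace_eq)
  have cont_cj: "continuous_map X X (cj n)" for n
    unfolding cj_def by (rule continuous_translation) auto
  have "compactin X (Vn n)" for n
    unfolding conj_set_pow by (rule image_compactin[OF \<open>compactin X V\<close> cont_cj])
  then have Vn_closed: "closedin ?Y (Vn n)" for n
    using compactin_imp_closedin[OF Hausdorff] Vn_VV by (auto intro: closedin_subset_topspace)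
  have "\<exists>n. ?Y interior_of (Vn n) \<noteq> {}"
  proof (rule ccontr)
    assume none: "\<not> (\<exists>n. ?Y interior_of (Vn n) \<noteq> {})"
    have "locally_compact_space ?Y"
      using locally_compact closed by (rule locally_compact_space_closed_subset)
    moreover have "Hausdorff_space ?Y" by (rule Hausdorff_space_subtopology[OF Hausdorff])
    ultimately have "?Y interior_of \<Union>(range (\<lambda>n. Vn n)) = {}"
      using none Vn_closed locally_compact_Hausdorff_imp_regular_space
      by (intro Baire_category_alt) auto
    moreover have "\<Union>(range (\<lambda>n. Vn n)) = topspace ?Y" unfolding topspace_Y by (simp only: VV_def)
    ultimately have "?Y interior_of (topspace ?Y) = {}" by (simp only:)
    then show False using VV_one topspace_Y by (metis emptyE interior_of_topspace)
  qed
  then obtain n g where g: "g \<in> ?Y interior_of (Vn n)" by blast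
  let ?N = "?Y interior_of (Vn n)"
  have gn: "g \<in> Vn n" using g interior_of_subset by fast
  have "openin ?Y (Vn n)"
  proof (subst openin_subopen, rule ballI)
    fix h assume h: "h \<in> Vn n"
    have hc: "h \<in> carrier G" "g \<in> carrier G" using h gn Vn_carrier by auto
    have a: "g \<otimes> inv h \<in> Vn n"
      using gn h Vn_subgroup by (meson subgroup.m_closed subgroup.m_inv_closed)
    \<comment> \<open>Left multiplication by \<open>g \<otimes> inv h\<close> takes \<open>h\<close>
      to the interior point \<open>g\<close>, so the preimage of the interior is a neighbourhood of
      \<open>h\<close> inside the subgroup.\<close>
    have "continuous_map ?Y ?Y (\<lambda>y. g \<otimes> inv h \<otimes> y \<otimes> \<one>)"
      unfolding continuous_map_in_subtopology topspace_Y
      using a hc Vn_VV VV_carrier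
      by (auto intro!: continuous_map_from_subtopology continuous_translation simp: VV_mult)
    from openin_continuous_map_preimage[OF this openin_interior_of]
    have "openin ?Y {y \<in> VV. g \<otimes> inv h \<otimes> y \<otimes> \<one> \<in> ?N}" unfolding topspace_Y .
    moreover have "h \<in> {y \<in> VV. g \<otimes> inv h \<otimes> y \<otimes> \<one> \<in> ?N}"
      using g hc Vn_VV[OF h] by (simp add: m_assoc)
    moreover have "{y \<in> VV. g \<otimes> inv h \<otimes> y \<otimes> \<one> \<in> ?N} \<subseteq> Vn n"
    proof
      fix y assume "y \<in> {y \<in> VV. g \<otimes> inv h \<otimes> y \<otimes> \<one> \<in> ?N}"
      then have y: "y \<in> carrier G" "g \<otimes> inv h \<otimes> y \<in> Vn n"
        using VV_carrier interior_of_subset[of ?Y "Vn n"] hc by auto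
      have "inv (g \<otimes> inv h) \<otimes> (g \<otimes> inv h \<otimes> y) \<in> Vn n"
        using a y Vn_subgroup by (meson subgroup.m_closed subgroup.m_inv_closed)
      then show "y \<in> Vn n" using y(1) hc by simp
    qed
    ultimately show "\<exists>W. openin ?Y W \<and> h \<in> W \<and> W \<subseteq> Vn n" by blast
  qed
  moreover have "continuous_map ?Y ?Y (cj n)"
    using continuous_map_from_subtopology[OF cont_cj] cj_VV
    by (auto simp: continuous_map_in_subtopology topspace_Y)
  ultimately have "openin ?Y {y \<in> topspace ?Y. cj n y \<in> Vn n}"
    by (rule openin_continuous_map_preimage[rotated])
  also have "{y \<in> topspace ?Y. cj n y \<in> Vn n} = V"
    unfolding topspace_Y using VV_carrier V_VV by (auto simp: Vn_iff)
  finally show ?thesis .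
qed

lemma (in group) conj_set_subgroup:
  assumes "a \<in> carrier G" "subgroup U G"
  shows "subgroup (conj_set G a U) G"
proof (rule subgroupI)
  note carr = subgroup.mem_carrier[OF assms(2)]
  show "conj_set G a U \<subseteq> carrier G" using assms(1) carr by (auto simp: conj_set_def)
  show "conj_set G a U \<noteq> {}" using subgroup.one_closed[OF assms(2)] by (auto simp: conj_set_def)
  fix g assume "g \<in> conj_set G a U"
  then obtain u where u: "u \<in> U" "g = a \<otimes> u \<otimes> inv a" by (auto simp: conj_set_def)
  then have "inv g = a \<otimes> inv u \<otimes> inv a"
    using assms(1) carr by (simp add: inv_mult_group m_assoc)
  then show "inv g \<in> conj_set G a U"
    using u subgroup.m_inv_closed[OF assms(2)] unfolding conj_set_def by blast
  fix h assume "h \<in> conj_set G a U"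
  then obtain w where w: "w \<in> U" "h = a \<otimes> w \<otimes> inv a" by (auto simp: conj_set_def)
  then have "g \<otimes> h = a \<otimes> (u \<otimes> w) \<otimes> inv a"
    using u assms(1) carr by (simp add: m_assoc inv_mult_cancel)
  then show "g \<otimes> h \<in> conj_set G a U"
    using u w subgroup.m_closed[OF assms(2)] unfolding conj_set_def by blast
qed

lemma (in group) conj_set_conj_set:
  assumes "a \<in> carrier G" "b \<in> carrier G" "U \<subseteq> carrier G"
  shows "conj_set G a (conj_set G b U) = conj_set G (a \<otimes> b) U"
  unfolding conj_set_def image_image
  using assms by (intro image_cong) (auto simp: inv_mult_group m_assoc subset_iff)

text \<open>Conjugation by \<open>x\<close> turns the term with index \<open>n + 1\<close> of the
  defining intersection into the term with index \<open>n\<close>, so the conjugated intersection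
  lies in every term.\<close>

lemma minus_part_contraction:
  assumes "group G" "x \<in> carrier G" "subgroup U G"
  shows "contraction G x (minus_part G x U)"
proof -
  interpret group G by fact
  have "subgroup (minus_part G x U) G"
    unfolding minus_part_def
    by (intro subgroups_Inter) (use assms conj_set_subgroup in auto)
  moreover have "conj_set G x (minus_part G x U) \<subseteq> minus_part G x U"
    unfolding minus_part_def
  proof (rule INT_greatest)
    fix n :: nat
    have "conj_set G x (\<Inter>n. conj_set G (x [^]\<^bsub>G\<^esub> (- int n)) U)
        \<subseteq> conj_set G x (conj_set G (x [^]\<^bsub>G\<^esub> (- int (Suc n))) U)"
      unfolding conj_set_def by blast
    also have "\<dots> = conj_set G (x [^]\<^bsub>G\<^esub> (1::int) \<otimes>\<^bsub>G\<^esub> x [^]\<^bsub>G\<^esub> (- int (Suc n))) U"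
      using assms subgroup.subset[OF assms(3)] by (simp only: int_pow_1 conj_set_conj_set int_pow_closed)
    also have "x [^]\<^bsub>G\<^esub> (1::int) \<otimes>\<^bsub>G\<^esub> x [^]\<^bsub>G\<^esub> (- int (Suc n)) = x [^]\<^bsub>G\<^esub> (- int n)"
      using assms int_pow_mult[of x 1 "- int (Suc n)"] by simp
    finally show "conj_set G x (\<Inter>n. conj_set G (x [^]\<^bsub>G\<^esub> (- int n)) U)
        \<subseteq> conj_set G (x [^]\<^bsub>G\<^esub> (- int n)) U" .
  qed
  ultimately show ?thesis
    using assms by (intro contraction.intro contraction_axioms.intro)
qed

lemma minus_part_compact:
  assumes "tdlc_group G X" "x \<in> carrier G" "compactin X U"
  shows "compactin X (minus_part G x U)"
proof -
  interpret tdlc_group G X by fact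
  have "compactin X (conj_set G (x [^]\<^bsub>G\<^esub> n) U)" for n :: int
    unfolding conj_set_def using assms
    by (intro image_compactin[OF assms(3) continuous_translation]) auto
  then show ?thesis
    unfolding minus_part_def
    by (rule closed_compactin_Inter[OF _ rangeI[of _ 0]])
      (use compactin_imp_closedin[OF Hausdorff] \<open>\<And>n. compactin X (conj_set G (x [^]\<^bsub>G\<^esub> n) U)\<close> in blast)
qed

section \<open>From tidiness to the equivalence of uniqueness and primitivity\<close>

theorem proposition4p6:
  fixes G :: "('a, 'm) monoid_scheme" and X :: "'a topology"
    and x :: 'a and U V H :: "'a set" and q :: nat
    and T :: "'v ugraph" and \<omega> :: "(nat \<Rightarrow> 'v) set"
    and \<phi> :: "int \<times> 'a set \<Rightarrow> 'v" and \<rho> :: "'a \<times> 'a \<Rightarrow> 'v \<Rightarrow> 'v"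
  assumes "tdlc_group G X"
    and "x \<in> carrier G"
    and "compact_open_subgroup G X U" and "tidy G X x U"
    and "group_scale G X (inv\<^bsub>G\<^esub> x) = q" and "q > 1"
    and "V = minus_part G x U" and "H = minus_minus_part G x U"
    and "regular_tree (q + 1) T" and "\<omega> \<in> ends T"
    and "tree_identification G H x V T \<omega> \<phi>"
    and "\<rho> = coset_rep G H x V T \<phi>"
  shows "(\<forall>\<rho>'. scale_group_rep G X H x T \<omega> \<rho>' \<longrightarrow> conjugate_reps G H x T \<omega> \<rho> \<rho>') \<longleftrightarrow>
    primitive_action (G\<lparr>carrier := V\<rparr>) (lcosets\<^bsub>G\<lparr>carrier := V\<rparr>\<^esub> (conj_set G x V))
      (left_translation G (lcosets\<^bsub>G\<lparr>carrier := V\<rparr>\<^esub> (conj_set G x V)))"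
proof -
  interpret tdlc_group G X by fact
  have U: "subgroup U G" "compactin X U"
    using assms(3) by (simp_all add: compact_open_subgroup_def)
  interpret contraction G x V
    unfolding assms(7) using is_group assms(2) U(1) by (rule minus_part_contraction)
  have H: "H = VV" by (simp only: assms(8) minus_minus_part_def VV_def flip: assms(7))
  have V_compact: "compactin X V"
    unfolding assms(7) using assms(1,2) U(2) by (rule minus_part_compact)
  \<comment> \<open>Tidiness provides the closedness required by the Baire argument.\<close>
  have "closedin X VV" using assms(4) H assms(8) by (simp add: tidy_def)
  then have V_open: "openin (subtopology X VV) V"
    using contraction_axioms assms(1) V_compact by (intro open_of_closed_union)
  interpret identified_contraction G x V T \<omega> \<phi> q
    using assms(6,9-11) H by unfold_locales simp_all
  interpret topological_identification G x V T \<omega> \<phi> q X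
    using V_compact V_open by unfold_locales
  have \<rho>: "\<rho> = rep" by (simp add: assms(12) H)
  \<comment> \<open>Uniqueness and primitivity are both compared with the absence of subgroups
    strictly between \<open>Vn 1\<close> and \<open>V\<close>.\<close>
  have "(\<forall>\<rho>'. scale_group_rep G X VV x T \<omega> \<rho>' \<longrightarrow> conjugate_reps G VV x T \<omega> rep \<rho>') \<longleftrightarrow>
      (\<forall>K. subgroup K G \<and> Vn 1 \<subseteq> K \<and> K \<subseteq> V \<longrightarrow> K = Vn 1 \<or> K = V)" (is "?L \<longleftrightarrow> ?R")
  proof
    assume ?L
    show ?R
    proof (intro allI impI, rule ccontr)
      fix K assume "subgroup K G \<and> Vn 1 \<subseteq> K \<and> K \<subseteq> V" "\<not> (K = Vn 1 \<or> K = V)"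
      then obtain \<rho>' where "scale_group_rep G X VV x T \<omega> \<rho>'" "\<not> conjugate_reps G VV x T \<omega> rep \<rho>'"
        using intermediate_rep[of K] by blast
      with \<open>?L\<close> show False by blast
    qed
  next
    assume ?R
    then show ?L using unique_rep by blast
  qed
  also have "\<dots> \<longleftrightarrow> primitive_action (G\<lparr>carrier := V\<rparr>) ((\<lambda>g. g <#\<^bsub>G\<^esub> Vn 1) ` V)
      (left_translation G ((\<lambda>g. g <#\<^bsub>G\<^esub> Vn 1) ` V))"
    using primitive_left_translation_iff[OF V Vn_subgroup[of 1]] Vn_antimono[of 0 1] Vn_0 by simp
  finally show ?thesis unfolding H \<rho> lcosets_V .
qed

end
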